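(* Let $(\Omega,\sigma)$ be a minimal continuous flow on a compact metric space, let $a,b:\Omega\to\mathbb{R}$ be continuous, and let $g:\Omega\times\mathbb{R}\to\mathbb{R}$ satisfy: - the partial derivative $g_x$ exists, and $g,g_x$ are continuous on $\Omega\times\mathbb{R}$; - there exist real numbers $r_1\le r_2$ such that $g(\omega,x)=0$ if $r_1\le x\le r_2$, $g(\omega,x)>0$ if $x<r_1$, $g(\omega,x)<0$ if $x>r_2$, and, in case $r_1=r_2$, $g_x(\omega,r_1)=0$ for all $\omega\in\Omega$; - $\lim_{x\to\pm\infty}g(\omega,x)/x=-\infty$ uniformly on $\Omega$; - $g_x(\omega,x)<0$ whenever $x\notin[r_1,r_2]$. Let $(\Omega\times\mathbb{R},\tau)$ be the flow induced by the family $x'=a(\omega\cdot t)\,x+b(\omega\cdot t)+g(\omega\cdot t,x)$, $\omega\in\Omega$, let $\mathcal{A}=\bigcup_{\omega\in\Omega}\big(\{\omega\}\times[\alpha_{\mathcal{A}}(\omega),\beta_{\mathcal{A}}(\omega)]\big)$ be its global attractor, let $\Omega_c$ be the set of common continuity points of $\alpha_{\mathcal{A}}$ and $\beta_{\mathcal{A}}$, and let $\mathcal{M}^\alpha,\mathcal{M}^\beta$ be the $\tau$-minimal sets associated with $\alpha_{\mathcal{A}},\beta_{\mathcal{A}}$ (defined in the context). Assume also that $\sup\Sigma_a=0$, and that $\mathcal{A}$ is a pinched set. Then $\Omega_c=\{\omega\in\Omega : \alpha_{\mathcal{A}}(\omega)=\beta_{\mathcal{A}}(\omega)\}$, and $\mathcal{M}:=\mathcal{M}^\alpha=\mathcal{M}^\beta$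 is the unique $\tau$-minimal set. In addition: (i) $\mathcal{M}\not\subset\Omega\times[r_1,r_2]$ if and only if there exists $\omega\in\Omega_c$ such that $\alpha_{\mathcal{A}}(\omega)<r_1$ or $\beta_{\mathcal{A}}(\omega)>r_2$. In this case, $\mathcal{A}=\mathcal{M}$ is a uniformly exponentially stable at $+\infty$ copy of the base: the graph of the continuous function $\alpha_{\mathcal{A}}=\beta_{\mathcal{A}}$. (ii) If $\mathcal{M}\subseteq\Omega\times[r_1,r_2]$, then its upper Lyapunov exponent is $0$. (iii) If $\mathcal{M}\subseteq\Omega\times[r_1,r_2]$ and the map $a$ has a continuous primitive, then $\mathcal{A}=\mathcal{M}=\{\alpha_{\mathcal{A}}\}=\{\beta_{\mathcal{A}}\}$. In addition, in this case, $\inf\{\alpha_{\mathcal{A}}(\omega) : \omega\in\Omega\}=r_1$ and $\sup\{\alpha_{\mathcal{A}}(\omega) : \omega\in\Omega\}=r_2$. (iv) If $r_1=r_2=:r$ and $\mathcal{M}=\{r\}$ (i.e. $\mathcal{M}=\Omega\times\{r\}$), then $\Omega_c$ has complete measure. (v) If $r_1<r_2$, and either $\mathcal{M}\subset\Omega\times[r_1,r_2)$ or $\mathcal{M}\subset\Omega\times(r_1,r_2]$, then the map $a$ does not admit a continuous primitive, $\mathcal{M}\subsetneq\mathcal{A}$, and $\Omega_c\subsetneq\Omega$. (vi) The restricted flow $(\mathcal{A},\tau)$ is chain recurrent.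
   Context: Write $\omega\cdot t:=\sigma(t,\omega)$. The induced (local) flow is $\tau(t,\omega,x_0)=(\omega\cdot t,x(t,\omega,x_0))$, where $x(t,\omega,x_0)$ is the maximal solution of the equation corresponding to $\omega$ with $x(0,\omega,x_0)=x_0$; $\Omega\times\mathbb{R}$ carries the distance $\mathrm{dist}_\Omega(\omega_1,\omega_2)+|x_1-x_2|$. A set is $\tau$-invariant if it is composed of globally defined orbits and is mapped onto itself by $\tau_t$ for all $t\in\mathbb{R}$. A $\tau$-minimal set is a nonempty compact $\tau$-invariant set with no proper nonempty compact $\tau$-invariant subset ($(\Omega,\sigma)$ minimal: $\Omega$ itself is minimal for $\sigma$). The upper Lyapunov exponent of a $\tau$-minimal set $\mathcal{M}$ is $\sup\int_{\mathcal{M}}(a(\omega)+g_x(\omega,x))\,d\nu$ over all $\tau$-invariant Borel probability measures $\nu$ on $\mathcal{M}$. Sacker–Sell spectrum: the family $x'=c(\omega\cdot t)\,x$, $\omega\in\Omega$ ($c$ continuous) has exponential dichotomy over $\Omega$ if there are $\kappa\ge1$, $\gamma>0$ such that either $\exp\int_0^t c(\omega\cdot l)\,dl\le\kappa e^{-\gamma t}$ for all $\omega\in\Omega$, $t\ge0$, or $\exp\int_0^t c(\omega\cdot l)\,dl\le\kappa e^{\gamma t}$ for all $\omega\in\Omega$, $t\le0$. $\Sigma_a$ is the set of $\lambda\in\mathbb{R}$ such that $x'=(a(\omega\cdot t)-\lambda)\,x$, $\omega\in\Omega$, does not have exponential dichotomy over $\Omega$. (It is known that $\Sigma_a$ is the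 compact interval with endpoints the infimum and supremum of $\int_\Omega a\,dm$ over the $\sigma$-invariant Borel probability measures $m$, both attained at ergodic measures.) Continuous primitive of $a$: a continuous $h_a:\Omega\to\mathbb{R}$ with $h_a(\omega\cdot t)-h_a(\omega)=\int_0^t a(\omega\cdot s)\,ds$ for all $\omega\in\Omega$, $t\in\mathbb{R}$. Background: under the stated conditions all forward semiorbits are globally defined and bounded, and $\tau$ has a global attractor $\mathcal{A}$, i.e. a compact $\tau$-invariant set with $\lim_{t\to\infty}\mathrm{dist}(\tau_t(\mathcal{C}),\mathcal{A})=0$ (Hausdorff semidistance) for every bounded $\mathcal{C}$; it has the displayed form, with $\alpha_{\mathcal{A}}$ lower and $\beta_{\mathcal{A}}$ upper semicontinuous, both $\tau$-equilibria ($\alpha(\omega\cdot t)=x(t,\omega,\alpha(\omega))$ for all $t,\omega$); $\Omega_c$ is residual and $\sigma$-invariant. For any $\omega_0\in\Omega_c$, $\mathcal{M}^\alpha$ and $\mathcal{M}^\beta$ are the closures in $\Omega\times\mathbb{R}$ of $\{(\omega_0\cdot t,\alpha_{\mathcal{A}}(\omega_0\cdot t)) : t\in\mathbb{R}\}$ and $\{(\omega_0\cdot t,\beta_{\mathcal{A}}(\omega_0\cdot t)) : t\in\mathbb{R}\}$; they are $\tau$-minimal and independent of the choice of $\omega_0$. A compact $\tau$-invariant set is pinched if for some $\omega$ its section over $\omega$ is a singleton. A copy of the base is the graph $\{\eta\}$ of a continuous $\tau$-equilibrium $\eta:\Omega\to\mathbb{R}$. A compact $\tau$-invariant set $\mathcal{K}$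 is uniformly exponentially stable at $+\infty$ (on the fiber) if there are $\delta>0$, $\kappa\ge1$, $\gamma>0$ such that, if $(\omega,\bar x_0)\in\mathcal{K}$ and $|\bar x_0-x_0|<\delta$, then $x(t,\omega,x_0)$ is defined and $|x(t,\omega,\bar x_0)-x(t,\omega,x_0)|\le\kappa e^{-\gamma t}|\bar x_0-x_0|$ for all $t\ge0$. A Borel set has complete measure if it has measure $1$ for every $\sigma$-invariant Borel probability measure on $\Omega$. A flow $(Y,\phi)$ on a compact metric space is chain recurrent if for all $\varepsilon>0$, $T>0$ and $y,\widetilde y\in Y$ there are $k\ge1$, points $y_0=y,y_1,\dots,y_k=\widetilde y$ in $Y$ and times $s_0,\dots,s_{k-1}\ge T$ with $\mathrm{dist}(\phi_{s_i}(y_i),y_{i+1})<\varepsilon$ for $i=0,\dots,k-1$. *)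

theory Defs
  imports "HOL-Probability.Probability"
begin

subsection \<open>Flows, invariant measures, minimality, chain recurrence\<close>

definition continuous_flow :: "(real \<Rightarrow> 'w::topological_space \<Rightarrow> 'w) \<Rightarrow> bool" where
  "continuous_flow \<sigma> \<longleftrightarrow>
     continuous_on UNIV (\<lambda>(t, \<omega>). \<sigma> t \<omega>) \<and>
     (\<forall>\<omega>. \<sigma> 0 \<omega> = \<omega>) \<and> (\<forall>s t \<omega>. \<sigma> (s + t) \<omega> = \<sigma> s (\<sigma> t \<omega>))"

definition flow_invariant :: "(real \<Rightarrow> 'w \<Rightarrow> 'w) \<Rightarrow> 'w set \<Rightarrow> bool" where
  "flow_invariant \<sigma> K \<longleftrightarrow> (\<forall>t. \<sigma> t ` K = K)"

text \<open>The argument \<open>Q\<close> is the notion of invariance, since it differs for the global base flow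
  and for the local flow on the product.\<close>

definition minimal_set :: "('y::topological_space set \<Rightarrow> bool) \<Rightarrow> 'y set \<Rightarrow> bool" where
  "minimal_set Q M \<longleftrightarrow>
     M \<noteq> {} \<and> compact M \<and> Q M \<and>
     (\<forall>K. K \<noteq> {} \<and> compact K \<and> Q K \<and> K \<subseteq> M \<longrightarrow> K = M)"

definition invariant_probs ::
    "'y::topological_space set \<Rightarrow> (real \<Rightarrow> 'y \<Rightarrow> 'y) \<Rightarrow> 'y measure set" where
  "invariant_probs Y \<phi> =
     {\<nu>. prob_space \<nu> \<and> sets \<nu> = sets (restrict_space borel Y) \<and>
         (\<forall>t. \<phi> t \<in> measurable \<nu> \<nu> \<and> distr \<nu> \<nu> (\<phi> t) = \<nu>)}"

definition has_complete_measure :: "(real \<Rightarrow> 'w::topological_space \<Rightarrow> 'w) \<Rightarrow> 'w set \<Rightarrow> bool" where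
  "has_complete_measure \<sigma> B \<longleftrightarrow>
     B \<in> sets borel \<and> (\<forall>m\<in>invariant_probs UNIV \<sigma>. measure m B = 1)"

definition chain_recurrent ::
    "('y \<Rightarrow> 'y \<Rightarrow> real) \<Rightarrow> 'y set \<Rightarrow> (real \<Rightarrow> 'y \<Rightarrow> 'y) \<Rightarrow> bool" where
  "chain_recurrent d Y \<phi> \<longleftrightarrow>
     (\<forall>\<epsilon>>0. \<forall>T>0. \<forall>y\<in>Y. \<forall>y'\<in>Y.
        \<exists>k\<ge>1. \<exists>(p :: nat \<Rightarrow> 'y) (s :: nat \<Rightarrow> real).
          p 0 = y \<and> p k = y' \<and> (\<forall>i\<le>k. p i \<in> Y) \<and>
          (\<forall>i<k. s i \<ge> T \<and> d (\<phi> (s i) (p i)) (p (Suc i)) < \<epsilon>))"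

subsection \<open>Primitives and the Sacker--Sell spectrum\<close>

text \<open>The interval integral is the signed one, so \<open>t < 0\<close> is covered.\<close>

definition orbit_integral :: "(real \<Rightarrow> 'w \<Rightarrow> 'w) \<Rightarrow> ('w \<Rightarrow> real) \<Rightarrow> 'w \<Rightarrow> real \<Rightarrow> real" where
  "orbit_integral \<sigma> c \<omega> t = (LBINT s=ereal 0..ereal t. c (\<sigma> s \<omega>))"

definition has_continuous_primitive ::
    "(real \<Rightarrow> 'w::topological_space \<Rightarrow> 'w) \<Rightarrow> ('w \<Rightarrow> real) \<Rightarrow> bool" where
  "has_continuous_primitive \<sigma> a \<longleftrightarrow>
     (\<exists>h :: 'w \<Rightarrow> real. continuous_on UNIV h \<and>
        (\<forall>\<omega> t. h (\<sigma> t \<omega>) - h \<omega> = orbit_integral \<sigma> a \<omega> t))"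

definition exp_dichotomy :: "(real \<Rightarrow> 'w \<Rightarrow> 'w) \<Rightarrow> ('w \<Rightarrow> real) \<Rightarrow> bool" where
  "exp_dichotomy \<sigma> c \<longleftrightarrow>
     (\<exists>\<kappa>\<ge>1. \<exists>\<gamma>>0.
        (\<forall>\<omega>. \<forall>t\<ge>0. exp (orbit_integral \<sigma> c \<omega> t) \<le> \<kappa> * exp (- \<gamma> * t)) \<or>
        (\<forall>\<omega>. \<forall>t\<le>0. exp (orbit_integral \<sigma> c \<omega> t) \<le> \<kappa> * exp (\<gamma> * t)))"

definition sacker_sell_spectrum :: "(real \<Rightarrow> 'w \<Rightarrow> 'w) \<Rightarrow> ('w \<Rightarrow> real) \<Rightarrow> real set" where
  "sacker_sell_spectrum \<sigma> a = {l. \<not> exp_dichotomy \<sigma> (\<lambda>\<omega>. a \<omega> - l)}"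

subsection \<open>The local skew-product flow induced by \<open>x' = f (\<omega>\<cdot>t) x\<close>\<close>

definition is_solution ::
    "(real \<Rightarrow> 'w \<Rightarrow> 'w) \<Rightarrow> ('w \<Rightarrow> real \<Rightarrow> real) \<Rightarrow> 'w \<Rightarrow> real \<Rightarrow> real set \<Rightarrow> (real \<Rightarrow> real) \<Rightarrow> bool" where
  "is_solution \<sigma> f \<omega> x0 I u \<longleftrightarrow>
     open I \<and> is_interval I \<and> 0 \<in> I \<and> u 0 = x0 \<and>
     (\<forall>t\<in>I. (u has_real_derivative f (\<sigma> t \<omega>) (u t)) (at t))"

definition is_maximal_solution ::
    "(real \<Rightarrow> 'w \<Rightarrow> 'w) \<Rightarrow> ('w \<Rightarrow> real \<Rightarrow> real) \<Rightarrow> 'w \<Rightarrow> real \<Rightarrow> real set \<Rightarrow> (real \<Rightarrow> real) \<Rightarrow> bool" where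
  "is_maximal_solution \<sigma> f \<omega> x0 I u \<longleftrightarrow>
     is_solution \<sigma> f \<omega> x0 I u \<and>
     (\<forall>J v. is_solution \<sigma> f \<omega> x0 J v \<and> I \<subseteq> J \<and> (\<forall>t\<in>I. v t = u t) \<longrightarrow> J = I)"

text \<open>Only the values of a maximal solution on its interval are unique, whence the form of \<open>sol\<close>;
  \<open>sol \<sigma> f t \<omega> x0\<close> is meaningful only for \<open>t \<in> sol_dom \<sigma> f \<omega> x0\<close>.\<close>

definition sol_dom ::
    "(real \<Rightarrow> 'w \<Rightarrow> 'w) \<Rightarrow> ('w \<Rightarrow> real \<Rightarrow> real) \<Rightarrow> 'w \<Rightarrow> real \<Rightarrow> real set" where
  "sol_dom \<sigma> f \<omega> x0 = (THE I. \<exists>u. is_maximal_solution \<sigma> f \<omega> x0 I u)"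

definition sol ::
    "(real \<Rightarrow> 'w \<Rightarrow> 'w) \<Rightarrow> ('w \<Rightarrow> real \<Rightarrow> real) \<Rightarrow> real \<Rightarrow> 'w \<Rightarrow> real \<Rightarrow> real" where
  "sol \<sigma> f t \<omega> x0 = (THE y. \<exists>I u. is_maximal_solution \<sigma> f \<omega> x0 I u \<and> t \<in> I \<and> u t = y)"

definition skew_flow ::
    "(real \<Rightarrow> 'w \<Rightarrow> 'w) \<Rightarrow> ('w \<Rightarrow> real \<Rightarrow> real) \<Rightarrow> real \<Rightarrow> 'w \<times> real \<Rightarrow> 'w \<times> real" where
  "skew_flow \<sigma> f t = (\<lambda>(\<omega>, x0). (\<sigma> t \<omega>, sol \<sigma> f t \<omega> x0))"

definition skew_invariant ::
    "(real \<Rightarrow> 'w \<Rightarrow> 'w) \<Rightarrow> ('w \<Rightarrow> real \<Rightarrow> real) \<Rightarrow> ('w \<times> real) set \<Rightarrow> bool" where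
  "skew_invariant \<sigma> f K \<longleftrightarrow>
     (\<forall>(\<omega>, x)\<in>K. sol_dom \<sigma> f \<omega> x = UNIV) \<and> (\<forall>t. skew_flow \<sigma> f t ` K = K)"

definition equilibrium ::
    "(real \<Rightarrow> 'w \<Rightarrow> 'w) \<Rightarrow> ('w \<Rightarrow> real \<Rightarrow> real) \<Rightarrow> ('w \<Rightarrow> real) \<Rightarrow> bool" where
  "equilibrium \<sigma> f \<eta> \<longleftrightarrow>
     (\<forall>\<omega>. sol_dom \<sigma> f \<omega> (\<eta> \<omega>) = UNIV \<and> (\<forall>t. \<eta> (\<sigma> t \<omega>) = sol \<sigma> f t \<omega> (\<eta> \<omega>)))"

definition graph_of :: "('w \<Rightarrow> real) \<Rightarrow> ('w \<times> real) set" where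
  "graph_of \<eta> = {(\<omega>, x). x = \<eta> \<omega>}"

definition copy_of_base ::
    "(real \<Rightarrow> 'w::topological_space \<Rightarrow> 'w) \<Rightarrow> ('w \<Rightarrow> real \<Rightarrow> real) \<Rightarrow> ('w \<times> real) set \<Rightarrow> bool" where
  "copy_of_base \<sigma> f K \<longleftrightarrow>
     (\<exists>\<eta>. continuous_on UNIV \<eta> \<and> equilibrium \<sigma> f \<eta> \<and> K = graph_of \<eta>)"

definition pinched :: "('w \<times> real) set \<Rightarrow> bool" where
  "pinched K \<longleftrightarrow> (\<exists>\<omega> x. {y. (\<omega>, y) \<in> K} = {x})"

text \<open>The library's product metric is the Euclidean one; \<open>sum_dist\<close> is the (equivalent) sum metric.
  The semidistance takes values in \<open>ennreal\<close> so that suprema and infima need no side conditions.\<close>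

definition sum_dist :: "'w::metric_space \<times> real \<Rightarrow> 'w \<times> real \<Rightarrow> real" where
  "sum_dist p q = dist (fst p) (fst q) + \<bar>snd p - snd q\<bar>"

definition hausdorff_semidist :: "('w::metric_space \<times> real) set \<Rightarrow> ('w \<times> real) set \<Rightarrow> ennreal" where
  "hausdorff_semidist B K = (SUP p\<in>B. INF q\<in>K. ennreal (sum_dist p q))"

text \<open>The first conjunct on \<open>C\<close> says that \<open>skew_flow \<sigma> f t ` C\<close> makes sense for \<open>t \<ge> 0\<close>.\<close>

definition global_attractor ::
    "(real \<Rightarrow> 'w::metric_space \<Rightarrow> 'w) \<Rightarrow> ('w \<Rightarrow> real \<Rightarrow> real) \<Rightarrow> ('w \<times> real) set \<Rightarrow> bool" where
  "global_attractor \<sigma> f K \<longleftrightarrow>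
     compact K \<and> skew_invariant \<sigma> f K \<and>
     (\<forall>C. bounded C \<longrightarrow>
        (\<forall>(\<omega>, x)\<in>C. {0..} \<subseteq> sol_dom \<sigma> f \<omega> x) \<and>
        ((\<lambda>t. hausdorff_semidist (skew_flow \<sigma> f t ` C) K) \<longlongrightarrow> 0) at_top)"

definition unif_exp_stable ::
    "(real \<Rightarrow> 'w \<Rightarrow> 'w) \<Rightarrow> ('w \<Rightarrow> real \<Rightarrow> real) \<Rightarrow> ('w \<times> real) set \<Rightarrow> bool" where
  "unif_exp_stable \<sigma> f K \<longleftrightarrow>
     (\<exists>\<delta>>0. \<exists>\<kappa>\<ge>1. \<exists>\<gamma>>0. \<forall>\<omega> y x.
        (\<omega>, y) \<in> K \<and> \<bar>y - x\<bar> < \<delta> \<longrightarrow>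
          (\<forall>t\<ge>0. t \<in> sol_dom \<sigma> f \<omega> x \<and>
             \<bar>sol \<sigma> f t \<omega> y - sol \<sigma> f t \<omega> x\<bar> \<le> \<kappa> * exp (- \<gamma> * t) * \<bar>y - x\<bar>))"

text \<open>\<open>fx\<close> is the derivative of \<open>f\<close> in the state variable.\<close>

definition upper_lyapunov_exponent ::
    "(real \<Rightarrow> 'w::topological_space \<Rightarrow> 'w) \<Rightarrow> ('w \<Rightarrow> real \<Rightarrow> real) \<Rightarrow> ('w \<Rightarrow> real \<Rightarrow> real) \<Rightarrow>
     ('w \<times> real) set \<Rightarrow> real" where
  "upper_lyapunov_exponent \<sigma> f fx M =
     (SUP \<nu>\<in>invariant_probs M (skew_flow \<sigma> f). \<integral>p. fx (fst p) (snd p) \<partial>\<nu>)"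

text \<open>The closures whose common value, for \<open>\<omega>\<^sub>0\<close> a common continuity point of the two attractor
  bounds, is \<open>\<M>\<^sup>\<alpha>\<close> resp. \<open>\<M>\<^sup>\<beta>\<close>.\<close>

definition orbit_closure ::
    "(real \<Rightarrow> 'w::topological_space \<Rightarrow> 'w) \<Rightarrow> ('w \<Rightarrow> real) \<Rightarrow> 'w \<Rightarrow> ('w \<times> real) set" where
  "orbit_closure \<sigma> \<eta> \<omega>\<^sub>0 = closure (range (\<lambda>t. (\<sigma> t \<omega>\<^sub>0, \<eta> (\<sigma> t \<omega>\<^sub>0))))"

end

theory Submission
  imports Defs
begin

text \<open>The difference \<open>d\<close> of two ordered solutions over the same base orbit satisfies \<open>d' = (a + G) d\<close>
  with \<open>G \<le> 0\<close> the difference quotient of \<open>g\<close>, so \<open>ln d - \<integral>a\<close> decreases along the flow, strictly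
  where the two solutions are not both in \<open>[r1, r2]\<close>. That the supremum of the spectrum is \<open>0\<close> means that
  \<open>\<integral>a\<close> over \<open>[0, t]\<close> grows at most subexponentially uniformly on the base, but cannot be negative everywhere
  for any \<open>t\<close>; hence some base point has \<open>\<integral>a\<close> bounded above in the past.

  Since the attractor is pinched over a dense set of base points, every invariant compact set contains the
  closure of the orbit over any of them, and every orbit comes back close to it in both time directions.
  If \<open>\<M>\<close> leaves the strip, then by minimality of the base every orbit of the attractor spends a uniform
  proportion of time where \<open>g\<close> contracts, which beats the subexponential growth of \<open>\<integral>a\<close>. Inside the strip the
  equation is linear, so adding to an orbit a solution of the homogeneous equation that is bounded in the
  past gives a further orbit of the attractor: the attractor must reach both ends of the strip. The statements on
  measures rest on the fact that \<open>\<integral>a\<close> has nonpositive mean with respect to every invariant probability and on the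
  Krylov-Bogoliubov construction.\<close>

subsection \<open>Differential inequalities and local existence\<close>

text \<open>The hypothesis on the spectrum enters only through one equivalence: the solutions of
  \<open>x' = (a - l) x\<close> decay exponentially, uniformly on the base, exactly when
  \<open>l > 0\<close>. Decay for every small \<open>l > 0\<close> is the upper bound on the growth
  of the cocycle; failure at \<open>l = 0\<close> is the source of all lower bounds. The obstacle is
  that this failure does not yield one base point with nonnegative integral at all times, only, for
  each time, some point depending on it. Hence the measure of exponent \<open>0\<close> is a limit
  of time averages whose starting points change with the length of the average, and the point with
  integral bounded in the past is a limit of points that are good on longer and longer stretches.
  New points of the attractor come from pullback: a point lies in it as soon as, for every
  \<open>t \<ge> 0\<close>, the flow carries some point of one bounded set to it in time
  \<open>t\<close>. The logarithmic gap is read in both directions: forwards it yields contraction,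
  backwards it keeps a positive gap away from zero.\<close>

lemma barrier_le:
  fixes u :: "real \<Rightarrow> real"
  assumes "0 \<le> t" "u 0 \<le> N"
    and der: "\<And>s. 0 \<le> s \<Longrightarrow> s \<le> t \<Longrightarrow> (u has_real_derivative u' s) (at s)"
    and neg: "\<And>s. 0 \<le> s \<Longrightarrow> s \<le> t \<Longrightarrow> u s > N \<Longrightarrow> u' s \<le> 0"
  shows "u t \<le> N"
proof (rule ccontr)
  assume con: "\<not> u t \<le> N"
  have cont: "continuous_on {0..t} u"
    by (intro continuous_at_imp_continuous_on ballI) (use der DERIV_isCont in auto)
  \<comment> \<open>After the last time with \<open>u \<le> N\<close> the solution stays above the
    barrier, where its derivative is nonpositive; the mean value theorem then forbids the
    rise.\<close>
  define S where "S = {0..t} \<inter> u -` {..N}"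
  have "compact S"
    unfolding S_def using continuous_closed_preimage[OF cont, of "{..N}"]
    by (auto simp: compact_eq_bounded_closed bounded_Int)
  moreover have "0 \<in> S" using assms by (auto simp: S_def)
  ultimately obtain s1 where s1: "s1 \<in> S" "\<And>s. s \<in> S \<Longrightarrow> s \<le> s1"
    using compact_attains_sup[of S] by auto
  have "s1 < t" "0 \<le> s1" "u s1 \<le> N" using s1(1) con by (auto simp: S_def less_le)
  have gt: "u s > N" if "s1 < s" "s \<le> t" for s
    using s1(2)[of s] that \<open>0 \<le> s1\<close> by (force simp: S_def)
  obtain z where z: "s1 < z" "z < t" "u t - u s1 = (t - s1) * u' z"
    using MVT2[OF \<open>s1 < t\<close>, of u u'] der \<open>0 \<le> s1\<close> by auto
  have "u' z \<le> 0" using neg[of z] gt[of z] z \<open>0 \<le> s1\<close> by auto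
  then have "u t \<le> u s1" using z \<open>s1 < t\<close>
    by (smt (verit) mult_nonneg_nonpos)
  then show False using con \<open>u s1 \<le> N\<close> by simp
qed

lemma barrier_ge:
  fixes u :: "real \<Rightarrow> real"
  assumes "0 \<le> t" "N \<le> u 0"
    and der: "\<And>s. 0 \<le> s \<Longrightarrow> s \<le> t \<Longrightarrow> (u has_real_derivative u' s) (at s)"
    and pos: "\<And>s. 0 \<le> s \<Longrightarrow> s \<le> t \<Longrightarrow> u s < N \<Longrightarrow> u' s \<ge> 0"
  shows "N \<le> u t"
  using barrier_le[of t "\<lambda>s. - u s" "- N" "\<lambda>s. - u' s"] assms
  by (auto intro!: derivative_intros)

text \<open>A segment instead of an interval covers both time directions:
  \<open>(W + e) * exp (- K * s)\<close> decreases when time runs forwards, and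
  \<open>(W + e) * exp (K * s)\<close> decreases when it runs backwards. The shift \<open>e\<close>
  absorbs an inhomogeneous term.\<close>

lemma gronwall_segment:
  fixes W :: "real \<Rightarrow> real"
  assumes der: "\<And>s. s \<in> closed_segment p q \<Longrightarrow> (W has_real_derivative W' s) (at s)"
    and bnd: "\<And>s. s \<in> closed_segment p q \<Longrightarrow> \<bar>W' s\<bar> \<le> K * (W s + e)"
  shows "W q + e \<le> exp (K * \<bar>q - p\<bar>) * (W p + e)"
proof (cases "p \<le> q")
  case True
  then have seg: "closed_segment p q = {p..q}" by (simp add: closed_segment_eq_real_ivl)
  have "(\<lambda>s. (W s + e) * exp (- K * s)) q \<le> (\<lambda>s. (W s + e) * exp (- K * s)) p"
  proof (rule DERIV_nonpos_imp_nonincreasing[OF True])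
    fix s assume "p \<le> s" "s \<le> q"
    then have s: "s \<in> closed_segment p q" by (simp add: seg)
    have "((\<lambda>s. (W s + e) * exp (- K * s)) has_real_derivative
        (W' s - K * (W s + e)) * exp (- K * s)) (at s)"
      by (auto intro!: derivative_eq_intros der[OF s] simp: algebra_simps)
    moreover have "(W' s - K * (W s + e)) * exp (- K * s) \<le> 0"
      using bnd[OF s] by (intro mult_nonpos_nonneg) auto
    ultimately show "\<exists>y. ((\<lambda>s. (W s + e) * exp (- K * s)) has_real_derivative y) (at s) \<and> y \<le> 0" by blast
  qed
  then have "(W q + e) * exp (- K * q) * exp (K * q) \<le> (W p + e) * exp (- K * p) * exp (K * q)"
    by (intro mult_right_mono) auto
  then show ?thesis using True
    by (simp add: mult.assoc flip: exp_add) (simp add: algebra_simps)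
next
  case False
  then have pq: "q \<le> p" by simp
  have seg: "closed_segment p q = {q..p}" using False by (simp add: closed_segment_eq_real_ivl)
  have "(\<lambda>s. (W s + e) * exp (K * s)) q \<le> (\<lambda>s. (W s + e) * exp (K * s)) p"
  proof (rule DERIV_nonneg_imp_nondecreasing[OF pq])
    fix s assume "q \<le> s" "s \<le> p"
    then have s: "s \<in> closed_segment p q" by (simp add: seg)
    have "((\<lambda>s. (W s + e) * exp (K * s)) has_real_derivative
        (W' s + K * (W s + e)) * exp (K * s)) (at s)"
      by (auto intro!: derivative_eq_intros der[OF s] simp: algebra_simps)
    moreover have "(W' s + K * (W s + e)) * exp (K * s) \<ge> 0"
      using bnd[OF s] by (intro mult_nonneg_nonneg) auto
    ultimately show "\<exists>y. ((\<lambda>s. (W s + e) * exp (K * s)) has_real_derivative y) (at s) \<and> 0 \<le> y" by blast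
  qed
  then have "(W q + e) * exp (K * q) * exp (- K * q) \<le> (W p + e) * exp (K * p) * exp (- K * q)"
    by (intro mult_right_mono) auto
  then show ?thesis using False
    by (simp add: mult.assoc flip: exp_add) (simp add: algebra_simps)
qed

lemma interval_integral_DERIV:
  fixes h :: "real \<Rightarrow> real"
  assumes "continuous_on UNIV h"
  shows "((\<lambda>t. LBINT s=ereal 0..ereal t. h s) has_real_derivative h t) (at t)"
proof -
  define r where "r = \<bar>t\<bar> + 1"
  have "((\<lambda>t. LBINT s=ereal 0..ereal t. h s) has_vector_derivative h t) (at t within {-r..r})"
    unfolding r_def
    by (rule interval_integral_FTC2) (auto intro: continuous_on_subset[OF assms])
  moreover have "at t within {-r..r} = at t"
    by (rule at_within_interior) (auto simp: r_def)
  ultimately show ?thesis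
    by (simp add: has_real_derivative_iff_has_vector_derivative)
qed

lemma interval_integral_unique_primitive:
  fixes F :: "real \<Rightarrow> real"
  assumes "continuous_on UNIV h" and F: "\<And>s. (F has_real_derivative h s) (at s)"
  shows "(LBINT s=ereal 0..ereal t. h s) = F t - F 0"
proof -
  let ?D = "\<lambda>t. (LBINT s=ereal 0..ereal t. h s) - F t"
  have "(?D has_real_derivative 0) (at s)" for s
    using DERIV_diff[OF interval_integral_DERIV[OF assms(1)] F] by simp
  then have "?D t = ?D 0" by (rule DERIV_isconst_all[rule_format])
  then show ?thesis by (simp add: zero_ereal_def[symmetric])
qed

text \<open>Picard iteration: the interval is so short that the integral operator halves distances; extending
  the iterates by constants makes them elements of a complete space of bounded functions.\<close>

lemma ode_local_existence:
  fixes H :: "real \<Rightarrow> real \<Rightarrow> real"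
  assumes cont: "continuous_on UNIV (\<lambda>(t, x). H t x)"
    and L: "L > 0" "\<And>t x y. \<bar>H t x - H t y\<bar> \<le> L * \<bar>x - y\<bar>"
    and B: "\<And>t x. \<bar>H t x\<bar> \<le> B"
  obtains u r where "r > 0" "u 0 = x0" "\<And>t. \<bar>t\<bar> < r \<Longrightarrow> (u has_real_derivative H t (u t)) (at t)"
proof -
  define r where "r = 1 / (2 * L)"
  have r: "r > 0" "L * r = 1/2" using L by (auto simp: r_def)
  define cl where "cl t = max (-r) (min r t)" for t :: real
  have cl: "\<bar>cl t\<bar> \<le> r" for t using r by (auto simp: cl_def)
  have cl_cont: "continuous_on UNIV cl" unfolding cl_def by (intro continuous_intros)
  define I where "I y t = (LBINT s=ereal 0..ereal t. H s (apply_bcontfun y s))" for y :: "real \<Rightarrow>\<^sub>C real" and t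
  have hc: "continuous_on UNIV (\<lambda>s. H s (apply_bcontfun y s))" for y
  proof -
    have 1: "continuous_on UNIV (\<lambda>s. (s, apply_bcontfun y s))"
      by (intro continuous_intros) auto
    show ?thesis using continuous_on_compose2[OF cont 1] by simp
  qed
  have Ider: "(I y has_real_derivative H t (apply_bcontfun y t)) (at t)" for y t
    using interval_integral_DERIV[OF hc, of y t] unfolding I_def[abs_def] by simp
  have I0: "I y 0 = 0" for y by (simp add: I_def zero_ereal_def[symmetric])
  have Icont: "continuous_on UNIV (I y)" for y
    using Ider DERIV_isCont continuous_at_imp_continuous_on by blast
  have Ibnd: "\<bar>I y t\<bar> \<le> B * \<bar>t\<bar>" for y t
    using field_differentiable_bound[of UNIV "I y" "\<lambda>t. H t (apply_bcontfun y t)" B 0 t] Ider B I0 by (simp add: abs_minus_commute)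
  have bc: "(\<lambda>t. x0 + I y (cl t)) \<in> bcontfun" for y
  proof (rule bcontfun_normI[where b="\<bar>x0\<bar> + B * r"])
    show "continuous_on UNIV (\<lambda>t. x0 + I y (cl t))"
      using continuous_on_compose2[OF Icont cl_cont] by (intro continuous_intros) auto
    fix t
    have "0 \<le> B" using B[of 0 0] by linarith
    have "\<bar>I y (cl t)\<bar> \<le> B * r" using Ibnd[of y "cl t"] mult_left_mono[OF cl[of t] \<open>0 \<le> B\<close>] by linarith
    then show "norm (x0 + I y (cl t)) \<le> \<bar>x0\<bar> + B * r" by (simp add: abs_triangle_ineq[THEN order_trans])
  qed
  define \<Phi> where "\<Phi> y = Bcontfun (\<lambda>t. x0 + I y (cl t))" for y
  have \<Phi>: "apply_bcontfun (\<Phi> y) t = x0 + I y (cl t)" for y t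
    unfolding \<Phi>_def using Bcontfun_inverse[OF bc] by simp
  have lip: "dist (\<Phi> y) (\<Phi> z) \<le> 1/2 * dist y z" for y z
  proof (rule dist_bound)
    fix t
    have "\<bar>(I y (cl t) - I z (cl t)) - (I y 0 - I z 0)\<bar> \<le> (L * dist y z) * \<bar>cl t - 0\<bar>"
    proof -
      have "\<bar>H t (apply_bcontfun y t) - H t (apply_bcontfun z t)\<bar> \<le> L * dist y z" for t
      proof -
        have "\<bar>apply_bcontfun y t - apply_bcontfun z t\<bar> \<le> dist y z"
          using dist_bounded[where f=y and g=z and x=t] by (simp add: dist_real_def)
        then show ?thesis
          using L(2)[of t "apply_bcontfun y t" "apply_bcontfun z t"] L(1)
          by (meson mult_left_mono less_imp_le order_trans)
      qed
      then show ?thesis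
        using field_differentiable_bound[of UNIV "\<lambda>t. I y t - I z t" "\<lambda>t. H t (apply_bcontfun y t) - H t (apply_bcontfun z t)" "L * dist y z" "cl t" 0]
          DERIV_diff[OF Ider[of y] Ider[of z]] by simp
    qed
    also have "\<dots> \<le> (L * dist y z) * r"
      using cl[of t] L(1) by (intro mult_left_mono) auto
    also have "\<dots> = 1/2 * dist y z" using r by (simp add: mult.assoc mult.left_commute)
    finally show "dist (\<Phi> y t) (\<Phi> z t) \<le> 1 / 2 * dist y z"
      by (simp add: \<Phi> I0 dist_real_def)
  qed
  obtain y where y: "\<Phi> y = y" using banach_fix_type[of "1/2" \<Phi>] lip by auto
  define u where "u t = x0 + I y t" for t
  have yu: "apply_bcontfun y t = u t" if "\<bar>t\<bar> < r" for t
  proof -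
    have "cl t = t" using that by (auto simp: cl_def)
    then show ?thesis using \<Phi>[of y t] y by (simp add: u_def)
  qed
  have "(u has_real_derivative H t (u t)) (at t)" if "\<bar>t\<bar> < r" for t
    using Ider[of y t] yu[OF that] unfolding u_def[abs_def] by (auto intro!: derivative_eq_intros)
  moreover have "u 0 = x0" by (simp add: u_def I0)
  ultimately show ?thesis using that r by blast
qed

subsection \<open>Invariant probabilities on compact metric spaces\<close>

text \<open>Closed sets form an intersection-stable generator of the Borel sets, and the indicator
  of a closed set is the bounded pointwise limit of the continuous functions
  \<open>h n\<close>.\<close>

lemma borel_measure_eqI_continuous:
  fixes \<mu> \<nu> :: "'y::metric_space measure"
  assumes "finite_measure \<mu>" "finite_measure \<nu>" and sets: "sets \<mu> = sets borel" "sets \<nu> = sets borel"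
    and eq: "\<And>h :: 'y \<Rightarrow> real. continuous_on UNIV h \<Longrightarrow> (\<And>x. 0 \<le> h x \<and> h x \<le> 1) \<Longrightarrow>
      (\<integral>x. h x \<partial>\<mu>) = (\<integral>x. h x \<partial>\<nu>)"
  shows "\<mu> = \<nu>"
proof (rule measure_eqI_generator_eq[where E="Collect closed" and \<Omega>=UNIV and A="\<lambda>_. UNIV"])
  interpret m: finite_measure \<mu> by fact
  interpret n: finite_measure \<nu> by fact
  show "Int_stable (Collect closed :: 'y set set)" by (auto simp: Int_stable_def)
  show "sets \<mu> = sigma_sets UNIV (Collect closed)" "sets \<nu> = sigma_sets UNIV (Collect closed)"
    using sets by (simp_all add: borel_eq_closed)
  show "emeasure \<mu> UNIV \<noteq> \<infinity>" by simp
  fix F :: "'y set" assume "F \<in> Collect closed"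
  then have F: "closed F" by simp
  show "emeasure \<mu> F = emeasure \<nu> F"
  proof (cases "F = {}")
    case False
    define h where "h n x = max 0 (1 - real n * infdist x F)" for n x
    have hc: "continuous_on UNIV (h n)" for n unfolding h_def by (intro continuous_intros)
    have hb: "0 \<le> h n x \<and> h n x \<le> 1" for n x by (simp add: h_def infdist_nonneg)
    have hlim: "(\<lambda>n. h n x) \<longlonglongrightarrow> indicator F x" for x
    proof (cases "x \<in> F")
      case True then show ?thesis by (simp add: h_def)
    next
      case False
      then have d: "infdist x F > 0"
        using F \<open>F \<noteq> {}\<close> in_closed_iff_infdist_zero[of F x] infdist_nonneg[of x F] by linarith
      obtain N where N: "1 / infdist x F \<le> real N" using real_arch_simple by blast
      have "h n x = 0" if "n \<ge> N" for n
      proof -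
        have "1 / infdist x F \<le> real n" using N that by linarith
        then show ?thesis using d by (simp add: h_def field_simps)
      qed
      then have "\<forall>\<^sub>F n in sequentially. h n x = 0" using eventually_sequentially by blast
      then show ?thesis using False by (simp add: tendsto_eventually)
    qed
    have lim: "(\<lambda>n. \<integral>x. h n x \<partial>m) \<longlonglongrightarrow> measure m F" if "finite_measure m" "sets m = sets borel" for m
    proof -
      interpret finite_measure m by fact
      have "(\<lambda>n. \<integral>x. h n x \<partial>m) \<longlonglongrightarrow> (\<integral>x. indicator F x \<partial>m)"
      proof (rule integral_dominated_convergence[where w="\<lambda>_. 1"])
        show "h n \<in> borel_measurable m" for n
          using borel_measurable_continuous_onI[OF hc] by (simp add: measurable_cong_sets[OF that(2) refl])
        have "F \<in> sets m" using F that(2) by (simp add: borel_closed)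
        then show "(indicator F :: 'y \<Rightarrow> real) \<in> borel_measurable m" by (rule borel_measurable_indicator)
        show "AE x in m. norm (h n x) \<le> 1" for n using hb by simp
      qed (use hlim in auto)
      moreover have "space m = UNIV" using sets_eq_imp_space_eq[OF that(2)] by simp
      then have "(\<integral>x. indicator F x \<partial>m) = measure m F" by simp
      ultimately show ?thesis by simp
    qed
    have "measure \<mu> F = measure \<nu> F"
      using lim[OF assms(1) sets(1)] lim[OF assms(2) sets(2)] unfolding eq[OF hc hb] by (rule LIMSEQ_unique)
    then show ?thesis by (simp add: m.emeasure_eq_measure n.emeasure_eq_measure)
  qed simp
qed auto

section \<open>Coding of compact metric spaces by real numbers\<close>

text \<open>The finite covers by balls of radius \<open>1 / (n + 1)\<close>, for all
  \<open>n\<close>, are merged into one sequence. Knowing which of its first \<open>J\<close>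
  members contain a point then locates the point up to \<open>e\<close>; these membership data
  become digits.\<close>

lemma compact_small_cover_sequence:
  fixes M :: "'y::metric_space set"
  assumes "compact M" "M \<noteq> {}"
  obtains U :: "nat \<Rightarrow> 'y set" where "\<And>j. open (U j)"
    "\<And>e. e > 0 \<Longrightarrow> \<exists>J. \<forall>x\<in>M. \<exists>j<J. x \<in> U j \<and> (\<forall>y\<in>U j. dist x y < e)"
proof -
  have "\<exists>k. finite k \<and> k \<subseteq> M \<and> M \<subseteq> (\<Union>x\<in>k. ball x (1 / (real n + 1)))" for n
  proof -
    have "M \<subseteq> (\<Union>x\<in>M. ball x (1 / (real n + 1)))" by force
    from compactE_image[OF assms(1) _ this] show ?thesis by (metis open_ball)
  qed
  then obtain k where k: "\<And>n. finite (k n)" "\<And>n. k n \<subseteq> M"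
      "\<And>n. M \<subseteq> (\<Union>x\<in>k n. ball x (1 / (real n + 1)))" by metis
  define \<U> where "\<U> = (\<Union>n. (\<lambda>x. ball x (1 / (real n + 1))) ` k n)"
  have cnt: "countable \<U>" unfolding \<U>_def by (rule countable_UN) (simp_all add: countable_finite k(1))
  have ne: "\<U> \<noteq> {}" using k(3)[of 0] assms(2) by (auto simp: \<U>_def)
  define U where "U = from_nat_into \<U>"
  show ?thesis
  proof (rule that)
    show "open (U j)" for j using from_nat_into[OF ne, of j] by (auto simp: U_def \<U>_def)
    fix e :: real assume "e > 0"
    obtain n where n: "2 / e < real n" using reals_Archimedean2 by blast
    have n2: "2 / (real n + 1) < e"
    proof -
      have "2 < e * real n" using n \<open>e > 0\<close> by (simp add: field_simps)
      also have "\<dots> < e * (real n + 1)" using \<open>e > 0\<close> by simp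
      finally show ?thesis by (simp add: field_simps)
    qed
    define ix where "ix x = to_nat_on \<U> (ball x (1 / (real n + 1)))" for x
    have ix: "U (ix x) = ball x (1 / (real n + 1))" if "x \<in> k n" for x
      unfolding U_def ix_def by (rule from_nat_into_to_nat_on[OF cnt]) (use that in \<open>auto simp: \<U>_def\<close>)
    define J where "J = Suc (Max (ix ` k n))"
    have "\<exists>j<J. x \<in> U j \<and> (\<forall>y\<in>U j. dist x y < e)" if xM: "x \<in> M" for x
    proof -
      obtain z where z: "z \<in> k n" "x \<in> ball z (1 / (real n + 1))" using k(3)[of n] xM by blast
      have "ix z < J" using k(1)[of n] z(1) by (simp add: J_def less_Suc_eq_le)
      moreover have "x \<in> U (ix z)" using ix z by simp
      moreover have "dist x y < e" if "y \<in> U (ix z)" for y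
      proof -
        have "dist z y < 1 / (real n + 1)" "dist z x < 1 / (real n + 1)" using that z ix by auto
        then have "dist x y < 2 / (real n + 1)" using dist_triangle3[of x y z] by (simp add: add_divide_distrib[symmetric] add_strict_mono)
        then show ?thesis using n2 by simp
      qed
      ultimately show ?thesis by blast
    qed
    then show "\<exists>J. \<forall>x\<in>M. \<exists>j<J. x \<in> U j \<and> (\<forall>y\<in>U j. dist x y < e)" by blast
  qed
qed

text \<open>Digits 0 and 1 in base 3, as for the Cantor set: the weights behind a digit add up to
  only half of its own weight, so later digits never make up for an earlier difference. The sum
  starts at \<open>j = 0\<close>, whence the bound 3/2.\<close>

definition ternary_code :: "(nat \<Rightarrow> 'y set) \<Rightarrow> 'y \<Rightarrow> real" where
  "ternary_code U x = (\<Sum>j. of_bool (x \<in> U j) * (1/3) ^ j)"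

lemma summable_third: "summable (\<lambda>j. (1/3::real) ^ (j + k))"
  by (rule summable_ignore_initial_segment) simp

lemma summable_ternary: "summable (\<lambda>j. of_bool (x \<in> U j) * (1/3::real) ^ j)"
  by (rule summable_comparison_test'[OF summable_third[of 0], of 0]) auto

lemma ternary_code_bounds: "0 \<le> ternary_code U x" "ternary_code U x \<le> 3/2"
proof -
  show "0 \<le> ternary_code U x" unfolding ternary_code_def by (rule suminf_nonneg[OF summable_ternary]) simp
  have "ternary_code U x \<le> (\<Sum>j. (1/3::real) ^ j)"
    unfolding ternary_code_def by (rule suminf_le[OF _ summable_ternary]) auto
  then show "ternary_code U x \<le> 3/2" using suminf_geometric[of "1/3::real"] by simp
qed

lemma ternary_code_measurable:
  assumes "\<And>j. open (U j)" shows "ternary_code U \<in> borel_measurable borel"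
proof -
  have [measurable]: "U j \<in> sets borel" for j using assms by simp
  have "(\<lambda>x. of_bool (x \<in> U j) * (1/3::real) ^ j) \<in> borel_measurable borel" for j
    unfolding of_bool_def by measurable
  then show ?thesis unfolding ternary_code_def[abs_def] by (rule borel_measurable_suminf)
qed

text \<open>At the first differing digit \<open>k\<close> the codes differ by
  \<open>(1/3) ^ k\<close>, up to a tail of at most half of that; with \<open>k < J\<close> the
  distance would be at least \<open>(1/3) ^ J / 2\<close>.\<close>

lemma ternary_code_separates:
  assumes close: "\<bar>ternary_code U x - ternary_code U y\<bar> < (1/3) ^ J / 2" and "j < J"
  shows "x \<in> U j \<longleftrightarrow> y \<in> U j"
proof (rule ccontr)
  assume j: "\<not> (x \<in> U j \<longleftrightarrow> y \<in> U j)"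
  define k where "k = (LEAST j. \<not> (x \<in> U j \<longleftrightarrow> y \<in> U j))"
  have kd: "\<not> (x \<in> U k \<longleftrightarrow> y \<in> U k)" unfolding k_def using j by (rule LeastI)
  have "k \<le> j" unfolding k_def using j by (rule Least_le)
  have kl: "x \<in> U i \<longleftrightarrow> y \<in> U i" if "i < k" for i using not_less_Least that unfolding k_def by blast
  define d where "d i = (of_bool (x \<in> U i) - of_bool (y \<in> U i)) * (1/3::real) ^ i" for i
  have dbnd: "\<bar>d i\<bar> \<le> (1/3) ^ i" for i by (auto simp: d_def)
  have sd: "summable d"
    by (rule summable_comparison_test'[OF summable_third[of 0], of 0]) (use dbnd in simp)
  have dsum: "ternary_code U x - ternary_code U y = suminf d"
    unfolding ternary_code_def d_def
    by (simp add: suminf_diff[OF summable_ternary summable_ternary] left_diff_distrib)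
  have split: "suminf d = (\<Sum>i. d (i + Suc k)) + (\<Sum>i<Suc k. d i)"
    by (rule suminf_split_initial_segment[OF sd])
  have "(\<Sum>i<k. d i) = 0" by (rule sum.neutral) (use kl in \<open>simp add: d_def\<close>)
  then have head: "\<bar>\<Sum>i<Suc k. d i\<bar> = (1/3) ^ k" using kd by (auto simp: d_def)
  have "summable (\<lambda>i. \<bar>d (i + Suc k)\<bar>)"
    by (rule summable_comparison_test'[OF summable_third[of "Suc k"], of 0])
       (simp only: real_norm_def abs_idempotent dbnd)
  then have "\<bar>\<Sum>i. d (i + Suc k)\<bar> \<le> (\<Sum>i. \<bar>d (i + Suc k)\<bar>)" by (rule summable_rabs)
  also have "\<dots> \<le> (\<Sum>i. (1/3) ^ (i + Suc k))"
    by (rule suminf_le[OF _ \<open>summable (\<lambda>i. \<bar>d (i + Suc k)\<bar>)\<close> summable_third]) (rule dbnd)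
  also have "\<dots> = (1/3) ^ k / 2"
  proof -
    have "(\<Sum>i. (1/3::real) ^ (i + Suc k)) = (\<Sum>i. (1/3) ^ i) * (1/3) ^ Suc k"
      unfolding power_add by (rule suminf_mult2[symmetric]) simp
    then show ?thesis using suminf_geometric[of "1/3::real"] by simp
  qed
  finally have "\<bar>suminf d\<bar> \<ge> (1/3) ^ k / 2" using split head by linarith
  moreover have "(1/3::real) ^ J \<le> (1/3) ^ k" by (rule power_decreasing) (use \<open>k \<le> j\<close> \<open>j < J\<close> in auto)
  ultimately show False using close dsum by linarith
qed

text \<open>Every compact metric space is the image of a compact set of reals; a Borel right inverse of the
  projection transports weak compactness of probabilities on the line to the space.\<close>

lemma compact_coding:
  fixes M :: "'y::metric_space set"
  assumes "compact M" "M \<noteq> {}"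
  obtains code :: "'y \<Rightarrow> real" and \<pi> where "code \<in> borel_measurable borel"
    "\<And>x. 0 \<le> code x \<and> code x \<le> 3/2" "continuous_on (closure (code ` M)) \<pi>"
    "\<And>z. z \<in> closure (code ` M) \<Longrightarrow> \<pi> z \<in> M" "\<And>x. x \<in> M \<Longrightarrow> \<pi> (code x) = x"
proof -
  obtain U :: "nat \<Rightarrow> 'y set" where U: "\<And>j. open (U j)"
    "\<And>e. e > 0 \<Longrightarrow> \<exists>J. \<forall>x\<in>M. \<exists>j<J. x \<in> U j \<and> (\<forall>y\<in>U j. dist x y < e)"
    using compact_small_cover_sequence[OF assms] by blast
  define code where "code = ternary_code U"
  \<comment> \<open>The extension by limits of the inverse of \<open>code\<close> to the closure of
    its range. \<open>Qclose\<close> is its uniform continuity, which also makes it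
    single-valued.\<close>
  define Q where "Q z x \<longleftrightarrow> (\<exists>X. (\<forall>n. X n \<in> M) \<and> (\<lambda>n. code (X n)) \<longlonglongrightarrow> z \<and> X \<longlonglongrightarrow> x)" for z x
  have Qex: "\<exists>x\<in>M. Q z x" if z: "z \<in> closure (code ` M)" for z
  proof -
    obtain Y where Y: "\<And>n. Y n \<in> code ` M" "Y \<longlonglongrightarrow> z" using z unfolding closure_sequential by blast
    have "\<exists>x. \<forall>n. x n \<in> M \<and> Y n = code (x n)" using Y(1) by (intro choice) blast
    then obtain X where X: "\<And>n. X n \<in> M" "\<And>n. Y n = code (X n)" by blast
    obtain x r where r: "x \<in> M" "strict_mono (r :: nat \<Rightarrow> nat)" "(X \<circ> r) \<longlonglongrightarrow> x"
      using assms(1) X(1) unfolding compact_def by blast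
    have "(Y \<circ> r) \<longlonglongrightarrow> z" using Y(2) r(2) by (rule LIMSEQ_subseq_LIMSEQ)
    then have "Q z x" unfolding Q_def using X r by (intro exI[of _ "X \<circ> r"]) (auto simp: o_def)
    then show ?thesis using r(1) by blast
  qed
  have Qclose: "\<exists>\<delta>>0. \<forall>z z' x x'. Q z x \<longrightarrow> Q z' x' \<longrightarrow> \<bar>z - z'\<bar> < \<delta> \<longrightarrow> dist x x' \<le> e" if e: "e > 0" for e
  proof -
    obtain J where J: "\<forall>x\<in>M. \<exists>j<J. x \<in> U j \<and> (\<forall>y\<in>U j. dist x y < e)" using U(2)[OF e] by blast
    have "dist x x' \<le> e" if Q: "Q z x" "Q z' x'" and zz: "\<bar>z - z'\<bar> < (1/3) ^ J / 2" for z z' x x'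
    proof -
      obtain X where X: "\<And>n. X n \<in> M" "(\<lambda>n. code (X n)) \<longlonglongrightarrow> z" "X \<longlonglongrightarrow> x" using Q(1) unfolding Q_def by blast
      obtain X' where X': "\<And>n. X' n \<in> M" "(\<lambda>n. code (X' n)) \<longlonglongrightarrow> z'" "X' \<longlonglongrightarrow> x'" using Q(2) unfolding Q_def by blast
      have "(\<lambda>n. \<bar>code (X n) - code (X' n)\<bar>) \<longlonglongrightarrow> \<bar>z - z'\<bar>" by (intro tendsto_intros X X')
      then have "\<forall>\<^sub>F n in sequentially. \<bar>code (X n) - code (X' n)\<bar> < (1/3) ^ J / 2"
        using zz by (rule order_tendstoD)
      then have "\<forall>\<^sub>F n in sequentially. dist (X n) (X' n) \<le> e"
      proof (rule eventually_mono)
        fix n assume c: "\<bar>code (X n) - code (X' n)\<bar> < (1/3) ^ J / 2"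
        obtain j where j: "j < J" "X n \<in> U j" "\<forall>y\<in>U j. dist (X n) y < e" using J X(1) by blast
        have "X' n \<in> U j" using ternary_code_separates[OF c[unfolded code_def] j(1)] j(2) by simp
        then show "dist (X n) (X' n) \<le> e" using j(3) by (simp add: less_imp_le)
      qed
      then show ?thesis by (intro tendsto_upperbound[OF tendsto_dist[OF X(3) X'(3)]]) auto
    qed
    then show ?thesis by (intro exI[of _ "(1/3) ^ J / 2"]) auto
  qed
  define \<pi> where "\<pi> z = (SOME x. x \<in> M \<and> Q z x)" for z
  have \<pi>: "\<pi> z \<in> M" "Q z (\<pi> z)" if "z \<in> closure (code ` M)" for z
    using someI_ex[of "\<lambda>x. x \<in> M \<and> Q z x"] Qex[OF that] unfolding \<pi>_def by blast+
  show ?thesis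
  proof (rule that[of code \<pi>])
    show "code \<in> borel_measurable borel" unfolding code_def by (rule ternary_code_measurable[OF U(1)])
    show "0 \<le> code x \<and> code x \<le> 3/2" for x unfolding code_def using ternary_code_bounds[of U x] by simp
    show "continuous_on (closure (code ` M)) \<pi>"
      unfolding continuous_on_iff
    proof (intro ballI allI impI)
      fix z and e :: real assume z: "z \<in> closure (code ` M)" and "e > 0"
      then obtain \<delta> where d: "\<delta> > 0" "\<forall>z z' x x'. Q z x \<longrightarrow> Q z' x' \<longrightarrow> \<bar>z - z'\<bar> < \<delta> \<longrightarrow> dist x x' \<le> e/2"
        using Qclose[of "e/2"] by auto
      have "dist (\<pi> z') (\<pi> z) < e" if z': "z' \<in> closure (code ` M)" "dist z' z < \<delta>" for z'
      proof -
        have "dist (\<pi> z') (\<pi> z) \<le> e/2" using d(2) \<pi>(2)[OF z] \<pi>(2)[OF z'(1)] z'(2) by (simp add: dist_real_def)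
        then show ?thesis using \<open>e > 0\<close> by simp
      qed
      then show "\<exists>d>0. \<forall>x'\<in>closure (code ` M). dist x' z < d \<longrightarrow> dist (\<pi> x') (\<pi> z) < e" using d(1) by blast
    qed
    show "\<pi> z \<in> M" if "z \<in> closure (code ` M)" for z using \<pi>(1)[OF that] .
    show "\<pi> (code x) = x" if x: "x \<in> M" for x
    proof -
      have cl: "code x \<in> closure (code ` M)" by (rule subsetD[OF closure_subset imageI[OF x]])
      have Qx: "Q (code x) x" unfolding Q_def using x by (intro exI[of _ "\<lambda>_. x"]) auto
      have le: "dist (\<pi> (code x)) x \<le> e" if e: "e > 0" for e
      proof -
        obtain \<delta> where d: "\<delta> > 0" "\<forall>z z' x x'. Q z x \<longrightarrow> Q z' x' \<longrightarrow> \<bar>z - z'\<bar> < \<delta> \<longrightarrow> dist x x' \<le> e"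
          using Qclose[OF e] by (elim exE conjE)
        show ?thesis by (rule d(2)[rule_format, OF \<pi>(2)[OF cl] Qx]) (simp add: d(1))
      qed
      show ?thesis
      proof (rule ccontr)
        assume "\<pi> (code x) \<noteq> x"
        then have "dist (\<pi> (code x)) x / 2 > 0" by simp
        from le[OF this] this show False by linarith
      qed
    qed
  qed
qed

section \<open>Time averages and the Krylov-Bogoliubov construction\<close>

definition time_uniform :: "real \<Rightarrow> real measure" where
  "time_uniform T = density lborel (\<lambda>s. ennreal (indicator {0..T} s / T))"

lemma sets_time_uniform [measurable_cong, simp]: "sets (time_uniform T) = sets borel"
  and space_time_uniform [simp]: "space (time_uniform T) = UNIV"
  by (simp_all add: time_uniform_def)

lemma integral_time_uniform:
  fixes q :: "real \<Rightarrow> real"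
  assumes "T > 0" and q: "continuous_on UNIV q" and F: "\<And>s. (F has_real_derivative q s) (at s)"
  shows "(\<integral>s. q s \<partial>time_uniform T) = (F T - F 0) / T"
proof -
  have "isCont q s" for s using q continuous_on_eq_continuous_at by blast
  then have "(\<integral>s. q s * indicator {0..T} s \<partial>lborel) = F T - F 0"
    using assms by (intro integral_FTC_Icc_real) auto
  moreover have "(\<integral>s. q s \<partial>time_uniform T) = (\<integral>s. (indicator {0..T} s / T) *\<^sub>R q s \<partial>lborel)"
    unfolding time_uniform_def
    by (rule integral_density) (use q \<open>T > 0\<close> borel_measurable_continuous_onI[OF q] in auto)
  moreover have "\<dots> = (\<integral>s. (q s * indicator {0..T} s) / T \<partial>lborel)"
    by (rule Bochner_Integration.integral_cong) auto
  ultimately show ?thesis by simp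
qed

lemma prob_space_time_uniform:
  assumes "T > 0" shows "prob_space (time_uniform T)"
proof
  have "emeasure (time_uniform T) (space (time_uniform T)) = (\<integral>\<^sup>+s. ennreal (1 / T) * indicator {0..T} s \<partial>lborel)"
    unfolding space_time_uniform time_uniform_def
    by (subst emeasure_density) (auto intro!: nn_integral_cong simp: indicator_def)
  also have "\<dots> = ennreal (1 / T) * emeasure lborel {0..T}" by (rule nn_integral_cmult_indicator) simp
  also have "\<dots> = 1" using assms by (simp flip: ennreal_mult')
  finally show "emeasure (time_uniform T) (space (time_uniform T)) = 1" .
qed

text \<open>The starting point may vary with the length of the average, since the application
  supplies a suitable point only for one time at once; the length is \<open>n + 1\<close> so that it
  never vanishes. Averages are carried to the line by \<open>code\<close>, a weak limit is taken
  there, and it is brought back by \<open>\<pi>\<close>.\<close>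

theorem krylov_bogoliubov:
  fixes M :: "'y::metric_space set" and \<phi> :: "real \<Rightarrow> 'y \<Rightarrow> 'y" and p :: "nat \<Rightarrow> 'y"
  assumes M: "compact M" and \<phi>M: "\<And>t x. x \<in> M \<Longrightarrow> \<phi> t x \<in> M"
    and \<phi>cont: "\<And>t. continuous_on M (\<phi> t)"
    and \<phi>orbit: "\<And>x. x \<in> M \<Longrightarrow> continuous_on UNIV (\<lambda>s. \<phi> s x)"
    and \<phi>add: "\<And>s t x. x \<in> M \<Longrightarrow> \<phi> (s + t) x = \<phi> s (\<phi> t x)"
    and p: "\<And>n. p n \<in> M"
  obtains \<nu> r where "\<nu> \<in> invariant_probs M \<phi>" "strict_mono (r :: nat \<Rightarrow> nat)"
    "\<And>h :: 'y \<Rightarrow> real. continuous_on M h \<Longrightarrow>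
      (\<lambda>n. \<integral>s. h (\<phi> s (p (r n))) \<partial>time_uniform (real (r n) + 1)) \<longlonglongrightarrow> (\<integral>x. h x \<partial>\<nu>)"
proof -
  have Mne: "M \<noteq> {}" using p by blast
  obtain code :: "'y \<Rightarrow> real" and \<pi> where code: "code \<in> borel_measurable borel"
    "\<And>x. 0 \<le> code x \<and> code x \<le> 3/2" and \<pi>: "continuous_on (closure (code ` M)) \<pi>"
    "\<And>z. z \<in> closure (code ` M) \<Longrightarrow> \<pi> z \<in> M" "\<And>x. x \<in> M \<Longrightarrow> \<pi> (code x) = x"
    using compact_coding[OF M Mne] by blast
  define Cl where "Cl = closure (code ` M)"
  have Cl: "closed Cl" "Cl \<noteq> {}" "\<And>x. x \<in> M \<Longrightarrow> code x \<in> Cl"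
    using Mne closure_subset[of "code ` M"] by (auto simp: Cl_def)
  define U where "U n = time_uniform (real n + 1)" for n
  have Uprob: "prob_space (U n)" for n unfolding U_def by (rule prob_space_time_uniform) simp
  define \<mu> where "\<mu> n = distr (U n) borel (\<lambda>s. code (\<phi> s (p n)))" for n
  have cm: "(\<lambda>s. code (\<phi> s (p n))) \<in> U n \<rightarrow>\<^sub>M borel" for n
  proof -
    have "(\<lambda>s. \<phi> s (p n)) \<in> borel \<rightarrow>\<^sub>M borel" by (rule borel_measurable_continuous_onI[OF \<phi>orbit[OF p]])
    then have "(\<lambda>s. code (\<phi> s (p n))) \<in> borel \<rightarrow>\<^sub>M borel" by (rule measurable_compose[OF _ code(1)])
    then show ?thesis by (simp add: U_def measurable_cong_sets[OF sets_time_uniform refl])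
  qed
  have \<mu>dist: "real_distribution (\<mu> n)" for n
    unfolding \<mu>_def by (intro prob_space.real_distribution_distr Uprob cm)
  have int\<mu>: "(\<integral>z. H z \<partial>\<mu> n) = (\<integral>s. H (code (\<phi> s (p n))) \<partial>U n)" if "continuous_on UNIV H" for H :: "real \<Rightarrow> real" and n
    unfolding \<mu>_def by (rule integral_distr[OF cm borel_measurable_continuous_onI[OF that]])
  \<comment> \<open>All codes lie in \<open>[0, 3/2]\<close>, which the half-open interval from -1
    to 2 contains, so no mass escapes.\<close>
  have "tight \<mu>"
    unfolding tight_def
  proof (intro conjI allI impI)
    fix \<epsilon> :: real assume "\<epsilon> > 0"
    have "measure (\<mu> n) {-1<..2} = 1" for n
    proof -
      have "(\<lambda>s. code (\<phi> s (p n))) -` {-1<..2} \<inter> space (U n) = space (U n)"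
      proof -
        have "code x \<in> {-1<..2}" for x using code(2)[of x] by auto
        then show ?thesis by blast
      qed
      then show ?thesis unfolding \<mu>_def
        by (subst measure_distr[OF cm]) (simp_all add: prob_space.prob_space[OF Uprob])
    qed
    then show "\<exists>a b. a < b \<and> (\<forall>n. 1 - \<epsilon> < measure (\<mu> n) {a<..b})"
      using \<open>\<epsilon> > 0\<close> by (intro exI[of _ "-1"] exI[of _ 2]) simp
  qed (rule \<mu>dist)
  from tight_imp_convergent_subsubsequence[OF this strict_mono_id]
  obtain r \<nu>0 where r: "strict_mono (r :: nat \<Rightarrow> nat)" "real_distribution \<nu>0" "weak_conv_m (\<mu> \<circ> r) \<nu>0"
    by (auto simp: comp_assoc)
  interpret n0: real_distribution \<nu>0 by fact
  have weak: "(\<lambda>n. \<integral>z. H z \<partial>\<mu> (r n)) \<longlonglongrightarrow> (\<integral>z. H z \<partial>\<nu>0)"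
    if "continuous_on UNIV H" "\<And>z. norm (H z) \<le> B" for H :: "real \<Rightarrow> real" and B
  proof -
    have "(\<lambda>n. integral\<^sup>L ((\<mu> \<circ> r) n) H) \<longlonglongrightarrow> integral\<^sup>L \<nu>0 H"
    proof (rule weak_conv_imp_integral_bdd_continuous_conv)
      show "real_distribution ((\<mu> \<circ> r) n)" for n using \<mu>dist by simp
      show "isCont H x" for x using that(1) continuous_on_eq_continuous_at by blast
      show "weak_conv_m (\<mu> \<circ> r) \<nu>0" by (rule r(3))
    qed (use r(2) that(2) in auto)
    then show ?thesis by (simp add: o_def)
  qed
  \<comment> \<open>The limit may charge limit points of codes, but nothing outside their closure:
    the distance to \<open>Cl\<close>, cut off at 1 to be a bounded test function, has integral 0
    all along the sequence.\<close>
  have AECl: "AE z in \<nu>0. z \<in> Cl"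
  proof -
    define k where "k z = min 1 (infdist z Cl)" for z
    have kc: "continuous_on UNIV k" unfolding k_def by (intro continuous_intros)
    have kb: "0 \<le> k z" "k z \<le> 1" for z by (auto simp: k_def infdist_nonneg)
    have "k (code (\<phi> s (p n))) = 0" for s n
      using Cl(3)[OF \<phi>M[OF p]] by (simp add: k_def)
    then have "(\<integral>z. k z \<partial>\<mu> (r n)) = 0" for n by (simp add: int\<mu>[OF kc])
    moreover have "(\<lambda>n. \<integral>z. k z \<partial>\<mu> (r n)) \<longlonglongrightarrow> (\<integral>z. k z \<partial>\<nu>0)"
      by (rule weak[OF kc, of 1]) (use kb in simp)
    ultimately have "(\<integral>z. k z \<partial>\<nu>0) = 0" by (simp add: LIMSEQ_const_iff)
    moreover have "integrable \<nu>0 k"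
      by (rule n0.integrable_const_bound[of _ 1])
         (use kb borel_measurable_continuous_onI[OF kc] in auto)
    ultimately have "AE z in \<nu>0. k z = 0"
      using integral_nonneg_eq_0_iff_AE[of \<nu>0 k] kb by simp
    then show ?thesis
    proof (rule AE_mp, intro AE_I2 impI)
      fix z assume "k z = 0"
      then have "infdist z Cl = 0" by (simp add: k_def min_def split: if_splits)
      then show "z \<in> Cl" using in_closed_iff_infdist_zero[OF Cl(1,2)] by simp
    qed
  qed
  \<comment> \<open>The default \<open>p 0\<close> is taken on a null set only; it keeps all values
    inside \<open>M\<close>.\<close>
  define \<pi>' where "\<pi>' z = (if z \<in> Cl then \<pi> z else p 0)" for z
  have \<pi>'M: "\<pi>' z \<in> M" for z using \<pi>(2) p by (simp add: \<pi>'_def Cl_def)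
  have \<pi>'m: "\<pi>' \<in> \<nu>0 \<rightarrow>\<^sub>M restrict_space borel M"
  proof (rule measurable_restrict_space2)
    have "\<pi>' \<in> borel_measurable borel"
      unfolding \<pi>'_def by (rule borel_measurable_continuous_on_if) (use Cl(1) \<pi>(1) in \<open>auto simp: Cl_def\<close>)
    then show "\<pi>' \<in> borel_measurable \<nu>0" by (simp add: measurable_cong_sets[OF n0.events_eq_borel refl])
  qed (use \<pi>'M in auto)
  define \<nu> where "\<nu> = distr \<nu>0 (restrict_space borel M) \<pi>'"
  have \<nu>sets: "sets \<nu> = sets (restrict_space borel M)" by (simp add: \<nu>_def)
  have \<nu>space: "space \<nu> = M" by (simp add: \<nu>_def space_restrict_space)
  have \<nu>prob: "prob_space \<nu>" unfolding \<nu>_def by (rule n0.prob_space_distr[OF \<pi>'m])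
  have hm: "h \<in> borel_measurable \<nu>" if "continuous_on M h" for h :: "'y \<Rightarrow> real"
    using borel_measurable_continuous_on_restrict[OF that] by (simp add: measurable_cong_sets[OF \<nu>sets refl])
  have bound: "\<exists>B\<ge>0. \<forall>x\<in>M. norm (h x) \<le> B" if "continuous_on M h" for h :: "'y \<Rightarrow> real"
  proof -
    have "bounded (h ` M)" by (intro compact_imp_bounded compact_continuous_image that M)
    then obtain B where "\<forall>y\<in>h ` M. norm y \<le> B" unfolding bounded_iff by blast
    then have "\<forall>x\<in>M. norm (h x) \<le> max 0 B" by (auto simp: le_max_iff_disj)
    then show ?thesis by (intro exI[of _ "max 0 B"]) simp
  qed
  have conv: "(\<lambda>n. \<integral>s. h (\<phi> s (p (r n))) \<partial>U (r n)) \<longlonglongrightarrow> (\<integral>x. h x \<partial>\<nu>)" if h: "continuous_on M h" for h :: "'y \<Rightarrow> real"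
  proof -
    obtain B where B: "B \<ge> 0" "\<forall>x\<in>M. norm (h x) \<le> B" using bound[OF h] by blast
    have 1: "continuous_on Cl (\<lambda>z. h (\<pi> z))"
      unfolding Cl_def by (rule continuous_on_compose2[OF h \<pi>(1)]) (use \<pi>(2) in auto)
    have 2: "norm (h (\<pi> z)) \<le> B" if "z \<in> Cl" for z using B(2) \<pi>(2) that by (simp add: Cl_def)
    have 3: "closedin (top_of_set UNIV) Cl" using Cl(1) by simp
    \<comment> \<open>Weak convergence on the line is tested with functions defined everywhere, so
      \<open>h \<circ> \<pi>\<close> is extended from the closed set \<open>Cl\<close> without
      enlarging its bound.\<close>
    obtain H where H: "continuous_on UNIV H" "\<And>z. z \<in> Cl \<Longrightarrow> H z = h (\<pi> z)" "\<And>z. norm (H z) \<le> B"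
      using Tietze[OF 1 3 B(1) 2] by (metis UNIV_I)
    have "H (code (\<phi> s (p n))) = h (\<phi> s (p n))" for s n
      using H(2)[OF Cl(3)[OF \<phi>M[OF p]]] \<pi>(3)[OF \<phi>M[OF p]] by simp
    then have "(\<integral>z. H z \<partial>\<mu> (r n)) = (\<integral>s. h (\<phi> s (p (r n))) \<partial>U (r n))" for n
      by (simp add: int\<mu>[OF H(1)])
    moreover have "(\<integral>z. H z \<partial>\<nu>0) = (\<integral>x. h x \<partial>\<nu>)"
    proof -
      have "(\<integral>x. h x \<partial>\<nu>) = (\<integral>z. h (\<pi>' z) \<partial>\<nu>0)"
        unfolding \<nu>_def by (rule integral_distr[OF \<pi>'m borel_measurable_continuous_on_restrict[OF h]])
      also have "\<dots> = (\<integral>z. H z \<partial>\<nu>0)"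
      proof (rule integral_cong_AE)
        show "(\<lambda>z. h (\<pi>' z)) \<in> borel_measurable \<nu>0"
          by (rule measurable_compose[OF \<pi>'m borel_measurable_continuous_on_restrict[OF h]])
        show "H \<in> borel_measurable \<nu>0"
          using borel_measurable_continuous_onI[OF H(1)] by (simp add: measurable_cong_sets[OF n0.events_eq_borel refl])
        show "AE z in \<nu>0. h (\<pi>' z) = H z" using AECl by (rule AE_mp) (simp add: H(2) \<pi>'_def)
      qed
      finally show ?thesis by simp
    qed
    ultimately show ?thesis using weak[OF H(1,3)] by simp
  qed
  \<comment> \<open>Time averages over \<open>[t, T + t]\<close> and \<open>[0, T]\<close> differ by
    two boundary terms of an antiderivative, together at most
    \<open>2 * B * \<bar>t\<bar> / T\<close>, and \<open>T\<close> tends to infinity along the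
    subsequence.\<close>
  have shift: "(\<integral>x. h (\<phi> t x) \<partial>\<nu>) = (\<integral>x. h x \<partial>\<nu>)" if h: "continuous_on M h" for h :: "'y \<Rightarrow> real" and t
  proof -
    obtain B where B: "B \<ge> 0" "\<forall>x\<in>M. norm (h x) \<le> B" using bound[OF h] by blast
    have ht: "continuous_on M (\<lambda>x. h (\<phi> t x))"
      by (rule continuous_on_compose2[OF h \<phi>cont]) (use \<phi>M in auto)
    define d where "d n = (\<integral>s. h (\<phi> t (\<phi> s (p (r n)))) \<partial>U (r n)) - (\<integral>s. h (\<phi> s (p (r n))) \<partial>U (r n))" for n
    have dlim: "d \<longlonglongrightarrow> (\<integral>x. h (\<phi> t x) \<partial>\<nu>) - (\<integral>x. h x \<partial>\<nu>)"
      unfolding d_def by (intro tendsto_diff conv ht h)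
    have dbound: "norm (d n) \<le> 2 * B * \<bar>t\<bar> * inverse (real (Suc n))" for n
    proof -
      define q where "q s = h (\<phi> s (p (r n)))" for s
      define T where "T = real (r n) + 1"
      have qc: "continuous_on UNIV q"
        unfolding q_def by (rule continuous_on_compose2[OF h \<phi>orbit[OF p]]) (use \<phi>M[OF p] in auto)
      have qB: "norm (q s) \<le> B" for s using B(2) \<phi>M[OF p] by (simp add: q_def)
      define F where "F u = (LBINT s=ereal 0..ereal u. q s)" for u
      have F: "(F has_real_derivative q s) (at s)" for s unfolding F_def by (rule interval_integral_DERIV[OF qc])
      have FB: "\<bar>F u - F v\<bar> \<le> B * \<bar>u - v\<bar>" for u v
        using field_differentiable_bound[of UNIV F q B u v] F qB by simp
      have Ft: "((\<lambda>s. F (t + s)) has_real_derivative q (t + s)) (at s)" for s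
        using F[of "s + t"] by (simp add: DERIV_shift add.commute)
      have qct: "continuous_on UNIV (\<lambda>s. q (t + s))"
        by (rule continuous_on_compose2[OF qc]) (auto intro!: continuous_intros)
      have "T > 0" by (simp add: T_def)
      have "d n = (F (t + T) - F (t + 0)) / T - (F T - F 0) / T"
        using integral_time_uniform[OF \<open>T > 0\<close> qct Ft] integral_time_uniform[OF \<open>T > 0\<close> qc F]
        by (simp add: d_def U_def T_def q_def \<phi>add[OF p])
      also have "\<dots> = ((F (t + T) - F T) - (F t - F 0)) / T" by (simp add: diff_divide_distrib)
      finally have "norm (d n) = \<bar>(F (t + T) - F T) - (F t - F 0)\<bar> / T" using \<open>T > 0\<close> by simp
      also have "\<dots> \<le> (2 * B * \<bar>t\<bar>) / T"
        using FB[of "t + T" T] FB[of t 0] \<open>T > 0\<close> by (intro divide_right_mono) auto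
      also have "\<dots> \<le> (2 * B * \<bar>t\<bar>) / real (Suc n)"
        using seq_suble[OF r(1), of n] B(1) by (intro divide_left_mono) (auto simp: T_def)
      finally show ?thesis by (simp add: field_simps)
    qed
    have "d \<longlonglongrightarrow> 0"
    proof (rule Lim_null_comparison)
      show "\<forall>\<^sub>F n in sequentially. norm (d n) \<le> 2 * B * \<bar>t\<bar> * inverse (real (Suc n))" using dbound by simp
      show "(\<lambda>n. 2 * B * \<bar>t\<bar> * inverse (real (Suc n))) \<longlonglongrightarrow> 0"
        using tendsto_mult_left[OF LIMSEQ_inverse_real_of_nat, of "2 * B * \<bar>t\<bar>"] by simp
    qed
    with dlim show ?thesis using LIMSEQ_unique by fastforce
  qed
  have \<phi>m: "\<phi> t \<in> measurable \<nu> \<nu>" for t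
  proof -
    have "\<phi> t \<in> restrict_space borel M \<rightarrow>\<^sub>M restrict_space borel M"
      by (rule measurable_restrict_space2)
         (use \<phi>M borel_measurable_continuous_on_restrict[OF \<phi>cont] in \<open>auto simp: space_restrict_space\<close>)
    then show ?thesis by (simp add: measurable_cong_sets[OF \<nu>sets \<nu>sets])
  qed
  \<comment> \<open>Continuous functions separate measures on the whole type, so both measures are
    pushed forward by the inclusion of \<open>M\<close>. Nothing is lost, as the measurable sets of
    \<open>\<nu>\<close> are the traces \<open>M \<inter> Y\<close> of Borel sets.\<close>
  have idm: "(\<lambda>x. x) \<in> \<nu> \<rightarrow>\<^sub>M borel"
    by (rule measurable_compose[of "\<lambda>x. x" \<nu> "restrict_space borel M"])
       (auto simp: measurable_cong_sets[OF \<nu>sets refl] intro: measurable_restrict_space1)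
  have "distr \<nu> \<nu> (\<phi> t) = \<nu>" for t
  proof -
    interpret nu: prob_space \<nu> by (rule \<nu>prob)
    interpret nut: prob_space "distr \<nu> \<nu> (\<phi> t)" by (rule nu.prob_space_distr[OF \<phi>m])
    have idm': "(\<lambda>x. x) \<in> distr \<nu> \<nu> (\<phi> t) \<rightarrow>\<^sub>M borel" using idm by simp
    have "distr (distr \<nu> \<nu> (\<phi> t)) borel (\<lambda>x. x) = distr \<nu> borel (\<lambda>x. x)"
    proof (rule borel_measure_eqI_continuous)
      show "finite_measure (distr (distr \<nu> \<nu> (\<phi> t)) borel (\<lambda>x. x))" "finite_measure (distr \<nu> borel (\<lambda>x. x))"
        by (intro prob_space.finite_measure nut.prob_space_distr idm' nu.prob_space_distr idm)+
      fix h :: "'y \<Rightarrow> real" assume h: "continuous_on UNIV h"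
      have hb: "h \<in> borel_measurable borel" by (rule borel_measurable_continuous_onI[OF h])
      have hM: "continuous_on M h" by (rule continuous_on_subset[OF h]) simp
      have "(\<integral>x. h x \<partial>distr (distr \<nu> \<nu> (\<phi> t)) borel (\<lambda>x. x)) = (\<integral>x. h x \<partial>distr \<nu> \<nu> (\<phi> t))"
        by (rule integral_distr[OF idm' hb])
      also have "\<dots> = (\<integral>x. h (\<phi> t x) \<partial>\<nu>)" by (rule integral_distr[OF \<phi>m hm[OF hM]])
      also have "\<dots> = (\<integral>x. h x \<partial>\<nu>)" by (rule shift[OF hM])
      also have "\<dots> = (\<integral>x. h x \<partial>distr \<nu> borel (\<lambda>x. x))" by (rule integral_distr[OF idm hb, symmetric])
      finally show "(\<integral>x. h x \<partial>distr (distr \<nu> \<nu> (\<phi> t)) borel (\<lambda>x. x)) = (\<integral>x. h x \<partial>distr \<nu> borel (\<lambda>x. x))" .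
    qed simp_all
    note deq = this
    show ?thesis
    proof (rule measure_eqI)
      fix X assume "X \<in> sets (distr \<nu> \<nu> (\<phi> t))"
      then have "X \<in> sets (restrict_space borel M)" using \<nu>sets by simp
      then obtain Y where Y: "Y \<in> sets borel" "X = M \<inter> Y" unfolding sets_restrict_space by blast
      have X: "(\<lambda>x. x) -` Y \<inter> M = X" using Y(2) by auto
      have "emeasure (distr (distr \<nu> \<nu> (\<phi> t)) borel (\<lambda>x. x)) Y = emeasure (distr \<nu> \<nu> (\<phi> t)) X"
        by (subst emeasure_distr[OF idm' Y(1)]) (simp add: \<nu>space X del: vimage_ident)
      moreover have "emeasure (distr \<nu> borel (\<lambda>x. x)) Y = emeasure \<nu> X"
        by (subst emeasure_distr[OF idm Y(1)]) (simp add: \<nu>space X del: vimage_ident)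
      ultimately show "emeasure (distr \<nu> \<nu> (\<phi> t)) X = emeasure \<nu> X" using deq by simp
    qed simp
  qed
  then have "\<nu> \<in> invariant_probs M \<phi>"
    unfolding invariant_probs_def using \<nu>prob \<nu>sets \<phi>m by blast
  then show ?thesis using that[OF _ r(1)] conv unfolding U_def by blast
qed

subsection \<open>Minimal base flows and cocycles of spectral bound zero\<close>

locale minimal_base_flow =
  fixes \<sigma> :: "real \<Rightarrow> 'w::metric_space \<Rightarrow> 'w"
  assumes compact_base: "compact (UNIV :: 'w set)"
    and flow: "continuous_flow \<sigma>"
    and minimal: "minimal_set (flow_invariant \<sigma>) UNIV"
begin

lemma base_zero [simp]: "\<sigma> 0 \<omega> = \<omega>"
  and base_add: "\<sigma> (s + t) \<omega> = \<sigma> s (\<sigma> t \<omega>)"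
  using flow by (auto simp: continuous_flow_def)

lemma base_minus [simp]: "\<sigma> (- t) (\<sigma> t \<omega>) = \<omega>" "\<sigma> t (\<sigma> (- t) \<omega>) = \<omega>"
  using base_add[of "- t" t \<omega>] base_add[of t "- t" \<omega>] by auto

lemma continuous_on_base [continuous_intros]:
  assumes "continuous_on S p" "continuous_on S q"
  shows "continuous_on S (\<lambda>x. \<sigma> (p x) (q x))"
  using continuous_on_compose2[of UNIV "\<lambda>(t, \<omega>). \<sigma> t \<omega>" S "\<lambda>x. (p x, q x)"] flow
    continuous_on_Pair[OF assms] by (simp add: continuous_flow_def)

lemma minimal_base: "compact K \<Longrightarrow> flow_invariant \<sigma> K \<Longrightarrow> K \<noteq> {} \<Longrightarrow> K = UNIV"
  using minimal by (simp add: minimal_set_def)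

text \<open>The points whose orbits avoid \<open>V\<close> form a compact invariant set, which
  minimality makes empty; a finite subcover bounds the time. The sign of the time is left open and
  is fixed by those who use this, by moving the starting point by \<open>T\<close>
  beforehand.\<close>

lemma uniform_hitting_time:
  assumes "open V" "V \<noteq> {}"
  obtains T where "T > 0" "\<And>\<omega>. \<exists>t. \<bar>t\<bar> \<le> T \<and> \<sigma> t \<omega> \<in> V"
proof -
  define K where "K = {\<omega>. \<forall>t. \<sigma> t \<omega> \<notin> V}"
  have op: "open {\<omega>. \<sigma> t \<omega> \<in> V}" for t
    using open_vimage[OF \<open>open V\<close>, of "\<sigma> t"] by (simp add: vimage_def continuous_intros)
  have "K = UNIV - (\<Union>t. {\<omega>. \<sigma> t \<omega> \<in> V})" by (auto simp: K_def)
  then have "closed K" using op by auto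
  then have "compact K" using compact_base compact_Int_closed[of UNIV K] by simp
  moreover have "flow_invariant \<sigma> K"
  proof -
    have sub: "\<sigma> t ` K \<subseteq> K" for t by (auto simp: K_def simp flip: base_add)
    have "K \<subseteq> \<sigma> t ` K" for t
    proof
      fix x assume "x \<in> K"
      then have "\<sigma> (- t) x \<in> K" using sub[of "- t"] by blast
      then show "x \<in> \<sigma> t ` K" by (metis base_minus(2) imageI)
    qed
    with sub show ?thesis unfolding flow_invariant_def by blast
  qed
  moreover have "K \<noteq> UNIV"
  proof -
    obtain v where "v \<in> V" using assms(2) by blast
    then have "\<sigma> 0 v \<in> V" by simp
    then have "\<not> (\<forall>t. \<sigma> t v \<notin> V)" by (intro notI) (erule allE[of _ 0], simp)
    then have "v \<notin> K" by (simp add: K_def)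
    then show ?thesis by blast
  qed
  ultimately have "K = {}" using minimal_base by blast
  then have "(UNIV :: 'w set) \<subseteq> (\<Union>t\<in>UNIV. {\<omega>. \<sigma> t \<omega> \<in> V})" by (auto simp: K_def)
  then obtain D where D: "finite D" "UNIV \<subseteq> (\<Union>t\<in>D. {\<omega>. \<sigma> t \<omega> \<in> V})"
    using op by (metis (no_types, lifting) compactE_image[OF compact_base])
  define T where "T = Max (insert 1 (abs ` D))"
  have "T \<ge> 1" and DT: "\<And>t. t \<in> D \<Longrightarrow> \<bar>t\<bar> \<le> T" using D(1) by (auto simp: T_def)
  show ?thesis
  proof (rule that[of T])
    show "T > 0" using \<open>T \<ge> 1\<close> by simp
    fix \<omega>
    have "\<omega> \<in> (\<Union>t\<in>D. {\<omega>. \<sigma> t \<omega> \<in> V})" using D(2) by (rule subsetD) simp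
    then obtain t where "t \<in> D" "\<sigma> t \<omega> \<in> V" by auto
    then show "\<exists>t. \<bar>t\<bar> \<le> T \<and> \<sigma> t \<omega> \<in> V" using DT[of t] by blast
  qed
qed

lemma base_dense_forward:
  assumes "open V" "V \<noteq> {}"
  obtains t where "t \<ge> T" "\<sigma> t \<omega> \<in> V"
proof -
  obtain T0 where T0: "T0 > 0" "\<And>\<omega>. \<exists>t. \<bar>t\<bar> \<le> T0 \<and> \<sigma> t \<omega> \<in> V"
    using uniform_hitting_time[OF assms] by blast
  obtain t where "\<bar>t\<bar> \<le> T0" "\<sigma> t (\<sigma> (T + T0) \<omega>) \<in> V" using T0(2) by blast
  then show ?thesis using that[of "t + (T + T0)"] by (simp add: base_add[of t])
qed

lemma base_dense_backward:
  assumes "open V" "V \<noteq> {}"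
  obtains t where "t \<ge> T" "\<sigma> (- t) \<omega> \<in> V"
proof -
  obtain T0 where T0: "T0 > 0" "\<And>\<omega>. \<exists>t. \<bar>t\<bar> \<le> T0 \<and> \<sigma> t \<omega> \<in> V"
    using uniform_hitting_time[OF assms] by blast
  obtain t where t: "\<bar>t\<bar> \<le> T0" "\<sigma> t (\<sigma> (- (T + T0)) \<omega>) \<in> V" using T0(2) by blast
  have "\<sigma> (- (T + T0 - t)) \<omega> = \<sigma> t (\<sigma> (- (T + T0)) \<omega>)"
    unfolding base_add[symmetric] by (rule arg_cong[of _ _ "\<lambda>r. \<sigma> r \<omega>"]) simp
  then have "\<sigma> (- (T + T0 - t)) \<omega> \<in> V" using t by simp
  moreover have "T + T0 - t \<ge> T" using t by linarith
  ultimately show ?thesis using that by blast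
qed

text \<open>By continuity of the flow at \<open>(0, \<omega>0)\<close>, orbits entering a smaller
  open set \<open>W\<close> remain in \<open>V\<close> for a time \<open>e\<close>, and
  \<open>W\<close> is reached within a bounded time. This is the source of the uniform proportion of
  time spent in a contracting region.\<close>

lemma uniform_sojourn:
  assumes "open V" "V \<noteq> {}"
  obtains P \<delta> where "P > 0" "\<delta> > 0" "\<delta> \<le> P"
    "\<And>\<omega>. \<exists>t\<ge>0. t + \<delta> \<le> P \<and> (\<forall>s. 0 \<le> s \<and> s \<le> \<delta> \<longrightarrow> \<sigma> (t + s) \<omega> \<in> V)"
proof -
  obtain \<omega>0 where "\<omega>0 \<in> V" using assms by blast
  have "open ((\<lambda>(t, \<omega>). \<sigma> t \<omega>) -` V)"
    using flow assms(1) by (auto simp: continuous_flow_def intro: open_vimage)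
  moreover have "(0, \<omega>0) \<in> (\<lambda>(t, \<omega>). \<sigma> t \<omega>) -` V" using \<open>\<omega>0 \<in> V\<close> by simp
  ultimately obtain I W where "open I" "open W" "(0, \<omega>0) \<in> I \<times> W" and
      IW': "I \<times> W \<subseteq> (\<lambda>(t, \<omega>). \<sigma> t \<omega>) -` V"
    by (rule open_prod_elim)
  then have IW: "open I" "open W" "0 \<in> I" "\<omega>0 \<in> W" by auto
  obtain e where e: "e > 0" "cball 0 e \<subseteq> I" using IW open_contains_cball by blast
  obtain T0 where T0: "T0 > 0" "\<And>\<omega>. \<exists>t. \<bar>t\<bar> \<le> T0 \<and> \<sigma> t \<omega> \<in> W"
    using uniform_hitting_time[OF IW(2)] IW(4) by blast
  show ?thesis
  proof (rule that[of "2 * T0 + e" e])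
    fix \<omega>
    obtain t where t: "\<bar>t\<bar> \<le> T0" "\<sigma> t (\<sigma> T0 \<omega>) \<in> W" using T0(2) by blast
    have "\<sigma> (t + T0 + s) \<omega> \<in> V" if "0 \<le> s" "s \<le> e" for s
    proof -
      have "s \<in> I" using e that by (auto simp: subset_iff dist_real_def)
      then have "\<sigma> s (\<sigma> t (\<sigma> T0 \<omega>)) \<in> V" using IW' t by auto
      then show ?thesis by (simp add: add.commute[of _ s] flip: base_add)
    qed
    then show "\<exists>t\<ge>0. t + e \<le> 2 * T0 + e \<and> (\<forall>s. 0 \<le> s \<and> s \<le> e \<longrightarrow> \<sigma> (t + s) \<omega> \<in> V)"
      using t by (intro exI[of _ "t + T0"]) auto
  qed (use T0 e in auto)
qed

text \<open>Gronwall for the squared difference, where \<open>e\<close> bounds the change of the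
  right-hand side along the limit solution when the base point moves (uniform continuity on a
  compact set). The Lipschitz bound is asked on \<open>S\<close> only, which suits right-hand sides
  that are Lipschitz on bounded sets.\<close>

lemma ode_sequential_dependence:
  fixes F :: "'w \<Rightarrow> real \<Rightarrow> real"
  assumes F: "continuous_on UNIV (\<lambda>(\<omega>, x). F \<omega> x)"
    and L: "L \<ge> 0" "\<And>\<omega> x y. x \<in> S \<Longrightarrow> y \<in> S \<Longrightarrow> \<bar>F \<omega> x - F \<omega> y\<bar> \<le> L * \<bar>x - y\<bar>"
    and X: "X \<longlonglongrightarrow> \<omega>"
    and u: "\<And>n s. s \<in> closed_segment 0 t \<Longrightarrow> (u n has_real_derivative F (\<sigma> s (X n)) (u n s)) (at s)"
      "\<And>n s. s \<in> closed_segment 0 t \<Longrightarrow> u n s \<in> S"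
    and v: "\<And>s. s \<in> closed_segment 0 t \<Longrightarrow> (v has_real_derivative F (\<sigma> s \<omega>) (v s)) (at s)"
      "\<And>s. s \<in> closed_segment 0 t \<Longrightarrow> v s \<in> S"
    and lim: "(\<lambda>n. u n 0) \<longlonglongrightarrow> v 0"
  shows "(\<lambda>n. u n t) \<longlonglongrightarrow> v t"
proof -
  define J where "J = closed_segment 0 t"
  define E where "E = exp ((1 + 2 * L) * \<bar>t\<bar>)"
  have "E > 0" by (simp add: E_def)
  have vc: "continuous_on J v"
  proof (intro continuous_at_imp_continuous_on ballI)
    fix s assume "s \<in> J"
    then show "isCont v s" using v(1) DERIV_isCont unfolding J_def by blast
  qed
  have hc: "continuous_on (UNIV \<times> J) (\<lambda>(w, s). F (\<sigma> s w) (v s))"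
  proof -
    have vc2: "continuous_on (UNIV \<times> J) (\<lambda>z. v (snd z))"
      by (rule continuous_on_compose2[OF vc continuous_on_snd[OF continuous_on_id]]) auto
    have "continuous_on (UNIV \<times> J) (\<lambda>z. (\<sigma> (snd z) (fst z), v (snd z)))"
      by (intro continuous_intros vc2)
    from continuous_on_compose2[OF F this] show ?thesis by (simp add: case_prod_beta)
  qed
  have "compact ((UNIV :: 'w set) \<times> J)" unfolding J_def by (intro compact_Times compact_base) auto
  then have uc: "uniformly_continuous_on (UNIV \<times> J) (\<lambda>(w, s). F (\<sigma> s w) (v s))"
    using compact_uniformly_continuous hc by blast
  have main: "\<forall>\<^sub>F n in sequentially. (u n t - v t)\<^sup>2 + e\<^sup>2 \<le> E * ((u n 0 - v 0)\<^sup>2 + e\<^sup>2)"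
    if "e > 0" for e
  proof -
    obtain d where d: "d > 0" "\<forall>p\<in>UNIV \<times> J. \<forall>q\<in>UNIV \<times> J. dist q p < d \<longrightarrow>
        dist ((\<lambda>(w, s). F (\<sigma> s w) (v s)) q) ((\<lambda>(w, s). F (\<sigma> s w) (v s)) p) < e"
      using uc[unfolded uniformly_continuous_on_def, rule_format, OF \<open>e > 0\<close>] by blast
    have "\<forall>\<^sub>F n in sequentially. dist (X n) \<omega> < d" using X d(1) tendstoD by blast
    then show ?thesis
    proof (rule eventually_mono)
      fix n assume n: "dist (X n) \<omega> < d"
      have "(\<lambda>s. (u n s - v s)\<^sup>2) t + e\<^sup>2 \<le> exp ((1 + 2 * L) * \<bar>t - 0\<bar>) * ((\<lambda>s. (u n s - v s)\<^sup>2) 0 + e\<^sup>2)"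
      proof (rule gronwall_segment)
        fix s assume s: "s \<in> closed_segment 0 t"
        let ?D = "F (\<sigma> s (X n)) (u n s) - F (\<sigma> s \<omega>) (v s)" and ?w = "u n s - v s"
        show "((\<lambda>s. (u n s - v s)\<^sup>2) has_real_derivative 2 * ?w * ?D) (at s)"
          using DERIV_power[where n=2, OF DERIV_diff[OF u(1)[OF s, of n] v(1)[OF s]]] by (simp add: algebra_simps)
        have "(\<omega>, s) \<in> UNIV \<times> J" "(X n, s) \<in> UNIV \<times> J" using s by (auto simp: J_def)
        moreover have "dist (X n, s) (\<omega>, s) < d" using n by (simp add: dist_Pair_Pair)
        ultimately have "dist (F (\<sigma> s (X n)) (v s)) (F (\<sigma> s \<omega>) (v s)) < e"
          using d(2)[rule_format, of "(\<omega>, s)" "(X n, s)"] by simp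
        then have "\<bar>F (\<sigma> s (X n)) (v s) - F (\<sigma> s \<omega>) (v s)\<bar> < e"
          by (simp add: dist_real_def)
        moreover have "\<bar>F (\<sigma> s (X n)) (u n s) - F (\<sigma> s (X n)) (v s)\<bar> \<le> L * \<bar>?w\<bar>"
          using L(2) u(2)[OF s] v(2)[OF s] by blast
        ultimately have "\<bar>?D\<bar> \<le> e + L * \<bar>?w\<bar>" by linarith
        then have "\<bar>2 * ?w * ?D\<bar> \<le> 2 * \<bar>?w\<bar> * (e + L * \<bar>?w\<bar>)"
          unfolding abs_mult by (intro mult_mono) auto
        also have "\<dots> = 2 * \<bar>?w\<bar> * e + 2 * L * ?w\<^sup>2"
          by (simp add: algebra_simps power2_eq_square)
        also have "2 * \<bar>?w\<bar> * e \<le> ?w\<^sup>2 + e\<^sup>2"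
          using sum_squares_bound[of "\<bar>?w\<bar>" e] by simp
        also have "?w\<^sup>2 + e\<^sup>2 + 2 * L * ?w\<^sup>2 \<le> (1 + 2 * L) * (?w\<^sup>2 + e\<^sup>2)"
          using L(1) by (simp add: algebra_simps)
        finally show "\<bar>2 * ?w * ?D\<bar> \<le> (1 + 2 * L) * (?w\<^sup>2 + e\<^sup>2)" by simp
      qed
      then show "(u n t - v t)\<^sup>2 + e\<^sup>2 \<le> E * ((u n 0 - v 0)\<^sup>2 + e\<^sup>2)" by (simp add: E_def)
    qed
  qed
  have "(\<lambda>n. (u n t - v t)\<^sup>2) \<longlonglongrightarrow> 0"
  proof (rule tendstoI)
    fix \<epsilon> :: real assume "\<epsilon> > 0"
    \<comment> \<open>\<open>E * e\<^sup>2\<close> is half of the tolerance; the other half pays for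
      the difference of the initial values.\<close>
    define e where "e = sqrt (\<epsilon> / (2 * E))"
    have e: "e > 0" "E * e\<^sup>2 = \<epsilon> / 2" using \<open>\<epsilon> > 0\<close> \<open>E > 0\<close> by (auto simp: e_def)
    have "(\<lambda>n. (u n 0 - v 0)\<^sup>2) \<longlonglongrightarrow> (v 0 - v 0)\<^sup>2" by (intro tendsto_intros lim)
    then have "\<forall>\<^sub>F n in sequentially. (u n 0 - v 0)\<^sup>2 < \<epsilon> / (2 * E)"
      by (rule order_tendstoD(2)) (use \<open>\<epsilon> > 0\<close> \<open>E > 0\<close> in simp)
    with main[OF e(1)] show "\<forall>\<^sub>F n in sequentially. dist ((u n t - v t)\<^sup>2) 0 < \<epsilon>"
    proof eventually_elim
      case (elim n)
      define x where "x = (u n 0 - v 0)\<^sup>2"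
      have "E * x < \<epsilon> / 2" using elim(2) \<open>E > 0\<close> by (simp add: x_def field_simps)
      moreover have "(u n t - v t)\<^sup>2 + e\<^sup>2 \<le> E * x + E * e\<^sup>2"
        using elim(1) by (simp only: x_def distrib_left)
      moreover have "0 \<le> e\<^sup>2" "0 \<le> (u n t - v t)\<^sup>2" by simp_all
      ultimately have "(u n t - v t)\<^sup>2 < \<epsilon>" using e(2) by linarith
      then show ?case by simp
    qed
  qed
  then have "(\<lambda>n. u n t - v t) \<longlonglongrightarrow> 0"
    using tendsto_real_sqrt[of "\<lambda>n. (u n t - v t)\<^sup>2" 0] by (simp add: tendsto_rabs_zero_iff)
  then show ?thesis using LIM_zero_iff by blast
qed

end


section \<open>The cocycle given by the integral of \<open>a\<close> along orbits\<close>

locale base_cocycle = minimal_base_flow \<sigma> for \<sigma> :: "real \<Rightarrow> 'w::metric_space \<Rightarrow> 'w" +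
  fixes a :: "'w \<Rightarrow> real"
  assumes a_cont: "continuous_on UNIV a"
begin

abbreviation C :: "'w \<Rightarrow> real \<Rightarrow> real" where
  "C \<equiv> orbit_integral \<sigma> a"

lemma continuous_a_orbit: "continuous_on UNIV (\<lambda>s. a (\<sigma> s \<omega>))"
  by (rule continuous_on_compose2[OF a_cont]) (auto intro!: continuous_intros)

lemma C_deriv: "(C \<omega> has_real_derivative a (\<sigma> t \<omega>)) (at t)"
  using interval_integral_DERIV[OF continuous_a_orbit] unfolding orbit_integral_def[abs_def] by simp

lemma C_zero [simp]: "C \<omega> 0 = 0"
  by (simp add: orbit_integral_def zero_ereal_def[symmetric])

lemma C_isCont: "isCont (C \<omega>) t"
  using C_deriv DERIV_isCont by blast

lemma C_add: "C \<omega> (s + t) = C \<omega> t + C (\<sigma> t \<omega>) s"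
proof -
  have "((\<lambda>s. C \<omega> (s + t) - C (\<sigma> t \<omega>) s) has_real_derivative 0) (at s)" for s
    using C_deriv[of \<omega> "s + t"] C_deriv[of "\<sigma> t \<omega>" s]
    by (auto intro!: derivative_eq_intros simp: base_add DERIV_shift)
  then have "C \<omega> (s + t) - C (\<sigma> t \<omega>) s = C \<omega> (0 + t) - C (\<sigma> t \<omega>) 0"
    by (rule DERIV_isconst_all[rule_format])
  then show ?thesis by simp
qed

lemma orbit_integral_diff_const: "orbit_integral \<sigma> (\<lambda>\<omega>. a \<omega> - l) \<omega> t = C \<omega> t - l * t"
  unfolding orbit_integral_def[of \<sigma> "\<lambda>\<omega>. a \<omega> - l"]
  by (subst interval_integral_unique_primitive[where F="\<lambda>t. C \<omega> t - l * t"])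
     (auto intro!: continuous_intros continuous_a_orbit derivative_eq_intros C_deriv)

text \<open>The summand 1 makes the bound strict and the constant positive.\<close>

definition a_max :: real where
  "a_max = (SUP \<omega>. \<bar>a \<omega>\<bar>) + 1"

lemma a_max: "\<bar>a \<omega>\<bar> < a_max"
proof -
  have "bounded (a ` UNIV)" using compact_continuous_image[OF a_cont compact_base] compact_imp_bounded by blast
  then obtain B where "\<And>\<omega>. \<bar>a \<omega>\<bar> \<le> B" unfolding bounded_iff by auto
  then have "bdd_above (range (\<lambda>\<omega>. \<bar>a \<omega>\<bar>))" by (rule bdd_aboveI2)
  then have "\<bar>a \<omega>\<bar> \<le> (SUP \<omega>. \<bar>a \<omega>\<bar>)" by (rule cSUP_upper[OF UNIV_I])
  then show ?thesis by (simp add: a_max_def)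
qed

lemma C_bound: "\<bar>C \<omega> t\<bar> \<le> a_max * \<bar>t\<bar>"
  using field_differentiable_bound[of UNIV "C \<omega>" "\<lambda>t. a (\<sigma> t \<omega>)" a_max t 0] C_deriv[of \<omega>] a_max
  by (auto simp: less_imp_le)

text \<open>The integral is itself the solution of an equation whose right-hand side does not depend
  on the state, so the Lipschitz constant 0 will do.\<close>

lemma C_tendsto:
  assumes "X \<longlonglongrightarrow> \<omega>"
  shows "(\<lambda>n. C (X n) t) \<longlonglongrightarrow> C \<omega> t"
proof (rule ode_sequential_dependence[where F="\<lambda>\<omega> x. a \<omega>" and L=0 and S=UNIV and X=X and \<omega>=\<omega>
      and u="\<lambda>n. C (X n)" and v="C \<omega>"])
  show "continuous_on UNIV (\<lambda>(\<omega>, x). a \<omega>)"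
    using continuous_on_compose2[OF a_cont continuous_on_fst[OF continuous_on_id]] by (simp add: case_prod_beta)
qed (auto intro: C_deriv assms)

lemma C_cont: "continuous_on UNIV (\<lambda>\<omega>. C \<omega> t)"
  unfolding continuous_on_sequentially using C_tendsto by (auto simp: o_def)

end

section \<open>Consequences of the spectral bound zero\<close>

locale critical_cocycle = base_cocycle \<sigma> a for \<sigma> :: "real \<Rightarrow> 'w::metric_space \<Rightarrow> 'w" and a +
  assumes spectrum: "Sup (sacker_sell_spectrum \<sigma> a) = 0"
begin

text \<open>This and \<open>unstable\<close> are the two alternatives in the exponential dichotomy
  of \<open>x' = (a - l) x\<close>, with the constant already integrated.\<close>

definition stable :: "real \<Rightarrow> bool" where
  "stable l \<longleftrightarrow> (\<exists>\<kappa>\<ge>1. \<exists>\<gamma>>0. \<forall>\<omega>. \<forall>t\<ge>0. exp (C \<omega> t - l * t) \<le> \<kappa> * exp (- \<gamma> * t))"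

definition unstable :: "real \<Rightarrow> bool" where
  "unstable l \<longleftrightarrow> (\<exists>\<kappa>\<ge>1. \<exists>\<gamma>>0. \<forall>\<omega>. \<forall>t\<le>0. exp (C \<omega> t - l * t) \<le> \<kappa> * exp (\<gamma> * t))"

lemma spectrum_iff: "l \<in> sacker_sell_spectrum \<sigma> a \<longleftrightarrow> \<not> stable l \<and> \<not> unstable l"
  unfolding sacker_sell_spectrum_def exp_dichotomy_def stable_def unstable_def orbit_integral_diff_const
  by auto

lemma stable_iff: "stable l \<longleftrightarrow> (\<exists>K\<ge>0. \<exists>\<gamma>>0. \<forall>\<omega>. \<forall>t\<ge>0. C \<omega> t - l * t \<le> K - \<gamma> * t)" (is "?l \<longleftrightarrow> ?r")
proof
  assume ?l
  then obtain \<kappa> \<gamma> where *: "\<kappa> \<ge> 1" "\<gamma> > 0" "\<And>\<omega> t. t \<ge> 0 \<Longrightarrow> exp (C \<omega> t - l * t) \<le> \<kappa> * exp (- \<gamma> * t)"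
    unfolding stable_def by blast
  have "C \<omega> t - l * t \<le> ln \<kappa> - \<gamma> * t" if "t \<ge> 0" for \<omega> t
  proof -
    have "exp (C \<omega> t - l * t) \<le> exp (ln \<kappa> - \<gamma> * t)"
      using *(3)[OF that, of \<omega>] *(1) by (simp add: exp_diff exp_minus field_simps)
    then show ?thesis by simp
  qed
  then show ?r using * by (intro exI[of _ "ln \<kappa>"]) auto
next
  assume ?r
  then obtain K \<gamma> where *: "K \<ge> 0" "\<gamma> > 0" "\<And>\<omega> t. t \<ge> 0 \<Longrightarrow> C \<omega> t - l * t \<le> K - \<gamma> * t" by blast
  have "exp (C \<omega> t - l * t) \<le> exp K * exp (- \<gamma> * t)" if "t \<ge> 0" for \<omega> t
    using *(3)[OF that, of \<omega>] by (simp flip: exp_add)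
  then show ?l unfolding stable_def using * by (intro exI[of _ "exp K"]) auto
qed

text \<open>The cocycle identity at \<open>\<sigma> t \<omega>\<close> turns a bound for negative
  times into one for positive times, so that both alternatives can be compared at the same
  \<open>t\<close>.\<close>

lemma unstable_iff: "unstable l \<longleftrightarrow> (\<exists>K\<ge>0. \<exists>\<gamma>>0. \<forall>\<omega>. \<forall>t\<ge>0. C \<omega> t - l * t \<ge> - K + \<gamma> * t)" (is "?l \<longleftrightarrow> ?r")
proof
  assume ?l
  then obtain \<kappa> \<gamma> where *: "\<kappa> \<ge> 1" "\<gamma> > 0" "\<And>\<omega> t. t \<le> 0 \<Longrightarrow> exp (C \<omega> t - l * t) \<le> \<kappa> * exp (\<gamma> * t)"
    unfolding unstable_def by blast
  have "C \<omega> t - l * t \<ge> - ln \<kappa> + \<gamma> * t" if "t \<ge> 0" for \<omega> t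
  proof -
    have "exp (C (\<sigma> t \<omega>) (- t) - l * (- t)) \<le> exp (ln \<kappa> + \<gamma> * (- t))"
      using *(3)[of "- t" "\<sigma> t \<omega>"] *(1) that by (simp only: exp_add exp_ln)
    then show ?thesis using C_add[of \<omega> "- t" t] by simp
  qed
  then show ?r using * by (intro exI[of _ "ln \<kappa>"]) auto
next
  assume ?r
  then obtain K \<gamma> where *: "K \<ge> 0" "\<gamma> > 0" "\<And>\<omega> t. t \<ge> 0 \<Longrightarrow> C \<omega> t - l * t \<ge> - K + \<gamma> * t" by blast
  have "exp (C \<omega> t - l * t) \<le> exp K * exp (\<gamma> * t)" if "t \<le> 0" for \<omega> t
    using *(3)[of "- t" "\<sigma> t \<omega>"] C_add[of \<omega> "- t" t] that by (simp flip: exp_add)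
  then show ?l unfolding unstable_def using * by (intro exI[of _ "exp K"]) auto
qed

lemma stableI:
  assumes "K \<ge> 0" "\<gamma> > 0" "\<And>\<omega> t. t \<ge> 0 \<Longrightarrow> C \<omega> t - l * t \<le> K - \<gamma> * t"
  shows "stable l"
  unfolding stable_iff using assms by blast

lemma unstableI:
  assumes "K \<ge> 0" "\<gamma> > 0" "\<And>\<omega> t. t \<ge> 0 \<Longrightarrow> C \<omega> t - l * t \<ge> - K + \<gamma> * t"
  shows "unstable l"
  unfolding unstable_iff using assms by blast

lemma stableE:
  assumes "stable l"
  obtains K \<gamma> where "K \<ge> 0" "\<gamma> > 0" "\<And>\<omega> t. t \<ge> 0 \<Longrightarrow> C \<omega> t - l * t \<le> K - \<gamma> * t"
  using assms[unfolded stable_iff] by (elim exE conjE) (rule that, auto)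

lemma unstableE:
  assumes "unstable l"
  obtains K \<gamma> where "K \<ge> 0" "\<gamma> > 0" "\<And>\<omega> t. t \<ge> 0 \<Longrightarrow> C \<omega> t - l * t \<ge> - K + \<gamma> * t"
  using assms[unfolded unstable_iff] by (elim exE conjE) (rule that, auto)

text \<open>\<open>Sup\<close> is informative only once a maximum is exhibited. Stable values form
  an open up-set and unstable ones an open down-set disjoint from it, so the infimum
  \<open>m\<close> of the stable values is neither. It is therefore the largest element of the
  spectrum, that is, 0.\<close>

lemma stable_iff_pos: "stable l \<longleftrightarrow> l > 0"
proof -
  define S where "S = Collect stable"
  have up: "stable m" if st: "stable l" "l \<le> m" for l m
  proof -
    obtain K \<gamma> where *: "K \<ge> 0" "\<gamma> > 0" "\<And>\<omega> t. t \<ge> 0 \<Longrightarrow> C \<omega> t - l * t \<le> K - \<gamma> * t"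
      using stableE[OF st(1)] by metis
    have "C \<omega> t - m * t \<le> K - \<gamma> * t" if "t \<ge> 0" for \<omega> t
      using *(3)[OF that, of \<omega>] mult_right_mono[OF st(2) that] by linarith
    then show ?thesis by (rule stableI[OF *(1,2)])
  qed
  have opn: "\<exists>\<delta>>0. stable (l - \<delta>)" if st: "stable l" for l
  proof -
    obtain K \<gamma> where *: "K \<ge> 0" "\<gamma> > 0" "\<And>\<omega> t. t \<ge> 0 \<Longrightarrow> C \<omega> t - l * t \<le> K - \<gamma> * t"
      using stableE[OF st(1)] by metis
    have "C \<omega> t - (l - \<gamma>/2) * t \<le> K - \<gamma>/2 * t" if "t \<ge> 0" for \<omega> t
      using *(3)[OF that, of \<omega>] by (simp add: algebra_simps)
    then have "stable (l - \<gamma>/2)" using *(1,2) by (intro stableI[of K "\<gamma>/2"]) simp_all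
    then show ?thesis using *(2) by (intro exI[of _ "\<gamma>/2"]) auto
  qed
  have opn': "\<exists>\<delta>>0. \<forall>m\<le>l + \<delta>. unstable m" if st: "unstable l" for l
  proof -
    obtain K \<gamma> where *: "K \<ge> 0" "\<gamma> > 0" "\<And>\<omega> t. t \<ge> 0 \<Longrightarrow> C \<omega> t - l * t \<ge> - K + \<gamma> * t"
      using unstableE[OF st(1)] by metis
    have "C \<omega> t - m * t \<ge> - K + \<gamma>/2 * t" if "t \<ge> 0" "m \<le> l + \<gamma>/2" for \<omega> t m
      using *(3)[OF that(1), of \<omega>] mult_right_mono[OF that(2) that(1)] by (simp add: algebra_simps)
    then have "unstable m" if "m \<le> l + \<gamma>/2" for m using *(1,2) that
      by (intro unstableI[of K "\<gamma>/2" m]) simp_all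
    then show ?thesis using *(2) by (intro exI[of _ "\<gamma>/2"]) auto
  qed
  have excl: False if st: "stable l" "unstable l" for l
  proof -
    obtain K \<gamma> where 1: "K \<ge> 0" "\<gamma> > 0" "\<And>\<omega> t. t \<ge> 0 \<Longrightarrow> C \<omega> t - l * t \<le> K - \<gamma> * t"
      using stableE[OF st(1)] by metis
    obtain K' \<gamma>' where 2: "K' \<ge> 0" "\<gamma>' > 0" "\<And>\<omega> t. t \<ge> 0 \<Longrightarrow> C \<omega> t - l * t \<ge> - K' + \<gamma>' * t"
      using unstableE[OF st(2)] by metis
    define t where "t = (K + K' + 1) / \<gamma>"
    have t: "t \<ge> 0" "\<gamma> * t = K + K' + 1" using 1 2 by (auto simp: t_def)
    have "0 \<le> \<gamma>' * t" using 2 t by simp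
    then show False using 1(3)[OF t(1), of undefined] 2(3)[OF t(1), of undefined] t(2) by linarith
  qed
  have big: "stable (a_max + 1)"
  proof -
    have "C \<omega> t - (a_max + 1) * t \<le> 0 - 1 * t" if "t \<ge> 0" for \<omega> t
      using C_bound[of \<omega> t] that by (simp add: algebra_simps)
    then show ?thesis by (intro stableI[of 0 1]) simp_all
  qed
  have low: "l \<ge> - a_max - 1" if st: "stable l" for l
  proof (rule ccontr)
    assume n: "\<not> l \<ge> - a_max - 1"
    have "C \<omega> t - l * t \<ge> - 0 + 1 * t" if "t \<ge> 0" for \<omega> t
    proof -
      have "l * t \<le> (- a_max - 1) * t" using n that by (intro mult_right_mono) auto
      then show ?thesis using C_bound[of \<omega> t] that by (simp add: algebra_simps)
    qed
    then have "unstable l" by (intro unstableI[of 0 1]) simp_all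
    then show False using excl st by blast
  qed
  have bdd: "bdd_below S" using low by (auto simp: S_def intro!: bdd_belowI)
  define m where "m = Inf S"
  have mS: "m \<le> l" if st: "stable l" for l unfolding m_def using st bdd by (auto intro!: cInf_lower simp: S_def)
  have mS': "stable l" if ml: "l > m" for l
  proof -
    obtain s where "s \<in> S" "s < l" using ml cInf_lessD[of S l] big by (auto simp: m_def S_def)
    then show ?thesis using up[of s l] by (auto simp: S_def)
  qed
  have mnot: "\<not> stable m" using opn[of m] mS by force
  have "\<not> unstable m"
  proof
    assume "unstable m"
    then obtain \<delta> where "\<delta> > 0" "unstable (m + \<delta>)" using opn' by blast
    then show False using excl mS'[of "m + \<delta>"] by simp
  qed
  with mnot have "m \<in> sacker_sell_spectrum \<sigma> a" by (simp add: spectrum_iff)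
  moreover have "l \<le> m" if "l \<in> sacker_sell_spectrum \<sigma> a" for l
    using that mS'[of l] by (auto simp: spectrum_iff not_le[symmetric])
  ultimately have "Sup (sacker_sell_spectrum \<sigma> a) = m" by (rule cSup_eq_maximum)
  then have "m = 0" using spectrum by simp
  then show ?thesis using mS[of l] mS'[of l] mnot by (cases "l = m") auto
qed

lemma C_subexponential:
  assumes "e > 0"
  obtains K where "K \<ge> 0" "\<And>\<omega> t. t \<ge> 0 \<Longrightarrow> C \<omega> t \<le> K + e * t"
proof -
  obtain K \<gamma> where *: "K \<ge> 0" "\<gamma> > 0" "\<And>\<omega> t. t \<ge> 0 \<Longrightarrow> C \<omega> t - e * t \<le> K - \<gamma> * t"
    using stableE[of e] assms stable_iff_pos by metis
  show ?thesis
  proof (rule that[OF *(1)])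
    fix \<omega> and t :: real assume "t \<ge> 0"
    then show "C \<omega> t \<le> K + e * t" using *(3)[of t \<omega>] mult_nonneg_nonneg[of \<gamma> t] *(2) by linarith
  qed
qed

text \<open>If the maximum over the base were \<open>- d < 0\<close> at a time \<open>t > 0\<close>,
  stringing together blocks of length \<open>t\<close> would give decay at rate \<open>d / t\<close>
  uniformly on the base, that is, \<open>stable 0\<close>.\<close>

lemma C_nonneg_somewhere:
  assumes "t \<ge> 0"
  obtains \<omega> where "C \<omega> t \<ge> 0"
proof (cases "t = 0")
  case False
  then have "t > 0" using assms by simp
  obtain \<omega>0 where \<omega>0: "\<And>\<omega>. C \<omega> t \<le> C \<omega>0 t"
    using continuous_attains_sup[OF compact_base UNIV_not_empty C_cont] by blast
  have "C \<omega>0 t \<ge> 0"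
  proof (rule ccontr)
    assume neg: "\<not> C \<omega>0 t \<ge> 0"
    define d where "d = - C \<omega>0 t"
    have "d > 0" using neg by (simp add: d_def)
    have steps: "C \<omega> (real n * t) \<le> - (real n * d)" for n \<omega>
    proof (induction n arbitrary: \<omega>)
      case (Suc n)
      have "C \<omega> (real (Suc n) * t) = C \<omega> t + C (\<sigma> t \<omega>) (real n * t)"
        using C_add[of \<omega> "real n * t" t] by (simp add: algebra_simps)
      also have "\<dots> \<le> - d + - (real n * d)" using Suc[of "\<sigma> t \<omega>"] \<omega>0[of \<omega>] by (simp add: d_def)
      finally show ?case by (simp add: algebra_simps)
    qed simp
    have "C \<omega> r - 0 * r \<le> (d + a_max * t) - (d / t) * r" if "r \<ge> 0" for \<omega> r
    proof -
      define n where "n = nat \<lfloor>r / t\<rfloor>"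
      have nr: "real n \<le> r / t" "r / t < real n + 1" using that \<open>t > 0\<close> by (auto simp: n_def)
      define q where "q = r - real n * t"
      have q: "0 \<le> q" "q \<le> t" using nr \<open>t > 0\<close> by (auto simp: q_def field_simps)
      have "C \<omega> r = C \<omega> q + C (\<sigma> q \<omega>) (real n * t)"
        using C_add[of \<omega> "real n * t" q] by (simp add: q_def)
      also have "\<dots> \<le> a_max * t + - (real n * d)"
      proof -
        have "a_max * q \<le> a_max * t" using q a_max[of \<omega>] by (intro mult_left_mono) auto
        then show ?thesis using steps[of "\<sigma> q \<omega>" n] C_bound[of \<omega> q] q by simp
      qed
      also have "- (real n * d) \<le> d - (d / t) * r"
        using mult_right_mono[OF less_imp_le[OF nr(2)], of d] \<open>d > 0\<close> by (simp add: algebra_simps)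
      finally show ?thesis by simp
    qed
    moreover have "0 \<le> d + a_max * t" "d / t > 0" using \<open>d > 0\<close> \<open>t > 0\<close> a_max[of undefined] by auto
    ultimately have "stable 0" by (rule_tac stableI)
    then show False using stable_iff_pos by blast
  qed
  then show ?thesis using that by blast
qed (use that in auto)

text \<open>By compactness it is enough to find, for every \<open>n\<close>, a point whose cocycle
  is at most a common \<open>K\<close> on \<open>[-n, 0]\<close>. If \<open>C\<close> is bounded
  above in the future, the end of a stretch of length \<open>n\<close> with nonnegative total
  serves. If not, one moves to the time \<open>t'\<close> where \<open>C\<close> is maximal on a
  long stretch: seen from there the past is nonpositive, and since \<open>C\<close> grows at most at
  rate \<open>a_max\<close>, a maximum above \<open>a_max * n\<close> occurs after time
  \<open>n\<close>.\<close>

lemma backward_bounded_cocycle: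
  obtains \<omega> K where "\<And>s. s \<le> 0 \<Longrightarrow> C \<omega> s \<le> K"
proof -
  note ret = that
  have lim: thesis if *: "\<And>n::nat. \<exists>\<omega>. \<forall>s. 0 \<le> s \<and> s \<le> real n \<longrightarrow> C \<omega> (- s) \<le> K" for K
  proof -
    obtain X where X: "\<And>n s. 0 \<le> s \<Longrightarrow> s \<le> real n \<Longrightarrow> C (X n) (- s) \<le> K" using * by metis
    obtain \<omega> r where r: "strict_mono (r :: nat \<Rightarrow> nat)" "(X \<circ> r) \<longlonglongrightarrow> \<omega>"
      using compact_base unfolding compact_def by (metis UNIV_I)
    have "C \<omega> s \<le> K" if "s \<le> 0" for s
    proof (rule LIMSEQ_le_const2[OF C_tendsto[OF r(2)]])
      obtain N where N: "real N \<ge> - s" using real_arch_simple by blast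
      have "C ((X \<circ> r) n) s \<le> K" if "n \<ge> N" for n
        using X[of "- s" "r n"] \<open>s \<le> 0\<close> N that seq_suble[OF r(1), of n] by simp
      then show "\<exists>N. \<forall>n\<ge>N. C ((X \<circ> r) n) s \<le> K" by blast
    qed
    then show thesis using ret[of \<omega> K] by simp
  qed
  show thesis
  proof (cases "\<exists>S. \<forall>\<omega>. \<forall>t\<ge>0. C \<omega> t \<le> S")
    case True
    then obtain S where S: "\<And>\<omega> t. t \<ge> 0 \<Longrightarrow> C \<omega> t \<le> S" by blast
    show thesis
    proof (rule lim)
      fix n :: nat
      obtain \<omega> where \<omega>: "C \<omega> (real n) \<ge> 0" using C_nonneg_somewhere[of "real n"] by auto
      have "C (\<sigma> n \<omega>) (- s) \<le> S" if "0 \<le> s" "s \<le> real n" for s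
      proof -
        have "C \<omega> (- s + n) \<le> S" by (rule S) (use that in simp)
        then show ?thesis using C_add[of \<omega> "- s" n] \<omega> by linarith
      qed
      then show "\<exists>\<omega>. \<forall>s. 0 \<le> s \<and> s \<le> real n \<longrightarrow> C \<omega> (- s) \<le> S" by blast
    qed
  next
    case False
    show thesis
    proof (rule lim)
      fix n :: nat
      obtain \<omega> t where wt: "t \<ge> 0" "C \<omega> t > a_max * n" using False by (meson not_le)
      obtain t' where t': "t' \<in> {0..t}" "\<And>s. s \<in> {0..t} \<Longrightarrow> C \<omega> s \<le> C \<omega> t'"
      proof -
        have "continuous_on {0..t} (C \<omega>)"
          by (intro continuous_at_imp_continuous_on ballI C_isCont)
        then show thesis using continuous_attains_sup[of "{0..t}" "C \<omega>"] wt(1) that by auto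
      qed
      have "C \<omega> t \<le> C \<omega> t'" by (rule t'(2)) (use wt(1) in simp)
      then have "a_max * n < a_max * t'" using wt C_bound[of \<omega> t'] t'(1) by (simp add: abs_le_iff)
      then have "n < t'" using a_max[of \<omega>] by (simp add: mult_less_cancel_left_pos)
      have "C (\<sigma> t' \<omega>) (- s) \<le> 0" if "0 \<le> s" "s \<le> real n" for s
      proof -
        have "C \<omega> (- s + t') \<le> C \<omega> t'" by (rule t'(2)) (use that t'(1) \<open>n < t'\<close> in simp)
        then show ?thesis using C_add[of \<omega> "- s" t'] by linarith
      qed
      then show "\<exists>\<omega>. \<forall>s. 0 \<le> s \<and> s \<le> real n \<longrightarrow> C \<omega> (- s) \<le> 0" by blast
    qed
  qed
qed

lemma invariant_prob_base:
  assumes "m \<in> invariant_probs UNIV \<sigma>"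
  shows "prob_space m" "sets m = sets borel" "space m = UNIV" "\<sigma> t \<in> m \<rightarrow>\<^sub>M m" "distr m m (\<sigma> t) = m"
proof -
  show "prob_space m" "\<sigma> t \<in> m \<rightarrow>\<^sub>M m" "distr m m (\<sigma> t) = m"
    using assms by (auto simp: invariant_probs_def)
  show sm: "sets m = sets borel" using assms by (simp add: invariant_probs_def)
  show "space m = UNIV" using sets_eq_imp_space_eq[OF sm] by simp
qed

lemma integral_invariant:
  assumes "m \<in> invariant_probs UNIV \<sigma>" "F \<in> borel_measurable m"
  shows "(\<integral>\<omega>. F (\<sigma> t \<omega>) \<partial>m) = (\<integral>\<omega>. F \<omega> \<partial>m :: real)"
  using integral_distr[OF invariant_prob_base(4)[OF assms(1), of t] assms(2)] invariant_prob_base(5)[OF assms(1)]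
  by simp

text \<open>By invariance the mean at time \<open>n * \<delta>\<close> is \<open>n\<close> times the
  mean at time \<open>\<delta>\<close>, and such linear growth contradicts the subexponential bound.
  The restriction to an invariant set \<open>E\<close> is there for the set where the attractor is
  not pinched.\<close>

lemma cocycle_mean_nonpos:
  assumes m: "m \<in> invariant_probs UNIV \<sigma>" and E: "E \<in> sets borel" "\<And>\<omega> t. \<sigma> t \<omega> \<in> E \<longleftrightarrow> \<omega> \<in> E"
    and "\<delta> \<ge> 0"
  shows "(\<integral>\<omega>. indicator E \<omega> * C \<omega> \<delta> \<partial>m) \<le> 0"
proof (rule ccontr)
  interpret m: prob_space m by (rule invariant_prob_base(1)[OF m])
  define J where "J t = (\<integral>\<omega>. indicator E \<omega> * C \<omega> t \<partial>m)" for t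
  assume "\<not> (\<integral>\<omega>. indicator E \<omega> * C \<omega> \<delta> \<partial>m) \<le> 0"
  then have J: "J \<delta> > 0" by (simp add: J_def)
  have Em: "E \<in> sets m" using E(1) invariant_prob_base(2)[OF m] by simp
  have meas: "(\<lambda>\<omega>. indicator E \<omega> * C \<omega> t) \<in> borel_measurable m" for t
  proof -
    have "(\<lambda>\<omega>. C \<omega> t) \<in> borel_measurable borel" by (rule borel_measurable_continuous_onI[OF C_cont])
    then have "(\<lambda>\<omega>. C \<omega> t) \<in> borel_measurable m"
      by (simp add: measurable_cong_sets[OF invariant_prob_base(2)[OF m] refl])
    then show ?thesis using Em by (intro borel_measurable_times borel_measurable_indicator)
  qed
  have integ: "integrable m (\<lambda>\<omega>. indicator E \<omega> * C \<omega> t)" for t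
    by (rule m.integrable_const_bound[of _ "a_max * \<bar>t\<bar>"])
       (use meas C_bound[of _ t] in \<open>auto simp: indicator_def intro: order_trans[OF abs_ge_zero C_bound]\<close>)
  have mult: "J (real n * \<delta>) = real n * J \<delta>" for n
  proof (induction n)
    case (Suc n)
    let ?F = "\<lambda>\<omega>. indicator E \<omega> * C \<omega> (real n * \<delta>)"
    have split: "indicator E \<omega> * C \<omega> (real (Suc n) * \<delta>) = indicator E \<omega> * C \<omega> \<delta> + ?F (\<sigma> \<delta> \<omega>)" for \<omega>
    proof -
      have "(indicator E (\<sigma> \<delta> \<omega>) :: real) = indicator E \<omega>" using E(2) by (simp add: indicator_def)
      moreover have "C \<omega> (real (Suc n) * \<delta>) = C \<omega> \<delta> + C (\<sigma> \<delta> \<omega>) (real n * \<delta>)"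
        using C_add[of \<omega> "real n * \<delta>" \<delta>] by (simp add: algebra_simps)
      ultimately show ?thesis by (simp add: distrib_left)
    qed
    have iF: "integrable m (\<lambda>\<omega>. ?F (\<sigma> \<delta> \<omega>))"
    proof -
      have "integrable m (\<lambda>\<omega>. indicator E \<omega> * C \<omega> (real (Suc n) * \<delta>) - indicator E \<omega> * C \<omega> \<delta>)"
        by (rule Bochner_Integration.integrable_diff[OF integ integ])
      then show ?thesis unfolding split by simp
    qed
    have "J (real (Suc n) * \<delta>) = J \<delta> + (\<integral>\<omega>. ?F (\<sigma> \<delta> \<omega>) \<partial>m)"
      unfolding J_def split by (rule Bochner_Integration.integral_add[OF integ iF])
    also have "(\<integral>\<omega>. ?F (\<sigma> \<delta> \<omega>) \<partial>m) = J (real n * \<delta>)"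
      unfolding J_def by (rule integral_invariant[OF m meas])
    finally show ?case using Suc by (simp add: algebra_simps)
  qed (simp add: J_def)
  have "\<delta> \<noteq> 0" using J by (auto simp: J_def)
  then have "\<delta> > 0" using assms(4) by simp
  \<comment> \<open>Half of the growth rate that the positive mean would force.\<close>
  define e where "e = J \<delta> / (2 * \<delta>)"
  have e: "e > 0" "e * \<delta> = J \<delta> / 2" using J \<open>\<delta> > 0\<close> by (auto simp: e_def)
  obtain K where K: "K \<ge> 0" "\<And>\<omega> t. t \<ge> 0 \<Longrightarrow> C \<omega> t \<le> K + e * t" using C_subexponential[OF e(1)] by metis
  have bound: "real n * J \<delta> \<le> K + real n * (J \<delta> / 2)" for n
  proof -
    have "J (real n * \<delta>) \<le> (\<integral>\<omega>. K + e * (real n * \<delta>) \<partial>m)"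
      unfolding J_def
    proof (rule integral_mono[OF integ])
      fix \<omega>
      have "0 \<le> K + e * (real n * \<delta>)" using K(1) e(1) \<open>\<delta> > 0\<close> by simp
      then show "indicator E \<omega> * C \<omega> (real n * \<delta>) \<le> K + e * (real n * \<delta>)"
        using K(2)[of "real n * \<delta>" \<omega>] \<open>\<delta> > 0\<close> by (auto simp: indicator_def)
    qed simp
    also have "\<dots> = K + e * (real n * \<delta>)" using m.prob_space by simp
    also have "\<dots> = K + real n * (J \<delta> / 2)" unfolding e(2)[symmetric] by (simp only: mult.left_commute)
    finally show ?thesis using mult by simp
  qed
  obtain n where "2 * K / J \<delta> < real n" using reals_Archimedean2 by blast
  then have "2 * K < real n * J \<delta>" using J by (simp add: divide_less_eq)
  then show False using bound[of n] by simp
qed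

text \<open>The difference quotients of \<open>C\<close> at time 0 converge boundedly to
  \<open>a\<close>, and each has nonpositive mean.\<close>

lemma mean_a_nonpos:
  assumes m: "m \<in> invariant_probs UNIV \<sigma>"
  shows "(\<integral>\<omega>. a \<omega> \<partial>m) \<le> 0"
proof -
  interpret m: prob_space m by (rule invariant_prob_base(1)[OF m])
  define q where "q n \<omega> = C \<omega> (inverse (real (Suc n))) / inverse (real (Suc n))" for n \<omega>
  have mc: "F \<in> borel_measurable m" if "continuous_on UNIV F" for F :: "'w \<Rightarrow> real"
    using borel_measurable_continuous_onI[OF that] by (simp add: measurable_cong_sets[OF invariant_prob_base(2)[OF m] refl])
  have qlim: "(\<lambda>n. q n \<omega>) \<longlonglongrightarrow> a \<omega>" for \<omega>
  proof -
    have "((\<lambda>h. (C \<omega> (0 + h) - C \<omega> 0) / h) \<longlongrightarrow> a \<omega>) (at 0)" using C_deriv[of \<omega> 0] by (simp add: DERIV_def)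
    moreover have "filterlim (\<lambda>n. inverse (real (Suc n))) (at 0) sequentially"
      unfolding filterlim_at using LIMSEQ_inverse_real_of_nat by auto
    ultimately have "(\<lambda>n. (C \<omega> (0 + inverse (real (Suc n))) - C \<omega> 0) / inverse (real (Suc n))) \<longlonglongrightarrow> a \<omega>"
      by (rule filterlim_compose)
    then show ?thesis by (simp only: q_def C_zero add_0_left diff_zero)
  qed
  have qbound: "norm (q n \<omega>) \<le> a_max" for n \<omega>
  proof -
    have "\<bar>C \<omega> (inverse (real (Suc n)))\<bar> \<le> a_max * inverse (real (Suc n))"
      using C_bound[of \<omega> "inverse (real (Suc n))"] by simp
    moreover have "inverse (real (Suc n)) > 0" by simp
    ultimately show ?thesis unfolding q_def real_norm_def abs_divide
      by (simp only: abs_of_pos pos_divide_le_eq)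
  qed
  have "(\<lambda>n. \<integral>\<omega>. q n \<omega> \<partial>m) \<longlonglongrightarrow> (\<integral>\<omega>. a \<omega> \<partial>m)"
  proof (rule integral_dominated_convergence[where w="\<lambda>_. a_max"])
    show "q n \<in> borel_measurable m" for n unfolding q_def by (intro borel_measurable_divide mc C_cont) simp
    show "a \<in> borel_measurable m" by (rule mc[OF a_cont])
  qed (use qlim qbound in auto)
  moreover have "(\<integral>\<omega>. q n \<omega> \<partial>m) \<le> 0" for n
  proof -
    have "(\<integral>\<omega>. indicator UNIV \<omega> * C \<omega> (inverse (real (Suc n))) \<partial>m) \<le> 0"
      by (rule cocycle_mean_nonpos[OF m]) auto
    then have "(\<integral>\<omega>. C \<omega> (inverse (real (Suc n))) \<partial>m) \<le> 0" by simp
    then have "(\<integral>\<omega>. C \<omega> (inverse (real (Suc n))) \<partial>m) / inverse (real (Suc n)) \<le> 0"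
      by (rule divide_nonpos_pos) simp
    then show ?thesis unfolding q_def by (simp only: integral_divide_zero)
  qed
  ultimately show ?thesis by (intro LIMSEQ_le_const2) auto
qed

end

subsection \<open>Solutions of the scalar family\<close>

locale dissipative_family = critical_cocycle \<sigma> a for \<sigma> :: "real \<Rightarrow> 'w::metric_space \<Rightarrow> 'w" and a +
  fixes b :: "'w \<Rightarrow> real" and g gx f :: "'w \<Rightarrow> real \<Rightarrow> real" and r1 r2 :: real
  assumes b_cont: "continuous_on UNIV b"
    and g_deriv: "\<And>\<omega> x. ((\<lambda>y. g \<omega> y) has_real_derivative gx \<omega> x) (at x)"
    and g_cont: "continuous_on UNIV (\<lambda>(\<omega>, x). g \<omega> x)"
    and gx_cont: "continuous_on UNIV (\<lambda>(\<omega>, x). gx \<omega> x)"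
    and r_le: "r1 \<le> r2"
    and g_zero: "\<And>\<omega> x. r1 \<le> x \<Longrightarrow> x \<le> r2 \<Longrightarrow> g \<omega> x = 0"
    and gx_zero: "r1 = r2 \<Longrightarrow> (\<And>\<omega>. gx \<omega> r1 = 0)"
    and g_lim_top: "\<And>B. \<forall>\<^sub>F x in at_top. \<forall>\<omega>. g \<omega> x / x < B"
    and g_lim_bot: "\<And>B. \<forall>\<^sub>F x in at_bot. \<forall>\<omega>. g \<omega> x / x < B"
    and gx_neg: "\<And>\<omega> x. x \<notin> {r1..r2} \<Longrightarrow> gx \<omega> x < 0"
    and f_eq: "f = (\<lambda>\<omega> x. a \<omega> * x + b \<omega> + g \<omega> x)"
begin

lemma f_cont: "continuous_on UNIV (\<lambda>(\<omega>, x). f \<omega> x)"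
proof -
  have "continuous_on UNIV (\<lambda>z :: 'w \<times> real. a (fst z))" "continuous_on UNIV (\<lambda>z :: 'w \<times> real. b (fst z))"
    by (rule continuous_on_compose2[OF a_cont] continuous_on_compose2[OF b_cont],
        auto intro!: continuous_intros)+
  with g_cont show ?thesis unfolding f_eq case_prod_beta by (intro continuous_intros)
qed

text \<open>Inside the strip \<open>g\<close> vanishes identically, and continuity of
  \<open>gx\<close> reaches the end points. A degenerate strip has no interior; there the separate
  assumption takes over.\<close>

lemma gx_eq_zero:
  assumes "r1 \<le> x" "x \<le> r2" shows "gx \<omega> x = 0"
proof (cases "r1 = r2")
  case True
  then show ?thesis using gx_zero assms by simp
next
  case False
  have "gx \<omega> y = 0" if "y \<in> {r1<..<r2}" for y
  proof -
    have "((\<lambda>y. g \<omega> y) has_real_derivative 0) (at y)"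
      by (rule has_field_derivative_transform_within_open[of "\<lambda>_. 0" _ _ "{r1<..<r2}"])
         (use that g_zero in auto)
    then show ?thesis using g_deriv DERIV_unique by blast
  qed
  then have "{r1<..<r2} \<subseteq> {x. gx \<omega> x = 0}" by blast
  moreover have "closed {x. gx \<omega> x = 0}"
  proof -
    have "continuous_on UNIV (\<lambda>x. gx \<omega> x)"
    proof -
      have "continuous_on UNIV (\<lambda>x::real. (\<omega>, x))" by (intro continuous_intros)
      from continuous_on_compose2[OF gx_cont this] show ?thesis by simp
    qed
    then show ?thesis by (intro closed_Collect_eq continuous_intros)
  qed
  ultimately have "closure {r1<..<r2} \<subseteq> {x. gx \<omega> x = 0}" by (rule closure_minimal)
  then show ?thesis using False r_le assms by (auto simp: closure_greaterThanLessThan)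
qed

lemma gx_nonpos: "gx \<omega> x \<le> 0"
  using gx_eq_zero[of x \<omega>] gx_neg[of x \<omega>] by (cases "x \<in> {r1..r2}") auto

lemma g_mvt:
  assumes "x < y"
  obtains z where "x < z" "z < y" "g \<omega> y - g \<omega> x = (y - x) * gx \<omega> z"
  using MVT2[OF assms, of "g \<omega>" "gx \<omega>"] g_deriv by blast

lemma g_antimono: "x \<le> y \<Longrightarrow> g \<omega> y \<le> g \<omega> x"
  by (rule DERIV_nonpos_imp_nonincreasing[of x y "g \<omega>"]) (use g_deriv gx_nonpos in blast)+

text \<open>The mean value theorem is applied to the part of \<open>[x, y]\<close> beyond the strip,
  where \<open>gx\<close> is negative; on the rest monotonicity suffices.\<close>

lemma g_strict:
  assumes "x < y" "x < r1 \<or> y > r2" shows "g \<omega> y < g \<omega> x"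
  using assms(2)
proof
  assume "x < r1"
  define y' where "y' = min y r1"
  have "x < y'" using assms(1) \<open>x < r1\<close> by (simp add: y'_def)
  then obtain z where z: "x < z" "z < y'" "g \<omega> y' - g \<omega> x = (y' - x) * gx \<omega> z" by (rule g_mvt)
  have "z < r1" using z by (simp add: y'_def)
  then have "(y' - x) * gx \<omega> z < 0" using gx_neg[of z \<omega>] \<open>x < y'\<close> by (intro mult_pos_neg) auto
  moreover have "g \<omega> y \<le> g \<omega> y'" by (rule g_antimono) (simp add: y'_def)
  ultimately show ?thesis using z by linarith
next
  assume "y > r2"
  define x' where "x' = max x r2"
  have "x' < y" using assms(1) \<open>y > r2\<close> by (simp add: x'_def)
  then obtain z where z: "x' < z" "z < y" "g \<omega> y - g \<omega> x' = (y - x') * gx \<omega> z" by (rule g_mvt)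
  have "z > r2" using z by (simp add: x'_def)
  then have "(y - x') * gx \<omega> z < 0" using gx_neg[of z \<omega>] \<open>x' < y\<close> by (intro mult_pos_neg) auto
  moreover have "g \<omega> x' \<le> g \<omega> x" by (rule g_antimono) (simp add: x'_def)
  ultimately show ?thesis using z by linarith
qed

lemma f_lipschitz:
  obtains L where "L > 0" "\<And>\<omega> x y. \<bar>x\<bar> \<le> N \<Longrightarrow> \<bar>y\<bar> \<le> N \<Longrightarrow> \<bar>f \<omega> x - f \<omega> y\<bar> \<le> L * \<bar>x - y\<bar>"
proof -
  have "compact ((UNIV :: 'w set) \<times> {-N..N})" by (intro compact_Times compact_base) auto
  then have "compact ((\<lambda>(\<omega>, x). gx \<omega> x) ` (UNIV \<times> {-N..N}))"
    by (intro compact_continuous_image continuous_on_subset[OF gx_cont]) auto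
  then obtain B where "\<forall>z\<in>(\<lambda>(\<omega>, x). gx \<omega> x) ` (UNIV \<times> {-N..N}). norm z \<le> B"
    by (meson compact_imp_bounded bounded_iff)
  then have B: "z \<in> (\<lambda>(\<omega>, x). gx \<omega> x) ` (UNIV \<times> {-N..N}) \<Longrightarrow> \<bar>z\<bar> \<le> B" for z
    by (metis real_norm_def)
  have Bx: "\<bar>gx \<omega> x\<bar> \<le> B" if "x \<in> {-N..N}" for \<omega> x
    by (rule B, rule image_eqI[of _ _ "(\<omega>, x)"]) (use that in auto)
  define L where "L = a_max + \<bar>B\<bar>"
  have "L > 0" using a_max[of undefined] by (simp add: L_def)
  moreover have "\<bar>f \<omega> x - f \<omega> y\<bar> \<le> L * \<bar>x - y\<bar>" if "\<bar>x\<bar> \<le> N" "\<bar>y\<bar> \<le> N" for \<omega> x y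
  proof -
    have "norm (f \<omega> x - f \<omega> y) \<le> L * norm (x - y)"
    proof (rule field_differentiable_bound[of "{-N..N}" "f \<omega>" "\<lambda>z. a \<omega> + gx \<omega> z"])
      fix z assume z: "z \<in> {-N..N}"
      have "((\<lambda>x. a \<omega> * x + b \<omega> + g \<omega> x) has_real_derivative a \<omega> + gx \<omega> z) (at z)"
        by (auto intro!: derivative_eq_intros g_deriv)
      then show "(f \<omega> has_field_derivative a \<omega> + gx \<omega> z) (at z within {-N..N})"
        unfolding f_eq by (rule has_field_derivative_at_within)
      show "norm (a \<omega> + gx \<omega> z) \<le> L" using a_max[of \<omega>] Bx[OF z, of \<omega>] by (simp add: L_def)
    qed (use that in auto)
    then show ?thesis by simp
  qed
  ultimately show ?thesis by (rule that)
qed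

lemma f_dissipative:
  obtains N0 where "N0 \<ge> 1" "\<And>\<omega> x. x \<ge> N0 \<Longrightarrow> f \<omega> x < 0" "\<And>\<omega> x. x \<le> - N0 \<Longrightarrow> f \<omega> x > 0"
proof -
  obtain Bb where Bb: "\<And>\<omega>. \<bar>b \<omega>\<bar> \<le> Bb"
    using compact_imp_bounded[OF compact_continuous_image[OF b_cont compact_base]]
    unfolding bounded_iff by auto
  \<comment> \<open>Outweighs \<open>a\<close> and, as \<open>\<bar>x\<bar> \<ge> 1\<close>, also
    \<open>b \<omega> / x\<close>, so that \<open>f \<omega> x / x\<close> is negative wherever
    \<open>g \<omega> x / x < D\<close>.\<close>
  define D where "D = - (a_max + Bb)"
  obtain X1 where X1: "\<And>x \<omega>. x \<ge> X1 \<Longrightarrow> g \<omega> x / x < D"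
    using g_lim_top[of D] unfolding eventually_at_top_linorder by blast
  obtain X2 where X2: "\<And>x \<omega>. x \<le> X2 \<Longrightarrow> g \<omega> x / x < D"
    using g_lim_bot[of D] unfolding eventually_at_bot_linorder by blast
  define N0 where "N0 = Max {1, X1, - X2}"
  have N0: "N0 \<ge> 1" "N0 \<ge> X1" "- N0 \<le> X2" by (auto simp: N0_def)
  have key: "f \<omega> x / x < 0" if "\<bar>x\<bar> \<ge> 1" "g \<omega> x / x < D" for \<omega> x
  proof -
    have x0: "x \<noteq> 0" using that by auto
    have "\<bar>b \<omega> / x\<bar> \<le> Bb / 1" unfolding abs_divide by (rule frac_le) (use that Bb[of \<omega>] in auto)
    moreover have "f \<omega> x / x = a \<omega> + b \<omega> / x + g \<omega> x / x" using x0 by (simp add: f_eq add_divide_distrib)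
    ultimately show ?thesis using that(2) a_max[of \<omega>] unfolding D_def by linarith
  qed
  show ?thesis
  proof (rule that[OF N0(1)])
    fix \<omega> x
    show "f \<omega> x < 0" if "x \<ge> N0"
      using key[of x \<omega>] X1[of x \<omega>] that N0 by (simp add: divide_less_0_iff)
    show "f \<omega> x > 0" if "x \<le> - N0"
      using key[of x \<omega>] X2[of x \<omega>] that N0 by (simp add: divide_less_0_iff)
  qed
qed

text \<open>Fixed once and for all: from \<open>N0\<close> on the vector field points inwards, so
  each interval \<open>[- N, N]\<close> with \<open>N \<ge> N0\<close> traps solutions in forward
  time.\<close>

definition N0 :: real where
  "N0 = (SOME N. N \<ge> 1 \<and> (\<forall>\<omega> x. (x \<ge> N \<longrightarrow> f \<omega> x < 0) \<and> (x \<le> - N \<longrightarrow> f \<omega> x > 0)))"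

lemma N0: "N0 \<ge> 1" "x \<ge> N0 \<Longrightarrow> f \<omega> x < 0" "x \<le> - N0 \<Longrightarrow> f \<omega> x > 0"
proof -
  have "\<exists>N. N \<ge> 1 \<and> (\<forall>\<omega> x. (x \<ge> N \<longrightarrow> f \<omega> x < 0) \<and> (x \<le> - N \<longrightarrow> f \<omega> x > 0))"
    by (rule f_dissipative) blast
  from someI_ex[OF this] show "N0 \<ge> 1" "x \<ge> N0 \<Longrightarrow> f \<omega> x < 0" "x \<le> - N0 \<Longrightarrow> f \<omega> x > 0"
    unfolding N0_def[symmetric] by auto
qed

text \<open>The equation at a single time, so that it can be imposed on segments and half-lines
  without carrying an interval of existence along.\<close>

definition solves :: "'w \<Rightarrow> (real \<Rightarrow> real) \<Rightarrow> real \<Rightarrow> bool" where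
  "solves \<omega> u t \<longleftrightarrow> (u has_real_derivative f (\<sigma> t \<omega>) (u t)) (at t)"

lemma solves_isCont: "solves \<omega> u t \<Longrightarrow> isCont u t"
  unfolding solves_def by (rule DERIV_isCont)

lemma solves_shift: "solves \<omega> u (s + t) \<Longrightarrow> solves (\<sigma> t \<omega>) (\<lambda>s. u (s + t)) s"
  unfolding solves_def by (simp add: DERIV_shift base_add)

lemma solves_unique:
  assumes u: "\<And>s. s \<in> closed_segment p q \<Longrightarrow> solves \<omega> u s"
    and v: "\<And>s. s \<in> closed_segment p q \<Longrightarrow> solves \<omega> v s"
    and eq: "u p = v p"
  shows "u q = v q"
proof -
  have bd: "\<exists>N. \<forall>s\<in>closed_segment p q. \<bar>w s\<bar> \<le> N" if "\<And>s. s \<in> closed_segment p q \<Longrightarrow> solves \<omega> w s" for w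
  proof -
    have "continuous_on (closed_segment p q) w"
      by (intro continuous_at_imp_continuous_on ballI solves_isCont[OF that])
    then have "bounded (w ` closed_segment p q)"
      by (intro compact_imp_bounded compact_continuous_image) auto
    then show ?thesis unfolding bounded_iff by auto
  qed
  obtain N1 where N1: "\<forall>s\<in>closed_segment p q. \<bar>u s\<bar> \<le> N1" using bd[OF u] by blast
  obtain N2 where N2: "\<forall>s\<in>closed_segment p q. \<bar>v s\<bar> \<le> N2" using bd[OF v] by blast
  obtain L where L: "L > 0"
    "\<And>\<omega> x y. \<bar>x\<bar> \<le> max N1 N2 \<Longrightarrow> \<bar>y\<bar> \<le> max N1 N2 \<Longrightarrow> \<bar>f \<omega> x - f \<omega> y\<bar> \<le> L * \<bar>x - y\<bar>"
    using f_lipschitz by metis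
  have "(\<lambda>s. (u s - v s)\<^sup>2) q + 0 \<le> exp ((2 * L) * \<bar>q - p\<bar>) * ((\<lambda>s. (u s - v s)\<^sup>2) p + 0)"
  proof (rule gronwall_segment)
    fix s assume s: "s \<in> closed_segment p q"
    let ?D = "f (\<sigma> s \<omega>) (u s) - f (\<sigma> s \<omega>) (v s)"
    show "((\<lambda>s. (u s - v s)\<^sup>2) has_real_derivative 2 * (u s - v s) * ?D) (at s)"
      using DERIV_power[where n=2, OF DERIV_diff[OF u[OF s, unfolded solves_def] v[OF s, unfolded solves_def]]]
      by (simp add: algebra_simps)
    have "\<bar>?D\<bar> \<le> L * \<bar>u s - v s\<bar>" using L(2)[of "u s" "v s"] N1 N2 s by (simp add: le_max_iff_disj)
    then have "\<bar>2 * (u s - v s) * ?D\<bar> \<le> 2 * \<bar>u s - v s\<bar> * (L * \<bar>u s - v s\<bar>)"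
      unfolding abs_mult by (intro mult_mono) auto
    also have "\<dots> = 2 * L * (\<bar>u s - v s\<bar> * \<bar>u s - v s\<bar>)" by (simp only: ac_simps)
    also have "\<dots> = 2 * L * ((u s - v s)\<^sup>2 + 0)" by (simp only: abs_mult_self_eq power2_eq_square add_0_right)
    finally show "\<bar>2 * (u s - v s) * ?D\<bar> \<le> 2 * L * ((u s - v s)\<^sup>2 + 0)" .
  qed
  then show ?thesis using eq by simp
qed

text \<open>A change of order would need a time of equality, from which uniqueness leads back to
  equality at \<open>p\<close>.\<close>

lemma solves_less:
  assumes u: "\<And>s. s \<in> closed_segment p q \<Longrightarrow> solves \<omega> u s"
    and v: "\<And>s. s \<in> closed_segment p q \<Longrightarrow> solves \<omega> v s"
    and less: "u p < v p"
  shows "u q < v q"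
proof (rule ccontr)
  assume "\<not> u q < v q"
  have cont: "continuous_on (closed_segment p q) (\<lambda>s. v s - u s)"
    by (intro continuous_at_imp_continuous_on ballI continuous_intros solves_isCont[OF u] solves_isCont[OF v])
  have "connected ((\<lambda>s. v s - u s) ` closed_segment p q)"
    by (rule connected_continuous_image[OF cont]) simp
  then have "0 \<in> (\<lambda>s. v s - u s) ` closed_segment p q"
  proof (rule connectedD_interval)
    show "v q - u q \<in> (\<lambda>s. v s - u s) ` closed_segment p q" "v p - u p \<in> (\<lambda>s. v s - u s) ` closed_segment p q"
      by auto
  qed (use \<open>\<not> u q < v q\<close> less in auto)
  then obtain s where s: "s \<in> closed_segment p q" "v s = u s" by auto
  have "closed_segment s p \<subseteq> closed_segment p q" using s(1) by (simp add: closed_segment_subset)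
  then have "u p = v p" using solves_unique[of s p \<omega> u v] u v s by auto
  then show False using less by simp
qed

lemma trapping:
  assumes "0 \<le> t" "N \<ge> N0" "\<bar>u 0\<bar> \<le> N"
    and u: "\<And>s. 0 \<le> s \<Longrightarrow> s \<le> t \<Longrightarrow> solves \<omega> u s"
  shows "\<bar>u t\<bar> \<le> N"
proof -
  have "u t \<le> N"
    by (rule barrier_le[of t u N "\<lambda>s. f (\<sigma> s \<omega>) (u s)"])
       (use assms N0(2) in \<open>auto simp: solves_def intro!: less_imp_le\<close>)
  moreover have "- N \<le> u t"
    by (rule barrier_ge[of t "- N" u "\<lambda>s. f (\<sigma> s \<omega>) (u s)"])
       (use assms N0(3) in \<open>auto simp: solves_def intro!: less_imp_le\<close>)
  ultimately show ?thesis by simp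
qed

lemma local_solution_exists: "\<exists>I u. is_solution \<sigma> f \<omega> x0 I u"
proof -
  define N where "N = \<bar>x0\<bar> + 1"
  \<comment> \<open>Clamping the state makes the right-hand side bounded and globally Lipschitz. As
    \<open>N = \<bar>x0\<bar> + 1\<close>, the clamp is inactive while the solution stays within
    distance 1 of \<open>x0\<close>.\<close>
  define cl where "cl x = max (-N) (min N x)" for x :: real
  have N: "N > 0" by (simp add: N_def)
  have cl: "\<bar>cl x\<bar> \<le> N" for x using N by (auto simp: cl_def)
  have cl_lip: "\<bar>cl x - cl y\<bar> \<le> \<bar>x - y\<bar>" for x y by (auto simp: cl_def)
  have cl_cont: "continuous_on UNIV cl" unfolding cl_def by (intro continuous_intros)
  obtain L where L: "L > 0" "\<And>\<omega> x y. \<bar>x\<bar> \<le> N \<Longrightarrow> \<bar>y\<bar> \<le> N \<Longrightarrow> \<bar>f \<omega> x - f \<omega> y\<bar> \<le> L * \<bar>x - y\<bar>"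
    using f_lipschitz by metis
  define H where "H t x = f (\<sigma> t \<omega>) (cl x)" for t x
  have Hcont: "continuous_on UNIV (\<lambda>(t, x). H t x)"
  proof -
    have "continuous_on UNIV (\<lambda>z::real\<times>real. cl (snd z))"
      by (rule continuous_on_compose2[OF cl_cont]) (auto intro!: continuous_intros)
    then have "continuous_on UNIV (\<lambda>z::real\<times>real. (\<sigma> (fst z) \<omega>, cl (snd z)))"
      by (intro continuous_intros)
    from continuous_on_compose2[OF f_cont this] show ?thesis by (simp add: H_def case_prod_beta)
  qed
  have Hlip: "\<bar>H t x - H t y\<bar> \<le> L * \<bar>x - y\<bar>" for t x y
    using L(2)[OF cl cl] mult_left_mono[OF cl_lip less_imp_le[OF L(1)]] unfolding H_def by (rule order_trans)
  have "compact ((UNIV :: 'w set) \<times> {-N..N})" by (intro compact_Times compact_base) auto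
  then have "compact ((\<lambda>(\<omega>, x). f \<omega> x) ` (UNIV \<times> {-N..N}))"
    by (intro compact_continuous_image continuous_on_subset[OF f_cont]) auto
  then obtain B where "\<forall>z\<in>(\<lambda>(\<omega>, x). f \<omega> x) ` (UNIV \<times> {-N..N}). norm z \<le> B"
    by (meson compact_imp_bounded bounded_iff)
  then have B: "z \<in> (\<lambda>(\<omega>, x). f \<omega> x) ` (UNIV \<times> {-N..N}) \<Longrightarrow> \<bar>z\<bar> \<le> B" for z
    by (metis real_norm_def)
  have HB: "\<bar>H t x\<bar> \<le> B" for t x
    unfolding H_def by (rule B, rule image_eqI[of _ _ "(\<sigma> t \<omega>, cl x)"]) (use cl[of x] in auto)
  obtain u r where u: "r > 0" "u 0 = x0" "\<And>t. \<bar>t\<bar> < r \<Longrightarrow> (u has_real_derivative H t (u t)) (at t)"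
    using ode_local_existence[OF Hcont L(1) Hlip HB] by metis
  have "isCont u 0" using u DERIV_isCont by force
  then obtain d where d: "d > 0" "\<And>t. \<bar>t\<bar> < d \<Longrightarrow> \<bar>u t - x0\<bar> < 1"
    unfolding continuous_at_eps_delta by (force simp: dist_real_def u(2) dest: spec[of _ 1])
  define I where "I = {- min r d<..<min r d}"
  have "is_solution \<sigma> f \<omega> x0 I u"
    unfolding is_solution_def
  proof (intro conjI ballI)
    fix t assume t: "t \<in> I"
    have "\<bar>t\<bar> < r" "\<bar>t\<bar> < d" using t by (auto simp: I_def)
    then have "\<bar>u t - x0\<bar> < 1" using d by blast
    then have "\<bar>u t\<bar> < N" by (simp add: N_def)
    then have "cl (u t) = u t" by (auto simp: cl_def)
    then show "(u has_real_derivative f (\<sigma> t \<omega>) (u t)) (at t)"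
      using u(3)[OF \<open>\<bar>t\<bar> < r\<close>] by (simp add: H_def)
  qed (use u d in \<open>auto simp: I_def is_interval_convex_1\<close>)
  then show ?thesis by blast
qed

section \<open>Maximal solutions and the local flow\<close>

text \<open>Solutions with the same data agree on common intervals, so the union of all their
  intervals carries a solution. It is the only maximal interval, which gives the definite
  descriptions in \<open>sol_dom\<close> and \<open>sol\<close> their meaning.\<close>

definition max_dom :: "'w \<Rightarrow> real \<Rightarrow> real set" where
  "max_dom \<omega> x0 = \<Union>{I. \<exists>u. is_solution \<sigma> f \<omega> x0 I u}"

definition max_sol :: "'w \<Rightarrow> real \<Rightarrow> real \<Rightarrow> real" where
  "max_sol \<omega> x0 t = (SOME y. \<exists>I u. is_solution \<sigma> f \<omega> x0 I u \<and> t \<in> I \<and> u t = y)"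

lemma is_solution_segment:
  assumes "is_solution \<sigma> f \<omega> x0 I u" "t \<in> I" "s \<in> closed_segment 0 t"
  shows "s \<in> I" "solves \<omega> u s"
proof -
  have "closed_segment 0 t \<subseteq> I"
    using assms unfolding is_solution_def is_interval_convex_1 by (intro closed_segment_subset) auto
  then show "s \<in> I" using assms(3) by blast
  then show "solves \<omega> u s" using assms(1) unfolding is_solution_def solves_def by blast
qed

lemma is_solution_unique:
  assumes "is_solution \<sigma> f \<omega> x0 I u" "t \<in> I" "is_solution \<sigma> f \<omega> x0 J v" "t \<in> J"
  shows "u t = v t"
proof (rule solves_unique[of 0 t \<omega> u v])
  fix s assume "s \<in> closed_segment 0 t"
  then show "solves \<omega> u s" "solves \<omega> v s"
    using is_solution_segment(2)[OF assms(1,2)] is_solution_segment(2)[OF assms(3,4)] by blast+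
qed (use assms in \<open>simp add: is_solution_def\<close>)

lemma max_sol_eq:
  assumes "is_solution \<sigma> f \<omega> x0 I u" "t \<in> I"
  shows "max_sol \<omega> x0 t = u t"
proof -
  have "\<exists>I' u'. is_solution \<sigma> f \<omega> x0 I' u' \<and> t \<in> I' \<and> u' t = max_sol \<omega> x0 t"
    unfolding max_sol_def by (rule someI[of _ "u t"]) (use assms in blast)
  then show ?thesis using is_solution_unique assms by metis
qed

lemma max_sol_is_solution: "is_solution \<sigma> f \<omega> x0 (max_dom \<omega> x0) (max_sol \<omega> x0)"
  unfolding is_solution_def
proof (intro conjI ballI)
  let ?F = "{I. \<exists>u. is_solution \<sigma> f \<omega> x0 I u}"
  obtain I u where Iu: "is_solution \<sigma> f \<omega> x0 I u" using local_solution_exists by blast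
  show "open (max_dom \<omega> x0)" unfolding max_dom_def by (rule open_Union) (auto simp: is_solution_def)
  show "is_interval (max_dom \<omega> x0)"
    unfolding max_dom_def is_interval_connected_1
    by (rule connected_Union) (auto simp: is_solution_def is_interval_connected_1)
  show "0 \<in> max_dom \<omega> x0" using Iu unfolding max_dom_def is_solution_def by blast
  show "max_sol \<omega> x0 0 = x0" using max_sol_eq[OF Iu, of 0] Iu unfolding is_solution_def by simp
  fix t assume "t \<in> max_dom \<omega> x0"
  then obtain J v where J: "is_solution \<sigma> f \<omega> x0 J v" "t \<in> J" unfolding max_dom_def by blast
  have der: "(v has_real_derivative f (\<sigma> t \<omega>) (v t)) (at t)" and op: "open J"
    using J unfolding is_solution_def by blast+
  have "(max_sol \<omega> x0 has_real_derivative f (\<sigma> t \<omega>) (v t)) (at t)"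
    by (rule has_field_derivative_transform_within_open[OF der op J(2)]) (simp add: max_sol_eq[OF J(1)])
  then show "(max_sol \<omega> x0 has_real_derivative f (\<sigma> t \<omega>) (max_sol \<omega> x0 t)) (at t)"
    by (simp add: max_sol_eq[OF J])
qed

lemma max_dom_upper: "is_solution \<sigma> f \<omega> x0 I u \<Longrightarrow> I \<subseteq> max_dom \<omega> x0"
  unfolding max_dom_def by blast

lemma maximal_max_sol: "is_maximal_solution \<sigma> f \<omega> x0 (max_dom \<omega> x0) (max_sol \<omega> x0)"
  unfolding is_maximal_solution_def using max_sol_is_solution max_dom_upper by blast

lemma maximal_dom:
  assumes "is_maximal_solution \<sigma> f \<omega> x0 I u" shows "I = max_dom \<omega> x0"
proof -
  have 1: "is_solution \<sigma> f \<omega> x0 I u" using assms by (simp add: is_maximal_solution_def)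
  have "\<forall>t\<in>I. max_sol \<omega> x0 t = u t" using max_sol_eq[OF 1] by blast
  then show ?thesis
    using assms max_sol_is_solution max_dom_upper[OF 1] unfolding is_maximal_solution_def by blast
qed

lemma sol_dom_eq: "sol_dom \<sigma> f \<omega> x0 = max_dom \<omega> x0"
  unfolding sol_dom_def by (rule the_equality) (use maximal_max_sol maximal_dom in blast)+

lemma sol_eq: "t \<in> max_dom \<omega> x0 \<Longrightarrow> sol \<sigma> f t \<omega> x0 = max_sol \<omega> x0 t"
  unfolding sol_def
proof (rule the_equality)
  fix y assume "\<exists>I u. is_maximal_solution \<sigma> f \<omega> x0 I u \<and> t \<in> I \<and> u t = y"
  then obtain I u where "is_maximal_solution \<sigma> f \<omega> x0 I u" "t \<in> I" "u t = y" by blast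
  then show "y = max_sol \<omega> x0 t" using max_sol_eq[of \<omega> x0 I u t] by (simp add: is_maximal_solution_def)
qed (use maximal_max_sol in blast)

lemma sol_solves:
  assumes "t \<in> sol_dom \<sigma> f \<omega> x0"
  shows "solves \<omega> (\<lambda>t. sol \<sigma> f t \<omega> x0) t"
proof -
  have *: "(max_sol \<omega> x0 has_real_derivative f (\<sigma> t \<omega>) (max_sol \<omega> x0 t)) (at t)" "open (max_dom \<omega> x0)"
    using max_sol_is_solution assms unfolding is_solution_def sol_dom_eq by blast+
  have "((\<lambda>t. sol \<sigma> f t \<omega> x0) has_real_derivative f (\<sigma> t \<omega>) (max_sol \<omega> x0 t)) (at t)"
    by (rule has_field_derivative_transform_within_open[OF *]) (use assms sol_eq in \<open>auto simp: sol_dom_eq\<close>)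
  then show ?thesis using assms by (simp add: solves_def sol_eq sol_dom_eq)
qed

lemma sol_zero [simp]: "sol \<sigma> f 0 \<omega> x0 = x0"
  using max_sol_is_solution[of \<omega> x0] sol_eq[of 0 \<omega> x0] by (simp add: is_solution_def)

lemma sol_unique:
  assumes "\<And>s. solves \<omega> u s" "u 0 = x0"
  shows "sol_dom \<sigma> f \<omega> x0 = UNIV" "sol \<sigma> f t \<omega> x0 = u t"
proof -
  have 1: "is_solution \<sigma> f \<omega> x0 UNIV u" using assms unfolding is_solution_def solves_def by simp
  then show "sol_dom \<sigma> f \<omega> x0 = UNIV" using max_dom_upper sol_dom_eq by blast
  then show "sol \<sigma> f t \<omega> x0 = u t" using max_sol_eq[OF 1, of t] sol_eq[of t \<omega> x0] sol_dom_eq by simp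
qed

lemma sol_add:
  assumes "sol_dom \<sigma> f \<omega> x0 = UNIV"
  shows "sol_dom \<sigma> f (\<sigma> t \<omega>) (sol \<sigma> f t \<omega> x0) = UNIV"
    "sol \<sigma> f s (\<sigma> t \<omega>) (sol \<sigma> f t \<omega> x0) = sol \<sigma> f (s + t) \<omega> x0"
proof -
  have "solves (\<sigma> t \<omega>) (\<lambda>s. sol \<sigma> f (s + t) \<omega> x0) s" for s
    by (rule solves_shift) (rule sol_solves, simp add: assms)
  from sol_unique[OF this] show "sol_dom \<sigma> f (\<sigma> t \<omega>) (sol \<sigma> f t \<omega> x0) = UNIV"
    "sol \<sigma> f s (\<sigma> t \<omega>) (sol \<sigma> f t \<omega> x0) = sol \<sigma> f (s + t) \<omega> x0" by auto
qed

lemma log_gap_deriv: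
  assumes "solves \<omega> u t" "solves \<omega> v t" "u t < v t"
  shows "((\<lambda>s. ln (v s - u s) - C \<omega> s) has_real_derivative
           (g (\<sigma> t \<omega>) (v t) - g (\<sigma> t \<omega>) (u t)) / (v t - u t)) (at t)"
proof -
  have "((\<lambda>s. ln (v s - u s) - C \<omega> s) has_real_derivative
           (f (\<sigma> t \<omega>) (v t) - f (\<sigma> t \<omega>) (u t)) / (v t - u t) - a (\<sigma> t \<omega>)) (at t)"
    using assms unfolding solves_def
    by (auto intro!: derivative_eq_intros C_deriv simp: field_simps)
  moreover have "(f (\<sigma> t \<omega>) (v t) - f (\<sigma> t \<omega>) (u t)) / (v t - u t) - a (\<sigma> t \<omega>)
      = (g (\<sigma> t \<omega>) (v t) - g (\<sigma> t \<omega>) (u t)) / (v t - u t)"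
    using assms(3) by (simp add: f_eq field_simps)
  ultimately show ?thesis by simp
qed

lemma log_gap_antimono:
  assumes "s \<le> t" and sol: "\<And>r. s \<le> r \<Longrightarrow> r \<le> t \<Longrightarrow> solves \<omega> u r \<and> solves \<omega> v r \<and> u r < v r"
  shows "ln (v t - u t) - C \<omega> t \<le> ln (v s - u s) - C \<omega> s"
proof (rule DERIV_nonpos_imp_nonincreasing[OF assms(1)])
  fix r assume "s \<le> r" "r \<le> t"
  then have r: "solves \<omega> u r" "solves \<omega> v r" "u r < v r" using sol by auto
  have "(g (\<sigma> r \<omega>) (v r) - g (\<sigma> r \<omega>) (u r)) / (v r - u r) \<le> 0"
    using g_antimono[of "u r" "v r" "\<sigma> r \<omega>"] r(3) by (intro divide_nonpos_pos) auto
  then show "\<exists>y. ((\<lambda>t. ln (v t - u t) - C \<omega> t) has_real_derivative y) (at r) \<and> y \<le> 0"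
    using log_gap_deriv[OF r] by blast
qed

end

subsection \<open>Pinched attractors\<close>

lemma dist_le_sum_dist: "dist p q \<le> sum_dist p q"
  unfolding sum_dist_def dist_prod_def using sqrt_sum_squares_le_sum[of "dist (fst p) (fst q)" "dist (snd p) (snd q)"]
  by (simp add: dist_real_def)

locale pinched_attractor = dissipative_family \<sigma> a b g gx f r1 r2
  for \<sigma> :: "real \<Rightarrow> 'w::metric_space \<Rightarrow> 'w" and a b g gx f r1 r2 +
  fixes \<A> :: "('w \<times> real) set" and \<alpha> \<beta> :: "'w \<Rightarrow> real"
  assumes attractor: "global_attractor \<sigma> f \<A>"
    and attractor_form: "\<A> = (\<Union>\<omega>. {\<omega>} \<times> {\<alpha> \<omega>..\<beta> \<omega>})"
    and pinched: "pinched \<A>"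
begin

abbreviation \<tau> :: "real \<Rightarrow> 'w \<times> real \<Rightarrow> 'w \<times> real" where
  "\<tau> \<equiv> skew_flow \<sigma> f"

lemma \<tau>_eq: "\<tau> t (\<omega>, x) = (\<sigma> t \<omega>, sol \<sigma> f t \<omega> x)"
  by (simp add: skew_flow_def)

lemma fst_\<tau>: "fst (\<tau> t p) = \<sigma> t (fst p)"
  by (simp add: skew_flow_def case_prod_beta)

lemma mem_A: "(\<omega>, x) \<in> \<A> \<longleftrightarrow> \<alpha> \<omega> \<le> x \<and> x \<le> \<beta> \<omega>"
  unfolding attractor_form by auto

lemma A_compact: "compact \<A>" and A_invariant: "skew_invariant \<sigma> f \<A>"
  using attractor by (auto simp: global_attractor_def)

lemma skew_invariant_dom: "skew_invariant \<sigma> f K \<Longrightarrow> (\<omega>, x) \<in> K \<Longrightarrow> sol_dom \<sigma> f \<omega> x = UNIV"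
  and skew_invariant_image: "skew_invariant \<sigma> f K \<Longrightarrow> \<tau> t ` K = K"
  by (auto simp: skew_invariant_def)

lemma A_dom: "(\<omega>, x) \<in> \<A> \<Longrightarrow> sol_dom \<sigma> f \<omega> x = UNIV"
  by (rule skew_invariant_dom[OF A_invariant])

lemma A_step: "(\<omega>, x) \<in> \<A> \<Longrightarrow> (\<sigma> t \<omega>, sol \<sigma> f t \<omega> x) \<in> \<A>"
  using skew_invariant_image[OF A_invariant, of t] \<tau>_eq by (metis imageI)

lemma A_solves: "(\<omega>, x) \<in> \<A> \<Longrightarrow> solves \<omega> (\<lambda>t. sol \<sigma> f t \<omega> x) s"
  by (rule sol_solves) (simp add: A_dom)

lemma \<tau>_zero: "\<tau> 0 p = p"
  by (cases p) (simp add: \<tau>_eq)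

lemma \<tau>_add: "p \<in> \<A> \<Longrightarrow> \<tau> (s + t) p = \<tau> s (\<tau> t p)"
  by (cases p) (simp add: \<tau>_eq sol_add(2) A_dom base_add)

lemma \<tau>_minus: "p \<in> \<A> \<Longrightarrow> \<tau> t (\<tau> (- t) p) = p"
  using \<tau>_add[of p t "- t"] by (simp add: \<tau>_zero)

lemma \<tau>_A: "p \<in> \<A> \<Longrightarrow> \<tau> t p \<in> \<A>"
  by (cases p) (simp add: \<tau>_eq A_step)

text \<open>The image of \<open>D\<close> contains \<open>p\<close> at every time, so the distance
  from \<open>p\<close> to the attractor is below a semidistance that tends to 0.\<close>

lemma pullback_attraction:
  assumes "bounded D" and D: "\<And>t. t \<ge> 0 \<Longrightarrow> \<exists>q\<in>D. \<tau> t q = p"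
  shows "p \<in> \<A>"
proof -
  define h where "h = (INF q\<in>\<A>. ennreal (sum_dist p q))"
  have lim: "((\<lambda>t. hausdorff_semidist (\<tau> t ` D) \<A>) \<longlongrightarrow> 0) at_top"
    using attractor assms(1) unfolding global_attractor_def by blast
  have "\<forall>\<^sub>F t::real in at_top. h \<le> hausdorff_semidist (\<tau> t ` D) \<A>"
  proof (rule eventually_mono[OF eventually_ge_at_top[of 0]])
    fix t :: real assume "t \<ge> 0"
    then obtain q where "q \<in> D" "\<tau> t q = p" using D by blast
    then have "p \<in> \<tau> t ` D" by blast
    then show "h \<le> hausdorff_semidist (\<tau> t ` D) \<A>"
      unfolding hausdorff_semidist_def h_def by (rule SUP_upper)
  qed
  then have "h \<le> 0" by (intro tendsto_lowerbound[OF lim]) auto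
  have "p \<in> closure \<A>"
    unfolding closure_approachable
  proof (intro allI impI)
    fix e :: real assume "e > 0"
    then have "h < ennreal e" using \<open>h \<le> 0\<close> by (meson ennreal_less_zero_iff order_le_less_trans)
    then obtain q where q: "q \<in> \<A>" "ennreal (sum_dist p q) < ennreal e"
      unfolding h_def INF_less_iff by blast
    have "0 \<le> sum_dist p q" by (simp add: sum_dist_def)
    then have "sum_dist p q < e" using q(2) by (simp add: ennreal_less_iff)
    then show "\<exists>y\<in>\<A>. dist y p < e"
      using q(1) dist_le_sum_dist[of p q] by (auto simp: dist_commute intro!: bexI[of _ q])
  qed
  then show ?thesis using compact_imp_closed[OF A_compact] by simp
qed

lemma invariant_subset_A:
  assumes "compact K" "skew_invariant \<sigma> f K"
  shows "K \<subseteq> \<A>"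
proof
  fix p assume "p \<in> K"
  show "p \<in> \<A>"
  proof (rule pullback_attraction[OF compact_imp_bounded[OF assms(1)]])
    fix t show "\<exists>q\<in>K. \<tau> t q = p"
      using skew_invariant_image[OF assms(2), of t] \<open>p \<in> K\<close> by (metis imageE)
  qed
qed

lemma invariant_fst:
  assumes "compact K" "skew_invariant \<sigma> f K" "K \<noteq> {}"
  shows "fst ` K = UNIV"
proof (rule minimal_base)
  show "compact (fst ` K)" by (intro compact_continuous_image continuous_intros assms)
  have "\<sigma> t ` fst ` K = fst ` (\<tau> t ` K)" for t by (simp add: image_image fst_\<tau>)
  then show "flow_invariant \<sigma> (fst ` K)"
    unfolding flow_invariant_def using skew_invariant_image[OF assms(2)] by simp
qed (use assms in simp)

lemma A_nonempty: "\<A> \<noteq> {}"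
  using pinched by (auto simp: pinched_def)

text \<open>An interval between the bounds could be empty; as the attractor projects onto the whole
  minimal base, none is.\<close>

lemma \<alpha>_le_\<beta>: "\<alpha> \<omega> \<le> \<beta> \<omega>"
proof -
  have "\<omega> \<in> fst ` \<A>" using invariant_fst[OF A_compact A_invariant A_nonempty] by simp
  then show ?thesis using mem_A by force
qed

lemma \<alpha>_in: "(\<omega>, \<alpha> \<omega>) \<in> \<A>" and \<beta>_in: "(\<omega>, \<beta> \<omega>) \<in> \<A>"
  using \<alpha>_le_\<beta> by (auto simp: mem_A)

text \<open>At least \<open>N0\<close>, so that \<open>[- (R + 1), R + 1]\<close> traps the
  solutions that start near the attractor as well.\<close>

definition R :: real where
  "R = (SOME R. R \<ge> N0 \<and> (\<forall>\<omega> x. (\<omega>, x) \<in> \<A> \<longrightarrow> \<bar>x\<bar> \<le> R))"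

lemma R_ge: "R \<ge> N0" and R_bound: "(\<omega>, x) \<in> \<A> \<Longrightarrow> \<bar>x\<bar> \<le> R"
proof -
  have "compact (snd ` \<A>)" by (intro compact_continuous_image continuous_intros A_compact)
  then obtain B where B: "\<forall>y\<in>snd ` \<A>. norm y \<le> B" by (meson compact_imp_bounded bounded_iff)
  have "\<bar>x\<bar> \<le> B" if "(\<omega>, x) \<in> \<A>" for \<omega> x
    using B that by (metis imageI real_norm_def snd_conv)
  then have "\<exists>R. R \<ge> N0 \<and> (\<forall>\<omega> x. (\<omega>, x) \<in> \<A> \<longrightarrow> \<bar>x\<bar> \<le> R)"
    by (intro exI[of _ "max N0 B"]) (simp add: le_max_iff_disj)
  from someI_ex[OF this] show "R \<ge> N0" "(\<omega>, x) \<in> \<A> \<Longrightarrow> \<bar>x\<bar> \<le> R"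
    unfolding R_def[symmetric] by auto
qed

lemma sol_less:
  assumes "(\<omega>, x) \<in> \<A>" "(\<omega>, y) \<in> \<A>" "x < y"
  shows "sol \<sigma> f t \<omega> x < sol \<sigma> f t \<omega> y"
  by (rule solves_less[of 0 t \<omega>]) (use assms A_solves in auto)

lemma sol_le:
  assumes "(\<omega>, x) \<in> \<A>" "(\<omega>, y) \<in> \<A>" "x \<le> y"
  shows "sol \<sigma> f t \<omega> x \<le> sol \<sigma> f t \<omega> y"
  using sol_less[OF assms(1,2), of t] assms(3) by (cases "x = y") auto

lemma A_preimage:
  assumes "(\<sigma> t \<omega>, y) \<in> \<A>"
  obtains x where "(\<omega>, x) \<in> \<A>" "sol \<sigma> f t \<omega> x = y"
proof -
  have "(\<sigma> t \<omega>, y) \<in> \<tau> t ` \<A>" using assms skew_invariant_image[OF A_invariant] by simp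
  then obtain w x where wx: "(w, x) \<in> \<A>" "\<sigma> t w = \<sigma> t \<omega>" "sol \<sigma> f t w x = y"
    by (auto simp: \<tau>_eq)
  have "w = \<omega>" using wx(2) base_minus(1) by metis
  then show ?thesis using wx that by blast
qed

text \<open>The image of the lower bound is in the attractor, hence not below the new lower bound.
  Conversely, the point that is carried to the new lower bound started no lower than the old one,
  and solutions keep their order.\<close>

lemma \<alpha>_equilibrium: "\<alpha> (\<sigma> t \<omega>) = sol \<sigma> f t \<omega> (\<alpha> \<omega>)"
proof (rule antisym)
  show "\<alpha> (\<sigma> t \<omega>) \<le> sol \<sigma> f t \<omega> (\<alpha> \<omega>)" using A_step[OF \<alpha>_in] mem_A by blast
  obtain x where x: "(\<omega>, x) \<in> \<A>" "sol \<sigma> f t \<omega> x = \<alpha> (\<sigma> t \<omega>)" using A_preimage[OF \<alpha>_in] by blast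
  have "sol \<sigma> f t \<omega> (\<alpha> \<omega>) \<le> sol \<sigma> f t \<omega> x" by (rule sol_le[OF \<alpha>_in x(1)]) (use x mem_A in blast)
  then show "sol \<sigma> f t \<omega> (\<alpha> \<omega>) \<le> \<alpha> (\<sigma> t \<omega>)" using x by simp
qed

lemma \<beta>_equilibrium: "\<beta> (\<sigma> t \<omega>) = sol \<sigma> f t \<omega> (\<beta> \<omega>)"
proof (rule antisym)
  show "sol \<sigma> f t \<omega> (\<beta> \<omega>) \<le> \<beta> (\<sigma> t \<omega>)" using A_step[OF \<beta>_in] mem_A by blast
  obtain x where x: "(\<omega>, x) \<in> \<A>" "sol \<sigma> f t \<omega> x = \<beta> (\<sigma> t \<omega>)" using A_preimage[OF \<beta>_in] by blast
  have "sol \<sigma> f t \<omega> x \<le> sol \<sigma> f t \<omega> (\<beta> \<omega>)" by (rule sol_le[OF x(1) \<beta>_in]) (use x mem_A in blast)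
  then show "\<beta> (\<sigma> t \<omega>) \<le> sol \<sigma> f t \<omega> (\<beta> \<omega>)" using x by simp
qed

lemma \<alpha>_solves: "solves \<omega> (\<lambda>t. \<alpha> (\<sigma> t \<omega>)) s" and \<beta>_solves: "solves \<omega> (\<lambda>t. \<beta> (\<sigma> t \<omega>)) s"
  unfolding \<alpha>_equilibrium \<beta>_equilibrium by (rule A_solves[OF \<alpha>_in], rule A_solves[OF \<beta>_in])

text \<open>Orbits in the attractor stay within \<open>R\<close> at all times, where
  \<open>f\<close> is Lipschitz, so both signs of \<open>t\<close> are covered.\<close>

lemma \<tau>_continuous: "continuous_on \<A> (\<tau> t)"
  unfolding continuous_on_sequentially
proof (intro allI ballI impI)
  fix X p assume p: "p \<in> \<A>" and X: "(\<forall>n. X n \<in> \<A>) \<and> X \<longlonglongrightarrow> p"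
  obtain L where L: "L > 0" "\<And>\<omega> x y. \<bar>x\<bar> \<le> R \<Longrightarrow> \<bar>y\<bar> \<le> R \<Longrightarrow> \<bar>f \<omega> x - f \<omega> y\<bar> \<le> L * \<bar>x - y\<bar>"
    using f_lipschitz by metis
  have XA: "(fst (X n), snd (X n)) \<in> \<A>" for n using X by simp
  have pA: "(fst p, snd p) \<in> \<A>" using p by simp
  have fstX: "(\<lambda>n. fst (X n)) \<longlonglongrightarrow> fst p" and sndX: "(\<lambda>n. snd (X n)) \<longlonglongrightarrow> snd p"
    using X by (auto intro: tendsto_fst tendsto_snd)
  have "(\<lambda>n. sol \<sigma> f t (fst (X n)) (snd (X n))) \<longlonglongrightarrow> sol \<sigma> f t (fst p) (snd p)"
  proof (rule ode_sequential_dependence[OF f_cont, where L=L and S="{-R..R}" and X="\<lambda>n. fst (X n)" and \<omega>="fst p"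
        and u="\<lambda>n s. sol \<sigma> f s (fst (X n)) (snd (X n))" and v="\<lambda>s. sol \<sigma> f s (fst p) (snd p)"])
    fix \<omega> x y assume "x \<in> {-R..R}" "y \<in> {-R..R}"
    then show "\<bar>f \<omega> x - f \<omega> y\<bar> \<le> L * \<bar>x - y\<bar>" by (intro L(2)) auto
  next
    fix n s
    show "((\<lambda>s. sol \<sigma> f s (fst (X n)) (snd (X n))) has_real_derivative
        f (\<sigma> s (fst (X n))) (sol \<sigma> f s (fst (X n)) (snd (X n)))) (at s)"
      using A_solves[OF XA, of n s] by (simp add: solves_def)
    show "sol \<sigma> f s (fst (X n)) (snd (X n)) \<in> {- R..R}"
      using R_bound[OF A_step[OF XA, of s n]] by (simp add: abs_le_iff)
    show "((\<lambda>s. sol \<sigma> f s (fst p) (snd p)) has_real_derivative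
        f (\<sigma> s (fst p)) (sol \<sigma> f s (fst p) (snd p))) (at s)"
      using A_solves[OF pA, of s] by (simp add: solves_def)
    show "sol \<sigma> f s (fst p) (snd p) \<in> {- R..R}"
      using R_bound[OF A_step[OF pA, of s]] by (simp add: abs_le_iff)
  qed (use L(1) fstX sndX in auto)
  moreover have "(\<lambda>n. \<sigma> t (fst (X n))) \<longlonglongrightarrow> \<sigma> t (fst p)"
  proof -
    have "continuous_on UNIV (\<sigma> t)" by (intro continuous_intros)
    then show ?thesis using fstX by (metis UNIV_I continuous_on_tendsto_compose always_eventually)
  qed
  ultimately show "(\<tau> t \<circ> X) \<longlonglongrightarrow> \<tau> t p"
    unfolding o_def skew_flow_def case_prod_beta by (intro tendsto_Pair)
qed

section \<open>Pinched points and the unique minimal set\<close>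

definition \<Omega>p :: "'w set" where
  "\<Omega>p = {\<omega>. \<alpha> \<omega> = \<beta> \<omega>}"

lemma \<Omega>p_unique: "\<omega> \<in> \<Omega>p \<Longrightarrow> (\<omega>, x) \<in> \<A> \<longleftrightarrow> x = \<alpha> \<omega>"
  by (auto simp: \<Omega>p_def mem_A)

lemma \<Omega>p_nonempty: "\<Omega>p \<noteq> {}"
proof -
  obtain \<omega> x where "{y. (\<omega>, y) \<in> \<A>} = {x}" using pinched unfolding pinched_def by blast
  then have "\<alpha> \<omega> = x" "\<beta> \<omega> = x" using \<alpha>_in[of \<omega>] \<beta>_in[of \<omega>] by auto
  then have "\<omega> \<in> \<Omega>p" by (simp add: \<Omega>p_def)
  then show ?thesis by blast
qed

lemma \<Omega>p_invariant: "\<omega> \<in> \<Omega>p \<Longrightarrow> \<sigma> t \<omega> \<in> \<Omega>p"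
  by (simp add: \<Omega>p_def \<alpha>_equilibrium \<beta>_equilibrium)

text \<open>Semicontinuity by compactness: the points of the attractor with height at distance at
  least \<open>e\<close> from \<open>\<alpha> \<omega>0\<close> form a compact set, and its
  projection misses \<open>\<omega>0\<close>.\<close>

lemma pinched_nearby:
  assumes "\<omega>0 \<in> \<Omega>p" "e > 0"
  obtains V where "open V" "\<omega>0 \<in> V" "\<And>\<omega> x. \<omega> \<in> V \<Longrightarrow> (\<omega>, x) \<in> \<A> \<Longrightarrow> \<bar>x - \<alpha> \<omega>0\<bar> < e"
proof -
  define Z where "Z = \<A> \<inter> {p. e \<le> \<bar>snd p - \<alpha> \<omega>0\<bar>}"
  have "closed {p :: 'w \<times> real. e \<le> \<bar>snd p - \<alpha> \<omega>0\<bar>}" by (intro closed_Collect_le continuous_intros)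
  then have "compact Z" unfolding Z_def by (rule compact_Int_closed[OF A_compact])
  then have "compact (fst ` Z)" by (intro compact_continuous_image continuous_intros)
  then have "open (- (fst ` Z))" using compact_imp_closed by blast
  moreover have "\<omega>0 \<in> - (fst ` Z)" using \<Omega>p_unique[OF assms(1)] assms(2) by (auto simp: Z_def)
  moreover have "\<bar>x - \<alpha> \<omega>0\<bar> < e" if "\<omega> \<in> - (fst ` Z)" "(\<omega>, x) \<in> \<A>" for \<omega> x
  proof (rule ccontr)
    assume "\<not> \<bar>x - \<alpha> \<omega>0\<bar> < e"
    then have "(\<omega>, x) \<in> Z" using that(2) by (simp add: Z_def)
    then show False using that(1) by (metis ComplD fst_conv imageI)
  qed
  ultimately show ?thesis using that by blast
qed

lemma isCont_at_pinched:
  assumes "\<omega>0 \<in> \<Omega>p" and \<eta>: "\<And>\<omega>. (\<omega>, \<eta> \<omega>) \<in> \<A>"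
  shows "isCont \<eta> \<omega>0"
proof -
  have "\<eta> \<omega>0 = \<alpha> \<omega>0" using \<Omega>p_unique[OF assms(1)] \<eta> by blast
  have near: "\<forall>\<^sub>F \<omega> in nhds \<omega>0. dist (\<eta> \<omega>) (\<eta> \<omega>0) < e" if e: "e > 0" for e
  proof -
    obtain V where "open V" "\<omega>0 \<in> V" "\<And>\<omega> x. \<omega> \<in> V \<Longrightarrow> (\<omega>, x) \<in> \<A> \<Longrightarrow> \<bar>x - \<alpha> \<omega>0\<bar> < e"
      using pinched_nearby[OF assms(1) e] by metis
    then show ?thesis unfolding eventually_nhds using \<eta> \<open>\<eta> \<omega>0 = \<alpha> \<omega>0\<close> by (auto simp: dist_real_def)
  qed
  then show ?thesis unfolding isCont_def tendsto_iff eventually_at_filter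
    by (intro allI impI eventually_mono[OF near])
qed

text \<open>Fibres shrink near a pinched point, so both bounds are continuous there. Conversely, a
  positive gap at a common continuity point would persist on an open set, which the dense orbit of a
  pinched point has to visit.\<close>

lemma common_continuity_points: "{\<omega>. isCont \<alpha> \<omega> \<and> isCont \<beta> \<omega>} = \<Omega>p"
proof
  show "\<Omega>p \<subseteq> {\<omega>. isCont \<alpha> \<omega> \<and> isCont \<beta> \<omega>}" using isCont_at_pinched \<alpha>_in \<beta>_in by auto
  show "{\<omega>. isCont \<alpha> \<omega> \<and> isCont \<beta> \<omega>} \<subseteq> \<Omega>p"
  proof (rule ccontr)
    assume "\<not> {\<omega>. isCont \<alpha> \<omega> \<and> isCont \<beta> \<omega>} \<subseteq> \<Omega>p"
    then obtain \<omega>0 where w: "isCont \<alpha> \<omega>0" "isCont \<beta> \<omega>0" "\<omega>0 \<notin> \<Omega>p" by blast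
    have "\<beta> \<omega>0 - \<alpha> \<omega>0 > 0" using w(3) \<alpha>_le_\<beta>[of \<omega>0] by (simp add: \<Omega>p_def)
    moreover have "isCont (\<lambda>\<omega>. \<beta> \<omega> - \<alpha> \<omega>) \<omega>0" using w by (intro continuous_intros)
    ultimately obtain V where V: "open V" "\<omega>0 \<in> V" "\<forall>\<omega>\<in>V. \<beta> \<omega> - \<alpha> \<omega> \<in> {0<..}"
      unfolding continuous_at_open by (metis greaterThan_iff open_greaterThan)
    obtain \<omega>1 where "\<omega>1 \<in> \<Omega>p" using \<Omega>p_nonempty by blast
    obtain t where "\<sigma> t \<omega>1 \<in> V" using base_dense_forward[OF V(1)] V(2) by blast
    then have "\<beta> (\<sigma> t \<omega>1) - \<alpha> (\<sigma> t \<omega>1) \<in> {0<..}" using V(3) by blast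
    then show False using \<Omega>p_invariant[OF \<open>\<omega>1 \<in> \<Omega>p\<close>, of t] by (simp add: \<Omega>p_def)
  qed
qed

lemma pinched_nearby_sum_dist:
  assumes "\<omega>0 \<in> \<Omega>p" "e > 0"
  obtains V where "open V" "V \<noteq> {}" "\<And>p. fst p \<in> V \<Longrightarrow> p \<in> \<A> \<Longrightarrow> sum_dist p (\<omega>0, \<alpha> \<omega>0) < e"
proof -
  have "e / 2 > 0" using assms(2) by simp
  then obtain V where V: "open V" "\<omega>0 \<in> V" "\<And>\<omega> x. \<omega> \<in> V \<Longrightarrow> (\<omega>, x) \<in> \<A> \<Longrightarrow> \<bar>x - \<alpha> \<omega>0\<bar> < e / 2"
    using pinched_nearby[OF assms(1)] by metis
  show ?thesis
  proof (rule that[of "V \<inter> ball \<omega>0 (e / 2)"])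
    fix p assume p: "fst p \<in> V \<inter> ball \<omega>0 (e / 2)" "p \<in> \<A>"
    have "\<bar>snd p - \<alpha> \<omega>0\<bar> < e / 2" using V(3)[of "fst p" "snd p"] p by simp
    then show "sum_dist p (\<omega>0, \<alpha> \<omega>0) < e" using p(1) by (simp add: sum_dist_def dist_commute)
  qed (use V assms(2) in auto)
qed

definition \<M> :: "('w \<times> real) set" where
  "\<M> = orbit_closure \<sigma> \<alpha> (SOME \<omega>. \<omega> \<in> \<Omega>p)"

text \<open>The fibre of \<open>K\<close> over \<open>\<omega>0\<close> is nonempty and contained in
  that of the attractor, hence it is the same single point.\<close>

lemma orbit_closure_least:
  assumes "\<omega>0 \<in> \<Omega>p" "compact K" "skew_invariant \<sigma> f K" "K \<noteq> {}"
  shows "orbit_closure \<sigma> \<alpha> \<omega>0 \<subseteq> K"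
  unfolding orbit_closure_def
proof (rule closure_minimal)
  show "closed K" using assms(2) by (rule compact_imp_closed)
  obtain x where x: "(\<omega>0, x) \<in> K" using invariant_fst[OF assms(2-4)] by (metis UNIV_I imageE prod.collapse)
  then have "(\<omega>0, x) \<in> \<A>" using invariant_subset_A[OF assms(2,3)] by blast
  then have "(\<omega>0, \<alpha> \<omega>0) \<in> K" using \<Omega>p_unique[OF assms(1)] x by simp
  then have "\<tau> t (\<omega>0, \<alpha> \<omega>0) \<in> K" for t using skew_invariant_image[OF assms(3)] by blast
  then show "range (\<lambda>t. (\<sigma> t \<omega>0, \<alpha> (\<sigma> t \<omega>0))) \<subseteq> K" by (auto simp: \<tau>_eq \<alpha>_equilibrium)
qed

lemma orbit_closure_subset_A: "orbit_closure \<sigma> \<alpha> \<omega>0 \<subseteq> \<A>"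
  unfolding orbit_closure_def
  by (rule closure_minimal) (use \<alpha>_in compact_imp_closed[OF A_compact] in auto)

lemma orbit_closure_invariant:
  "compact (orbit_closure \<sigma> \<alpha> \<omega>0)" "skew_invariant \<sigma> f (orbit_closure \<sigma> \<alpha> \<omega>0)" "orbit_closure \<sigma> \<alpha> \<omega>0 \<noteq> {}"
proof -
  let ?O = "range (\<lambda>t. (\<sigma> t \<omega>0, \<alpha> (\<sigma> t \<omega>0)))"
  let ?K = "orbit_closure \<sigma> \<alpha> \<omega>0"
  have sub: "?K \<subseteq> \<A>" by (rule orbit_closure_subset_A)
  show "compact ?K" using compact_Int_closed[OF A_compact, of ?K] sub
    by (simp add: orbit_closure_def Int_absorb1)
  show "?K \<noteq> {}" by (simp add: orbit_closure_def)
  have inv: "\<tau> t ` ?K \<subseteq> ?K" for t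
    unfolding orbit_closure_def
  proof (rule image_closure_subset)
    show "continuous_on (closure ?O) (\<tau> t)"
      using continuous_on_subset[OF \<tau>_continuous] sub by (simp add: orbit_closure_def)
    have "\<tau> t (\<sigma> s \<omega>0, \<alpha> (\<sigma> s \<omega>0)) = (\<sigma> (t + s) \<omega>0, \<alpha> (\<sigma> (t + s) \<omega>0))" for s
      by (simp add: \<tau>_eq base_add \<alpha>_equilibrium[of t "\<sigma> s \<omega>0"])
    then have "\<tau> t ` ?O \<subseteq> ?O" by auto
    then show "\<tau> t ` ?O \<subseteq> closure ?O" using closure_subset by blast
  qed simp
  have "?K \<subseteq> \<tau> t ` ?K" for t
  proof
    fix p assume "p \<in> ?K"
    then have "\<tau> (- t) p \<in> ?K" "\<tau> t (\<tau> (- t) p) = p" using inv[of "- t"] sub \<tau>_minus by blast+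
    then show "p \<in> \<tau> t ` ?K" by (metis imageI)
  qed
  then show "skew_invariant \<sigma> f ?K" unfolding skew_invariant_def using inv sub A_dom by blast
qed

lemma orbit_closure_eq: "\<omega>0 \<in> \<Omega>p \<Longrightarrow> orbit_closure \<sigma> \<alpha> \<omega>0 = \<M>"
  unfolding \<M>_def using orbit_closure_least orbit_closure_invariant \<Omega>p_nonempty
  by (intro antisym) (auto simp: some_in_eq)

lemma orbit_closure_\<beta>_eq: "\<omega>0 \<in> \<Omega>p \<Longrightarrow> orbit_closure \<sigma> \<beta> \<omega>0 = \<M>"
proof -
  assume w: "\<omega>0 \<in> \<Omega>p"
  have "\<beta> (\<sigma> t \<omega>0) = \<alpha> (\<sigma> t \<omega>0)" for t using \<Omega>p_invariant[OF w, of t] by (simp add: \<Omega>p_def)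
  then show ?thesis using orbit_closure_eq[OF w] by (simp add: orbit_closure_def)
qed

lemma M_compact: "compact \<M>" and M_invariant: "skew_invariant \<sigma> f \<M>" and M_nonempty: "\<M> \<noteq> {}"
  unfolding \<M>_def by (rule orbit_closure_invariant)+

lemma M_subset_A: "\<M> \<subseteq> \<A>"
  unfolding \<M>_def by (rule orbit_closure_subset_A)

lemma M_least:
  assumes "compact K" "skew_invariant \<sigma> f K" "K \<noteq> {}" shows "\<M> \<subseteq> K"
  unfolding \<M>_def using \<Omega>p_nonempty assms by (intro orbit_closure_least) (auto simp: some_in_eq)

lemma M_minimal: "minimal_set (skew_invariant \<sigma> f) K \<longleftrightarrow> K = \<M>"
  unfolding minimal_set_def using M_least M_compact M_invariant M_nonempty by blast

lemma M_pinched: "\<omega> \<in> \<Omega>p \<Longrightarrow> (\<omega>, \<alpha> \<omega>) \<in> \<M>"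
  using orbit_closure_eq[of \<omega>] closure_subset
  by (metis (no_types, lifting) base_zero orbit_closure_def range_eqI subsetD)

lemma M_fibre: obtains x where "(\<omega>, x) \<in> \<M>"
  using invariant_fst[OF M_compact M_invariant M_nonempty] by (metis UNIV_I imageE prod.collapse)

lemma M_section_iff:
  "\<not> \<M> \<subseteq> UNIV \<times> {r1..r2} \<longleftrightarrow> (\<exists>\<omega>\<in>\<Omega>p. \<alpha> \<omega> < r1 \<or> \<beta> \<omega> > r2)"
proof
  assume n: "\<not> \<M> \<subseteq> UNIV \<times> {r1..r2}"
  show "\<exists>\<omega>\<in>\<Omega>p. \<alpha> \<omega> < r1 \<or> \<beta> \<omega> > r2"
  proof (rule ccontr)
    assume c: "\<not> (\<exists>\<omega>\<in>\<Omega>p. \<alpha> \<omega> < r1 \<or> \<beta> \<omega> > r2)"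
    obtain \<omega>0 where w: "\<omega>0 \<in> \<Omega>p" using \<Omega>p_nonempty by blast
    have "\<alpha> (\<sigma> t \<omega>0) \<in> {r1..r2}" for t
      using c \<Omega>p_invariant[OF w, of t] by (auto simp: \<Omega>p_def not_less)
    then have "range (\<lambda>t. (\<sigma> t \<omega>0, \<alpha> (\<sigma> t \<omega>0))) \<subseteq> UNIV \<times> {r1..r2}" by auto
    then have "orbit_closure \<sigma> \<alpha> \<omega>0 \<subseteq> UNIV \<times> {r1..r2}"
      unfolding orbit_closure_def by (rule closure_minimal) (intro closed_Times closed_UNIV closed_atLeastAtMost)
    then show False using n orbit_closure_eq[OF w] by simp
  qed
next
  assume "\<exists>\<omega>\<in>\<Omega>p. \<alpha> \<omega> < r1 \<or> \<beta> \<omega> > r2"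
  then obtain \<omega> where w: "\<omega> \<in> \<Omega>p" "\<alpha> \<omega> \<notin> {r1..r2}" by (auto simp: \<Omega>p_def)
  then show "\<not> \<M> \<subseteq> UNIV \<times> {r1..r2}" using M_pinched[OF w(1)] by blast
qed

text \<open>A pinched orbit serves as bridge: \<open>y\<close> is flown close to \<open>p1\<close>,
  then \<open>p1\<close> exactly to \<open>p2\<close>, and \<open>y'\<close> is pulled back to a
  point \<open>q\<close> close to \<open>p2\<close>, from which the flow returns exactly to
  \<open>y'\<close>. Closeness need only be arranged on the base, since the fibres over a
  neighbourhood of a pinched point all lie near its point.\<close>

lemma chain_recurrent_attractor: "chain_recurrent sum_dist \<A> \<tau>"
  unfolding chain_recurrent_def
proof (intro allI impI ballI)
  fix e T :: real and y y' assume e: "e > 0" and T: "T > 0" and y: "y \<in> \<A>" and y': "y' \<in> \<A>"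
  obtain \<omega>0 where w: "\<omega>0 \<in> \<Omega>p" using \<Omega>p_nonempty by blast
  define p1 where "p1 = (\<omega>0, \<alpha> \<omega>0)"
  define p2 where "p2 = (\<sigma> T \<omega>0, \<alpha> (\<sigma> T \<omega>0))"
  have p12: "\<tau> T p1 = p2" by (simp add: p1_def p2_def \<tau>_eq \<alpha>_equilibrium)
  obtain V1 where V1: "open V1" "V1 \<noteq> {}" "\<And>p. fst p \<in> V1 \<Longrightarrow> p \<in> \<A> \<Longrightarrow> sum_dist p p1 < e"
    unfolding p1_def using pinched_nearby_sum_dist[OF w e] by metis
  obtain V2 where V2: "open V2" "V2 \<noteq> {}" "\<And>p. fst p \<in> V2 \<Longrightarrow> p \<in> \<A> \<Longrightarrow> sum_dist p p2 < e"
    unfolding p2_def using pinched_nearby_sum_dist[OF \<Omega>p_invariant[OF w] e] by metis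
  obtain s where s: "s \<ge> T" "\<sigma> s (fst y) \<in> V1" by (rule base_dense_forward[OF V1(1,2)])
  obtain s' where s': "s' \<ge> T" "\<sigma> (- s') (fst y') \<in> V2" by (rule base_dense_backward[OF V2(1,2)])
  define q where "q = \<tau> (- s') y'"
  have d1: "sum_dist (\<tau> s y) p1 < e" by (rule V1(3)) (use s y in \<open>auto simp: fst_\<tau> \<tau>_A\<close>)
  have "sum_dist q p2 < e" by (rule V2(3)) (use s' y' in \<open>auto simp: fst_\<tau> \<tau>_A q_def\<close>)
  then have d2: "sum_dist p2 q < e" by (simp add: sum_dist_def dist_commute abs_minus_commute)
  have d3: "sum_dist (\<tau> s' q) y' < e"
    using \<tau>_minus[OF y', of s'] e by (simp add: q_def sum_dist_def)
  have "p1 \<in> \<A>" "q \<in> \<A>" using \<alpha>_in y' \<tau>_A by (auto simp: p1_def q_def)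
  define P where "P = (\<lambda>_. y')(0 := y, Suc 0 := p1, Suc (Suc 0) := q)"
  define S where "S = (\<lambda>_::nat. s')(0 := s, Suc 0 := T)"
  have "P 0 = y" "P 3 = y'" by (auto simp: P_def numeral_eq_Suc)
  moreover have "\<forall>i\<le>3. P i \<in> \<A>" using y y' \<open>p1 \<in> \<A>\<close> \<open>q \<in> \<A>\<close> by (simp add: P_def)
  moreover have "\<forall>i<3. S i \<ge> T \<and> sum_dist (\<tau> (S i) (P i)) (P (Suc i)) < e"
    using s(1) s'(1) d1 d2 d3 p12 by (auto simp: S_def P_def less_Suc_eq numeral_eq_Suc)
  ultimately show "\<exists>k\<ge>1. \<exists>p s. p 0 = y \<and> p k = y' \<and> (\<forall>i\<le>k. p i \<in> \<A>) \<and>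
      (\<forall>i<k. s i \<ge> T \<and> sum_dist (\<tau> (s i) (p i)) (p (Suc i)) < e)"
    by (intro exI[of _ "3::nat"] conjI exI[of _ P] exI[of _ S]) auto
qed

lemma f_apply: "f \<omega> x = a \<omega> * x + b \<omega> + g \<omega> x"
  by (simp add: f_eq)

lemma forward_dom: "t \<ge> 0 \<Longrightarrow> t \<in> sol_dom \<sigma> f \<omega> x"
  using attractor bounded_insert[of "(\<omega>, x)" "{}"] unfolding global_attractor_def by fastforce

lemma forward_solves: "t \<ge> 0 \<Longrightarrow> solves \<omega> (\<lambda>t. sol \<sigma> f t \<omega> x) t"
  by (rule sol_solves[OF forward_dom])

lemma graph_attractor:
  assumes "\<Omega>p = UNIV"
  shows "\<A> = \<M>" "\<alpha> = \<beta>" "\<M> = graph_of \<alpha>" "\<M> = graph_of \<beta>" "continuous_on UNIV \<alpha>" "copy_of_base \<sigma> f \<M>"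
proof -
  have eq: "\<alpha> \<omega> = \<beta> \<omega>" for \<omega> using assms by (auto simp: \<Omega>p_def)
  then show ab: "\<alpha> = \<beta>" by blast
  have Ag: "\<A> = graph_of \<alpha>" using mem_A eq by (auto simp: graph_of_def intro: antisym)
  have "\<A> \<subseteq> \<M>" unfolding Ag using M_pinched assms by (auto simp: graph_of_def)
  then show AM: "\<A> = \<M>" using M_subset_A by blast
  show "\<M> = graph_of \<alpha>" using AM Ag by simp
  then show "\<M> = graph_of \<beta>" using ab by simp
  show c: "continuous_on UNIV \<alpha>"
    using isCont_at_pinched[OF _ \<alpha>_in] assms by (intro continuous_at_imp_continuous_on) auto
  have "equilibrium \<sigma> f \<alpha>" unfolding equilibrium_def using A_dom[OF \<alpha>_in] \<alpha>_equilibrium by blast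
  then show "copy_of_base \<sigma> f \<M>" unfolding copy_of_base_def using c \<open>\<M> = graph_of \<alpha>\<close> by blast
qed

section \<open>Contraction when the minimal set leaves the strip\<close>

text \<open>The derivative \<open>gx\<close> stays negative in a box around
  \<open>(\<omega>0, \<alpha> \<omega>0)\<close>. Half of its height allows for the spread of nearby
  fibres around \<open>\<alpha> \<omega>0\<close>, the other half is the distance
  \<open>\<rho>\<close> granted around each fibre point.\<close>

lemma contracting_neighbourhood:
  assumes "\<omega>0 \<in> \<Omega>p" "\<alpha> \<omega>0 \<notin> {r1..r2}"
  obtains V \<eta> \<rho> where "open V" "V \<noteq> {}" "\<eta> > 0" "\<rho> > 0"
    "\<forall>\<omega>\<in>V. \<forall>y x. (\<omega>, y) \<in> \<A> \<longrightarrow> \<bar>x - y\<bar> \<le> \<rho> \<longrightarrow> gx \<omega> x \<le> - \<eta>"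
proof -
  define \<eta> where "\<eta> = - gx \<omega>0 (\<alpha> \<omega>0) / 2"
  have \<eta>: "\<eta> > 0" "gx \<omega>0 (\<alpha> \<omega>0) < - \<eta>" using gx_neg[OF assms(2), of \<omega>0] by (auto simp: \<eta>_def)
  have "open ((\<lambda>(\<omega>, x). gx \<omega> x) -` {..<- \<eta>})" by (rule open_vimage[OF _ gx_cont]) simp
  moreover have "(\<omega>0, \<alpha> \<omega>0) \<in> (\<lambda>(\<omega>, x). gx \<omega> x) -` {..<- \<eta>}" using \<eta> by simp
  ultimately obtain V1 J where "open V1" "open J" "(\<omega>0, \<alpha> \<omega>0) \<in> V1 \<times> J" and
    VJ: "V1 \<times> J \<subseteq> (\<lambda>(\<omega>, x). gx \<omega> x) -` {..<- \<eta>}"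
    by (rule open_prod_elim)
  then obtain e where e: "e > 0" "ball (\<alpha> \<omega>0) e \<subseteq> J" by (meson mem_Sigma_iff open_contains_ball)
  obtain V2 where V2: "open V2" "\<omega>0 \<in> V2" "\<And>\<omega> x. \<omega> \<in> V2 \<Longrightarrow> (\<omega>, x) \<in> \<A> \<Longrightarrow> \<bar>x - \<alpha> \<omega>0\<bar> < e / 2"
    using pinched_nearby[OF assms(1), of "e / 2"] e(1) by auto
  show ?thesis
  proof (rule that[of "V1 \<inter> V2" \<eta> "e / 2"])
    show "open (V1 \<inter> V2)" using V2 \<open>open V1\<close> by blast
    show "V1 \<inter> V2 \<noteq> {}" using V2(2) \<open>(\<omega>0, \<alpha> \<omega>0) \<in> V1 \<times> J\<close> by blast
    show "\<forall>\<omega>\<in>V1 \<inter> V2. \<forall>y x. (\<omega>, y) \<in> \<A> \<longrightarrow> \<bar>x - y\<bar> \<le> e / 2 \<longrightarrow> gx \<omega> x \<le> - \<eta>"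
    proof (intro ballI allI impI)
      fix \<omega> y x assume w: "\<omega> \<in> V1 \<inter> V2" "(\<omega>, y) \<in> \<A>" "\<bar>x - y\<bar> \<le> e / 2"
      have "\<bar>y - \<alpha> \<omega>0\<bar> < e / 2" using V2(3) w by blast
      then have "\<bar>\<alpha> \<omega>0 - x\<bar> < e" using w(3) by linarith
      then have "x \<in> J" using e(2) by (auto simp: subset_iff dist_real_def)
      then have "(\<omega>, x) \<in> V1 \<times> J" using w(1) by blast
      then have "gx \<omega> x < - \<eta>" using VJ by auto
      then show "gx \<omega> x \<le> - \<eta>" by simp
    qed
  qed (use \<eta> e in auto)
qed

text \<open>The slope is controlled only within \<open>\<rho>\<close> of \<open>y\<close>. For a
  longer gap the piece of length \<open>\<rho>\<close> at \<open>y\<close> already lowers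
  \<open>g\<close> by \<open>\<eta> * \<rho>\<close>, the rest cannot raise it, and dividing by a
  gap of at most \<open>D\<close> leaves \<open>\<eta> * \<rho> / D\<close>.\<close>

lemma g_quotient_bound:
  assumes \<rho>: "\<rho> > 0" "\<eta> > 0"
    and gxb: "\<And>x. \<bar>x - y\<bar> \<le> \<rho> \<Longrightarrow> gx \<omega> x \<le> - \<eta>"
    and uv: "u < v" "v - u \<le> D" "y = u \<or> y = v"
  shows "(g \<omega> v - g \<omega> u) / (v - u) \<le> - (\<eta> * min 1 (\<rho> / D))"
proof -
  have "D > 0" using uv by simp
  have drop: "g \<omega> q - g \<omega> p \<le> - \<eta> * (q - p)" if pq: "p < q" "\<bar>p - y\<bar> \<le> \<rho>" "\<bar>q - y\<bar> \<le> \<rho>" for p q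
  proof -
    obtain z where z: "p < z" "z < q" "g \<omega> q - g \<omega> p = (q - p) * gx \<omega> z" using g_mvt[OF pq(1)] by metis
    have "gx \<omega> z \<le> - \<eta>" by (rule gxb) (use z pq in linarith)
    then have "(q - p) * gx \<omega> z \<le> (q - p) * - \<eta>" using pq by (intro mult_left_mono) auto
    then show ?thesis using z by (simp add: mult.commute)
  qed
  define \<eta>' where "\<eta>' = \<eta> * min 1 (\<rho> / D)"
  have "g \<omega> v - g \<omega> u \<le> - \<eta>' * (v - u)"
  proof (cases "v - u \<le> \<rho>")
    case True
    have "g \<omega> v - g \<omega> u \<le> - \<eta> * (v - u)" by (rule drop) (use True uv \<rho> in auto)
    moreover have "\<eta>' * (v - u) \<le> \<eta> * (v - u)"
      unfolding \<eta>'_def using \<rho> uv by (intro mult_right_mono) (auto simp: mult_left_le)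
    ultimately show ?thesis by simp
  next
    case False
    have "g \<omega> v - g \<omega> u \<le> - \<eta> * \<rho>"
      using uv(3)
    proof
      assume "y = u"
      then have "g \<omega> (u + \<rho>) - g \<omega> u \<le> - \<eta> * (u + \<rho> - u)" by (intro drop) (use \<rho> in auto)
      moreover have "g \<omega> v \<le> g \<omega> (u + \<rho>)" by (rule g_antimono) (use False in simp)
      ultimately show ?thesis by simp
    next
      assume "y = v"
      then have "g \<omega> v - g \<omega> (v - \<rho>) \<le> - \<eta> * (v - (v - \<rho>))" by (intro drop) (use \<rho> in auto)
      moreover have "g \<omega> (v - \<rho>) \<le> g \<omega> u" by (rule g_antimono) (use False in simp)
      ultimately show ?thesis by simp
    qed
    moreover have "\<eta>' * (v - u) \<le> \<eta> * \<rho>"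
    proof -
      have "\<eta>' * (v - u) \<le> (\<eta> * (\<rho> / D)) * D"
        unfolding \<eta>'_def using uv \<rho> \<open>D > 0\<close> by (intro mult_mono) auto
      then show ?thesis using \<open>D > 0\<close> by simp
    qed
    ultimately show ?thesis by simp
  qed
  then show ?thesis using uv(1) unfolding \<eta>'_def[symmetric] by (simp add: divide_le_eq)
qed

text \<open>At each time only one of the two solutions has to be in the attractor, so one estimate
  serves both the collapse of its fibres and its stability against points outside.\<close>

lemma exponential_contraction:
  assumes V: "open V" "V \<noteq> {}" "\<eta> > 0" "\<rho> > 0"
    "\<forall>\<omega>\<in>V. \<forall>y x. (\<omega>, y) \<in> \<A> \<longrightarrow> \<bar>x - y\<bar> \<le> \<rho> \<longrightarrow> gx \<omega> x \<le> - \<eta>"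
    and N: "N \<ge> N0"
  shows "\<exists>\<kappa>\<ge>1. \<exists>\<gamma>>0. \<forall>\<omega> u v.
      (\<forall>s\<ge>0. solves \<omega> u s \<and> solves \<omega> v s \<and> ((\<sigma> s \<omega>, u s) \<in> \<A> \<or> (\<sigma> s \<omega>, v s) \<in> \<A>)) \<longrightarrow>
      u 0 < v 0 \<longrightarrow> \<bar>u 0\<bar> \<le> N \<longrightarrow> \<bar>v 0\<bar> \<le> N \<longrightarrow>
      (\<forall>t\<ge>0. v t - u t \<le> \<kappa> * exp (- \<gamma> * t) * (v 0 - u 0))"
proof -
  define \<eta>' where "\<eta>' = \<eta> * min 1 (\<rho> / (2 * N))"
  have "N > 0" using N N0(1) by simp
  then have \<eta>': "\<eta>' > 0" using V by (simp add: \<eta>'_def)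
  obtain P \<delta> where P: "P > 0" "\<delta> > 0" "\<delta> \<le> P"
    "\<And>\<omega>. \<exists>t\<ge>0. t + \<delta> \<le> P \<and> (\<forall>s. 0 \<le> s \<and> s \<le> \<delta> \<longrightarrow> \<sigma> (t + s) \<omega> \<in> V)"
    using uniform_sojourn[OF V(1,2)] by metis
  \<comment> \<open>Each period \<open>P\<close> lowers the logarithmic gap relative to
    \<open>C\<close> by \<open>\<eta>' * \<delta>\<close>, a mean rate of
    \<open>2 * \<gamma>\<close>. One \<open>\<gamma>\<close> is spent on the growth of
    \<open>C\<close>, the other remains as rate of contraction.\<close>
  define \<gamma> where "\<gamma> = \<eta>' * \<delta> / (2 * P)"
  have "\<gamma> > 0" using \<eta>' P by (simp add: \<gamma>_def)
  obtain K where K: "K \<ge> 0" "\<And>\<omega> t. t \<ge> 0 \<Longrightarrow> C \<omega> t \<le> K + \<gamma> * t" using C_subexponential[OF \<open>\<gamma> > 0\<close>] by metis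
  \<comment> \<open>In the factor, \<open>K\<close> comes from the growth of \<open>C\<close> and
    \<open>\<eta>' * \<delta>\<close> from the last, incomplete period.\<close>
  show ?thesis
  proof (rule exI[of _ "exp (K + \<eta>' * \<delta>)"], rule conjI, use K(1) \<eta>' P in simp,
      rule exI[of _ \<gamma>], rule conjI, rule \<open>\<gamma> > 0\<close>, intro allI impI)
    fix \<omega> u v and t :: real
    assume uv: "\<forall>s\<ge>0. solves \<omega> u s \<and> solves \<omega> v s \<and> ((\<sigma> s \<omega>, u s) \<in> \<A> \<or> (\<sigma> s \<omega>, v s) \<in> \<A>)"
      and uv0: "u 0 < v 0" and uN: "\<bar>u 0\<bar> \<le> N" and vN: "\<bar>v 0\<bar> \<le> N" and t: "t \<ge> 0"
    have u: "solves \<omega> u s" and v: "solves \<omega> v s"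
      and inA: "(\<sigma> s \<omega>, u s) \<in> \<A> \<or> (\<sigma> s \<omega>, v s) \<in> \<A>" if "s \<ge> 0" for s
      using uv that by blast+
    have less: "u s < v s" if "s \<ge> 0" for s
      by (rule solves_less[of 0 s \<omega>]) (use u v uv0 that in \<open>auto simp: closed_segment_eq_real_ivl\<close>)
    have gap: "v s - u s \<le> 2 * N" if "s \<ge> 0" for s
      using trapping[OF that N uN u] trapping[OF that N vN v] by linarith
    define Y where "Y s = ln (v s - u s) - C \<omega> s" for s
    have anti: "Y s' \<le> Y s" if "0 \<le> s" "s \<le> s'" for s s'
      unfolding Y_def by (rule log_gap_antimono[OF that(2)]) (use that u v less in auto)
    have drop: "Y (s + \<delta>) \<le> Y s - \<eta>' * \<delta>"
      if s: "s \<ge> 0" and inV: "\<And>r. 0 \<le> r \<Longrightarrow> r \<le> \<delta> \<Longrightarrow> \<sigma> (s + r) \<omega> \<in> V" for s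
    proof -
      have "(\<lambda>r. Y r + \<eta>' * r) (s + \<delta>) \<le> (\<lambda>r. Y r + \<eta>' * r) s"
      proof (rule DERIV_nonpos_imp_nonincreasing[of s "s + \<delta>" "\<lambda>r. Y r + \<eta>' * r"])
        fix r assume r: "s \<le> r" "r \<le> s + \<delta>"
        have r0: "r \<ge> 0" using s r by simp
        let ?q = "(g (\<sigma> r \<omega>) (v r) - g (\<sigma> r \<omega>) (u r)) / (v r - u r)"
        have "(Y has_real_derivative ?q) (at r)"
          unfolding Y_def[abs_def] by (rule log_gap_deriv[OF u[OF r0] v[OF r0] less[OF r0]])
        then have "((\<lambda>r. Y r + \<eta>' * r) has_real_derivative ?q + \<eta>') (at r)"
          by (auto intro!: derivative_eq_intros)
        moreover have "?q \<le> - \<eta>'"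
        proof -
          have rV: "\<sigma> r \<omega> \<in> V" using inV[of "r - s"] r by simp
          obtain y where y: "(\<sigma> r \<omega>, y) \<in> \<A>" "y = u r \<or> y = v r" using inA[OF r0] by blast
          show ?thesis unfolding \<eta>'_def
            by (rule g_quotient_bound[OF V(4,3) V(5)[rule_format, OF rV y(1)] less[OF r0] gap[OF r0] y(2)])
        qed
        ultimately show "\<exists>y. ((\<lambda>r. Y r + \<eta>' * r) has_real_derivative y) (at r) \<and> y \<le> 0"
          by (intro exI[of _ "?q + \<eta>'"]) simp
      qed (use P in simp)
      then show ?thesis by (simp add: algebra_simps)
    qed
    have period: "Y (s + P) \<le> Y s - \<eta>' * \<delta>" if s: "s \<ge> 0" for s
    proof -
      obtain r where r: "r \<ge> 0" "r + \<delta> \<le> P" "\<forall>q. 0 \<le> q \<and> q \<le> \<delta> \<longrightarrow> \<sigma> (r + q) (\<sigma> s \<omega>) \<in> V"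
        using P(4) by blast
      have "\<sigma> (s + r + q) \<omega> \<in> V" if "0 \<le> q" "q \<le> \<delta>" for q
        using r(3) that by (simp add: base_add[symmetric] add_ac)
      then have "Y (s + r + \<delta>) \<le> Y (s + r) - \<eta>' * \<delta>" using s r by (intro drop) auto
      moreover have "Y (s + P) \<le> Y (s + r + \<delta>)" by (rule anti) (use s r P in auto)
      moreover have "Y (s + r) \<le> Y s" by (rule anti) (use s r in auto)
      ultimately show ?thesis by linarith
    qed
    have steps: "Y (real n * P) \<le> Y 0 - real n * (\<eta>' * \<delta>)" for n
    proof (induction n)
      case (Suc n)
      have "Y (real n * P + P) \<le> Y (real n * P) - \<eta>' * \<delta>" by (rule period) (use P in simp)
      then show ?case using Suc by (simp add: algebra_simps)
    qed simp
    define n where "n = nat \<lfloor>t / P\<rfloor>"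
    have n: "real n \<le> t / P" "t / P < real n + 1" using t P by (auto simp: n_def)
    have "real n * P \<le> t" using n(1) P by (simp add: field_simps)
    then have "Y t \<le> Y (real n * P)" using P by (intro anti) auto
    also have "\<dots> \<le> Y 0 - real n * (\<eta>' * \<delta>)" by (rule steps)
    also have "\<dots> \<le> Y 0 - (t / P - 1) * (\<eta>' * \<delta>)"
      using mult_right_mono[of "t / P - 1" "real n" "\<eta>' * \<delta>"] n \<eta>' P by simp
    also have "(t / P - 1) * (\<eta>' * \<delta>) = 2 * \<gamma> * t - \<eta>' * \<delta>" using P by (simp add: \<gamma>_def field_simps)
    finally have "ln (v t - u t) \<le> ln (v 0 - u 0) + C \<omega> t - 2 * \<gamma> * t + \<eta>' * \<delta>" by (simp add: Y_def)
    then have "ln (v t - u t) \<le> ln (v 0 - u 0) + (K + \<eta>' * \<delta>) + - \<gamma> * t" using K(2)[OF t, of \<omega>] by simp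
    then have "exp (ln (v t - u t)) \<le> exp (ln (v 0 - u 0) + (K + \<eta>' * \<delta>) + - \<gamma> * t)" by simp
    then show "v t - u t \<le> exp (K + \<eta>' * \<delta>) * exp (- \<gamma> * t) * (v 0 - u 0)"
    proof -
      have "exp (ln (v t - u t)) = v t - u t" "exp (ln (v 0 - u 0)) = v 0 - u 0"
        using less[OF t] uv0 by simp_all
      then show ?thesis
        using \<open>exp (ln (v t - u t)) \<le> _\<close> by (simp only: exp_add) (simp only: mult_ac)
    qed
  qed
qed

lemma hyperbolic_case:
  assumes "\<omega>0 \<in> \<Omega>p" "\<alpha> \<omega>0 \<notin> {r1..r2}"
  shows "\<Omega>p = UNIV" "unif_exp_stable \<sigma> f \<A>"
proof -
  obtain V \<eta> \<rho> where V: "open V" "V \<noteq> {}" "\<eta> > 0" "\<rho> > 0"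
    "\<forall>\<omega>\<in>V. \<forall>y x. (\<omega>, y) \<in> \<A> \<longrightarrow> \<bar>x - y\<bar> \<le> \<rho> \<longrightarrow> gx \<omega> x \<le> - \<eta>"
    using contracting_neighbourhood[OF assms] by metis
  have "R + 1 \<ge> N0" using R_ge by simp
  obtain \<kappa> \<gamma> where kg: "\<kappa> \<ge> 1" "\<gamma> > 0" and dec: "\<forall>\<omega> u v.
      (\<forall>s\<ge>0. solves \<omega> u s \<and> solves \<omega> v s \<and> ((\<sigma> s \<omega>, u s) \<in> \<A> \<or> (\<sigma> s \<omega>, v s) \<in> \<A>)) \<longrightarrow>
      u 0 < v 0 \<longrightarrow> \<bar>u 0\<bar> \<le> R + 1 \<longrightarrow> \<bar>v 0\<bar> \<le> R + 1 \<longrightarrow>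
      (\<forall>t\<ge>0. v t - u t \<le> \<kappa> * exp (- \<gamma> * t) * (v 0 - u 0))"
    using exponential_contraction[OF V \<open>R + 1 \<ge> N0\<close>] by (elim exE conjE) (rule that)
  have ordered: "\<bar>sol \<sigma> f t \<omega> v - sol \<sigma> f t \<omega> u\<bar> \<le> \<kappa> * exp (- \<gamma> * t) * (v - u)"
    if "u < v" "\<bar>u\<bar> \<le> R + 1" "\<bar>v\<bar> \<le> R + 1" "(\<omega>, u) \<in> \<A> \<or> (\<omega>, v) \<in> \<A>" "t \<ge> 0" for \<omega> u v t
  proof -
    have "sol \<sigma> f t \<omega> v - sol \<sigma> f t \<omega> u \<le> \<kappa> * exp (- \<gamma> * t) * (sol \<sigma> f 0 \<omega> v - sol \<sigma> f 0 \<omega> u)"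
      by (rule dec[rule_format]) (use that A_step forward_solves in auto)
    moreover have "sol \<sigma> f t \<omega> u < sol \<sigma> f t \<omega> v"
      by (rule solves_less[of 0 t \<omega>]) (use that forward_solves in \<open>auto simp: closed_segment_eq_real_ivl\<close>)
    ultimately show ?thesis by simp
  qed
  have contr: "\<bar>sol \<sigma> f t \<omega> y - sol \<sigma> f t \<omega> x\<bar> \<le> \<kappa> * exp (- \<gamma> * t) * \<bar>y - x\<bar>"
    if "(\<omega>, y) \<in> \<A>" "\<bar>x\<bar> \<le> R + 1" "t \<ge> 0" for \<omega> x y t
  proof -
    have "\<bar>y\<bar> \<le> R + 1" using R_bound[OF that(1)] by simp
    then show ?thesis using ordered[of x y \<omega> t] ordered[of y x \<omega> t] that
      by (cases x y rule: linorder_cases) (simp_all add: abs_minus_commute)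
  qed
  show "unif_exp_stable \<sigma> f \<A>"
    unfolding unif_exp_stable_def
  proof (rule exI[of _ 1], intro conjI, simp, rule exI[of _ \<kappa>], intro conjI, rule kg,
      rule exI[of _ \<gamma>], intro conjI, rule kg, intro allI impI conjI)
    fix \<omega> y x and t :: real assume yx: "(\<omega>, y) \<in> \<A> \<and> \<bar>y - x\<bar> < 1" and t: "t \<ge> 0"
    show "t \<in> sol_dom \<sigma> f \<omega> x" by (rule forward_dom[OF t])
    have "\<bar>x\<bar> \<le> R + 1" using R_bound[of \<omega> y] yx by linarith
    then show "\<bar>sol \<sigma> f t \<omega> y - sol \<sigma> f t \<omega> x\<bar> \<le> \<kappa> * exp (- \<gamma> * t) * \<bar>y - x\<bar>" using contr yx t by blast
  qed
  \<comment> \<open>Contraction is started over \<open>\<sigma> (- t) \<omega>\<close>, where the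
    gap is at most \<open>2 * R\<close>, and observed at time 0; then \<open>t\<close> tends to
    infinity.\<close>
  have "\<alpha> \<omega> = \<beta> \<omega>" for \<omega>
  proof -
    have bnd: "\<bar>\<alpha> \<omega> - \<beta> \<omega>\<bar> \<le> \<kappa> * (2 * R) * exp (- \<gamma> * t)" if t: "t \<ge> 0" for t
    proof -
      define w where "w = \<sigma> (- t) \<omega>"
      have w: "\<sigma> t w = \<omega>" by (simp add: w_def)
      have "\<bar>\<alpha> w\<bar> \<le> R" "\<bar>\<beta> w\<bar> \<le> R" using R_bound \<alpha>_in \<beta>_in by blast+
      then have "\<bar>sol \<sigma> f t w (\<alpha> w) - sol \<sigma> f t w (\<beta> w)\<bar> \<le> \<kappa> * exp (- \<gamma> * t) * \<bar>\<alpha> w - \<beta> w\<bar>"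
        using contr[OF \<alpha>_in _ t, of "\<beta> w" w] by simp
      also have "\<dots> \<le> \<kappa> * exp (- \<gamma> * t) * (2 * R)"
        using \<open>\<bar>\<alpha> w\<bar> \<le> R\<close> \<open>\<bar>\<beta> w\<bar> \<le> R\<close> kg by (intro mult_left_mono) auto
      finally show ?thesis using \<alpha>_equilibrium[of t w] \<beta>_equilibrium[of t w] w by (simp add: mult_ac)
    qed
    have "((\<lambda>t. \<kappa> * (2 * R) * exp (- \<gamma> * t)) \<longlongrightarrow> 0) at_top"
    proof -
      have "((\<lambda>t. exp (- (\<gamma> * t))) \<longlongrightarrow> 0) at_top"
        by (rule filterlim_compose[OF exp_at_bot], rule filterlim_compose[OF filterlim_uminus_at_bot_at_top])
           (rule filterlim_tendsto_pos_mult_at_top[OF tendsto_const kg(2) filterlim_ident])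
      from tendsto_mult_left[OF this, of "\<kappa> * (2 * R)"] show ?thesis by simp
    qed
    moreover have "\<forall>\<^sub>F t in at_top. \<bar>\<alpha> \<omega> - \<beta> \<omega>\<bar> \<le> \<kappa> * (2 * R) * exp (- \<gamma> * t)"
      using bnd eventually_ge_at_top[of 0] by (rule eventually_mono[rotated])
    ultimately have "\<bar>\<alpha> \<omega> - \<beta> \<omega>\<bar> \<le> 0" by (rule tendsto_lowerbound) simp
    then show ?thesis by simp
  qed
  then show "\<Omega>p = UNIV" by (auto simp: \<Omega>p_def)
qed

section \<open>Primitives, and the attractor at the ends of the strip\<close>

text \<open>A primitive is bounded on the compact base, so \<open>C\<close> is bounded below. As the
  logarithmic gap minus \<open>C\<close> only grows when time runs backwards, a positive gap over
  \<open>\<omega>\<close> stays above some \<open>m > 0\<close> in the whole past, whereas the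
  backward orbit of \<open>\<omega>\<close> comes near a pinched point, where gaps are below
  \<open>m\<close>.\<close>

lemma primitive_collapses:
  assumes "has_continuous_primitive \<sigma> a"
  shows "\<Omega>p = UNIV"
proof (rule ccontr)
  assume "\<Omega>p \<noteq> UNIV"
  then obtain \<omega> where "\<alpha> \<omega> \<noteq> \<beta> \<omega>" by (auto simp: \<Omega>p_def)
  then have w: "\<alpha> \<omega> < \<beta> \<omega>" using \<alpha>_le_\<beta>[of \<omega>] by simp
  obtain h where h: "continuous_on UNIV h" "\<And>\<omega> t. h (\<sigma> t \<omega>) - h \<omega> = C \<omega> t"
    using assms unfolding has_continuous_primitive_def by blast
  obtain H where H: "\<forall>y\<in>range h. norm y \<le> H"
    using compact_imp_bounded[OF compact_continuous_image[OF h(1) compact_base]] unfolding bounded_iff by blast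
  have Cb: "C \<omega> t \<ge> - 2 * H" for t
  proof -
    have "\<bar>h (\<sigma> t \<omega>)\<bar> \<le> H" "\<bar>h \<omega>\<bar> \<le> H" using H by auto
    then show ?thesis using h(2)[of t \<omega>] by linarith
  qed
  define m where "m = exp (ln (\<beta> \<omega> - \<alpha> \<omega>) - 2 * H)"
  have sep: "\<alpha> (\<sigma> s \<omega>) < \<beta> (\<sigma> s \<omega>)" for s
    unfolding \<alpha>_equilibrium \<beta>_equilibrium by (rule sol_less[OF \<alpha>_in \<beta>_in w])
  have below: "\<beta> (\<sigma> (- t) \<omega>) - \<alpha> (\<sigma> (- t) \<omega>) \<ge> m" if "t \<ge> 0" for t
  proof -
    have "ln (\<beta> (\<sigma> 0 \<omega>) - \<alpha> (\<sigma> 0 \<omega>)) - C \<omega> 0 \<le> ln (\<beta> (\<sigma> (- t) \<omega>) - \<alpha> (\<sigma> (- t) \<omega>)) - C \<omega> (- t)"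
      by (rule log_gap_antimono) (use that \<alpha>_solves \<beta>_solves sep in auto)
    then have "exp (ln (\<beta> \<omega> - \<alpha> \<omega>) - 2 * H) \<le> exp (ln (\<beta> (\<sigma> (- t) \<omega>) - \<alpha> (\<sigma> (- t) \<omega>)))"
      using Cb[of "- t"] by simp
    then show ?thesis using sep[of "- t"] by (simp add: m_def)
  qed
  obtain \<omega>0 where w0: "\<omega>0 \<in> \<Omega>p" using \<Omega>p_nonempty by blast
  have "m > 0" by (simp add: m_def)
  then have "m / 2 > 0" by simp
  then obtain V where V: "open V" "\<omega>0 \<in> V" "\<And>\<omega> x. \<omega> \<in> V \<Longrightarrow> (\<omega>, x) \<in> \<A> \<Longrightarrow> \<bar>x - \<alpha> \<omega>0\<bar> < m / 2"
    using pinched_nearby[OF w0] by metis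
  have "V \<noteq> {}" using V(2) by blast
  then obtain t where t: "t \<ge> 0" "\<sigma> (- t) \<omega> \<in> V" using base_dense_backward[OF V(1)] by metis
  have "\<bar>\<alpha> (\<sigma> (- t) \<omega>) - \<alpha> \<omega>0\<bar> < m / 2" "\<bar>\<beta> (\<sigma> (- t) \<omega>) - \<alpha> \<omega>0\<bar> < m / 2"
    using V(3)[OF t(2)] \<alpha>_in \<beta>_in by blast+
  then show False using below[OF t(1)] by linarith
qed

text \<open>On the strip where the equation is linear, adding a multiple of a solution of the homogeneous
  equation that stays bounded in the past produces another orbit bounded in the past, which has to lie in
  the attractor.\<close>

lemma perturbed_orbit_in_attractor:
  assumes K: "\<And>s. s \<le> 0 \<Longrightarrow> C \<omega>1 s \<le> K" and "\<rho> > 0"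
    and strip: "\<And>\<omega> x d. (\<omega>, x) \<in> \<A> \<Longrightarrow> 0 \<le> d \<Longrightarrow> d \<le> \<rho> \<Longrightarrow> r1 \<le> x + sg * d \<and> x + sg * d \<le> r2"
    and x0: "(\<omega>1, x0) \<in> \<A>"
  shows "(\<omega>1, x0 + sg * (\<rho> * exp (- K))) \<in> \<A>"
proof -
  \<comment> \<open>The factor \<open>exp (- K)\<close> keeps \<open>d t \<le> \<rho>\<close> for
    all \<open>t \<le> 0\<close>, hence the perturbed orbit in the strip throughout the past. The
    sign \<open>sg\<close> is 1 or -1 in the two applications, one for each end.\<close>
  define d where "d t = \<rho> * exp (- K) * exp (C \<omega>1 t)" for t
  define v where "v t = sol \<sigma> f t \<omega>1 x0 + sg * d t" for t
  have d: "0 \<le> d t" "d t \<le> \<rho>" if "t \<le> 0" for t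
  proof -
    show "0 \<le> d t" using \<open>\<rho> > 0\<close> by (simp add: d_def)
    have "exp (- K) * exp (C \<omega>1 t) \<le> 1" using K[OF that] by (simp flip: exp_add)
    then show "d t \<le> \<rho>" using \<open>\<rho> > 0\<close> unfolding d_def mult.assoc by (simp add: mult_left_le)
  qed
  have in1: "r1 \<le> v t \<and> v t \<le> r2" if "t \<le> 0" for t
    unfolding v_def by (rule strip[OF A_step[OF x0] d[OF that]])
  have in2: "r1 \<le> sol \<sigma> f t \<omega>1 x0 \<and> sol \<sigma> f t \<omega>1 x0 \<le> r2" for t
    using strip[OF A_step[OF x0], of 0 t] \<open>\<rho> > 0\<close> by simp
  have solv: "solves \<omega>1 v t" if t: "t \<le> 0" for t
  proof -
    have "(d has_real_derivative d t * a (\<sigma> t \<omega>1)) (at t)"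
      unfolding d_def[abs_def] by (auto intro!: derivative_eq_intros C_deriv)
    then have "(v has_real_derivative f (\<sigma> t \<omega>1) (sol \<sigma> f t \<omega>1 x0) + sg * (d t * a (\<sigma> t \<omega>1))) (at t)"
      unfolding v_def[abs_def] using A_solves[OF x0, of t] unfolding solves_def
      by (auto intro!: derivative_eq_intros)
    moreover have "f (\<sigma> t \<omega>1) (sol \<sigma> f t \<omega>1 x0) + sg * (d t * a (\<sigma> t \<omega>1)) = f (\<sigma> t \<omega>1) (v t)"

    proof -
      have 1: "f (\<sigma> t \<omega>1) y = a (\<sigma> t \<omega>1) * y + b (\<sigma> t \<omega>1)" if "r1 \<le> y \<and> y \<le> r2" for y
        using that by (subst f_apply) (simp add: g_zero)
      show ?thesis unfolding 1[OF in1[OF t]] 1[OF in2]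
        unfolding v_def distrib_left by (simp only: ac_simps)
    qed
    ultimately show ?thesis by (simp add: solves_def)
  qed
  define D where "D = (\<lambda>t. (\<sigma> t \<omega>1, v t)) ` {..0}"
  have "D \<subseteq> UNIV \<times> {r1..r2}" using in1 by (auto simp: D_def)
  moreover have "bounded ((UNIV :: 'w set) \<times> {r1..r2})"
    by (intro bounded_Times compact_imp_bounded compact_base) auto
  ultimately have "bounded D" by (rule bounded_subset[rotated])
  have "(\<omega>1, v 0) \<in> \<A>"
  proof (rule pullback_attraction[OF \<open>bounded D\<close>])
    fix T :: real assume T: "T \<ge> 0"
    have "sol \<sigma> f T (\<sigma> (- T) \<omega>1) (v (- T)) = v (T + - T)"
    proof (rule solves_unique[of 0 T "\<sigma> (- T) \<omega>1"
          "\<lambda>t. sol \<sigma> f t (\<sigma> (- T) \<omega>1) (v (- T))" "\<lambda>s. v (s + - T)"])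
      fix s assume "s \<in> closed_segment 0 T"
      then have s: "0 \<le> s" "s \<le> T" using T by (auto simp: closed_segment_eq_real_ivl)
      show "solves (\<sigma> (- T) \<omega>1) (\<lambda>a. sol \<sigma> f a (\<sigma> (- T) \<omega>1) (v (- T))) s" by (rule forward_solves[OF s(1)])
      show "solves (\<sigma> (- T) \<omega>1) (\<lambda>s. v (s + - T)) s" by (rule solves_shift, rule solv) (use s in simp)
    qed simp
    then have "\<tau> T (\<sigma> (- T) \<omega>1, v (- T)) = (\<omega>1, v 0)" by (simp add: \<tau>_eq)
    moreover have "(\<sigma> (- T) \<omega>1, v (- T)) \<in> D" using T by (auto simp: D_def)
    ultimately show "\<exists>q\<in>D. \<tau> T q = (\<omega>1, v 0)" by blast
  qed
  then show ?thesis by (simp add: v_def d_def)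
qed

text \<open>The room \<open>\<rho>\<close> below \<open>r2\<close> would allow
  \<open>\<beta>\<close> to be perturbed upwards within the attractor, against its maximality. At
  \<open>r1\<close> the same is done to \<open>\<alpha>\<close> downwards.\<close>

lemma attractor_reaches_r2:
  assumes "\<rho> > 0" "\<And>\<omega> x. (\<omega>, x) \<in> \<A> \<Longrightarrow> r1 \<le> x \<and> x \<le> r2 - \<rho>"
  shows False
proof -
  obtain \<omega> K where K: "\<And>s. s \<le> 0 \<Longrightarrow> C \<omega> s \<le> K" using backward_bounded_cocycle by blast
  have "r1 \<le> x + 1 * d \<and> x + 1 * d \<le> r2" if "(\<omega>, x) \<in> \<A>" "0 \<le> d" "d \<le> \<rho>" for \<omega> x d
    using assms(2)[OF that(1)] that by simp
  from perturbed_orbit_in_attractor[OF K assms(1) this \<beta>_in]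
  have "(\<omega>, \<beta> \<omega> + 1 * (\<rho> * exp (- K))) \<in> \<A>" by simp
  then have "\<rho> * exp (- K) \<le> 0" by (simp add: mem_A)
  then show False using assms(1) by (simp add: mult_le_0_iff)
qed

lemma attractor_reaches_r1:
  assumes "\<rho> > 0" "\<And>\<omega> x. (\<omega>, x) \<in> \<A> \<Longrightarrow> r1 + \<rho> \<le> x \<and> x \<le> r2"
  shows False
proof -
  obtain \<omega> K where K: "\<And>s. s \<le> 0 \<Longrightarrow> C \<omega> s \<le> K" using backward_bounded_cocycle by blast
  have "r1 \<le> x + -1 * d \<and> x + -1 * d \<le> r2" if "(\<omega>, x) \<in> \<A>" "0 \<le> d" "d \<le> \<rho>" for \<omega> x d
    using assms(2)[OF that(1)] that by simp
  from perturbed_orbit_in_attractor[OF K assms(1) this \<alpha>_in]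
  have "(\<omega>, \<alpha> \<omega> + -1 * (\<rho> * exp (- K))) \<in> \<A>" by simp
  then have "\<rho> * exp (- K) \<le> 0" by (simp add: mem_A)
  then show False using assms(1) by (simp add: mult_le_0_iff)
qed

lemma graph_range:
  assumes "\<Omega>p = UNIV" "\<M> \<subseteq> UNIV \<times> {r1..r2}"
  shows "(INF \<omega>. \<alpha> \<omega>) = r1" "(SUP \<omega>. \<alpha> \<omega>) = r2"
proof -
  have A: "r1 \<le> x \<and> x \<le> r2" if "(\<omega>, x) \<in> \<A>" for \<omega> x
    using that assms(2) graph_attractor(1)[OF assms(1)] by auto
  have \<alpha>: "r1 \<le> \<alpha> \<omega> \<and> \<alpha> \<omega> \<le> r2" for \<omega> using A[OF \<alpha>_in] .
  have x: "x = \<alpha> \<omega>" if "(\<omega>, x) \<in> \<A>" for \<omega> x using \<Omega>p_unique[of \<omega> x] assms(1) that by blast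
  have ba: "bdd_above (range \<alpha>)" "bdd_below (range \<alpha>)" 
    using \<alpha> bdd_aboveI2[of UNIV \<alpha> r2] bdd_belowI2[of UNIV r1 \<alpha>] by simp_all
  show "(SUP \<omega>. \<alpha> \<omega>) = r2"
  proof (rule ccontr)
    assume n: "(SUP \<omega>. \<alpha> \<omega>) \<noteq> r2"
    have "(SUP \<omega>. \<alpha> \<omega>) \<le> r2" by (rule cSUP_least) (use \<alpha> in auto)
    then have pos: "r2 - (SUP \<omega>. \<alpha> \<omega>) > 0" using n by simp
    show False
      by (rule attractor_reaches_r2[OF pos]) (use A x cSUP_upper[OF UNIV_I ba(1)] in force)
  qed
  show "(INF \<omega>. \<alpha> \<omega>) = r1"
  proof (rule ccontr)
    assume n: "(INF \<omega>. \<alpha> \<omega>) \<noteq> r1"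
    have "r1 \<le> (INF \<omega>. \<alpha> \<omega>)" by (rule cINF_greatest) (use \<alpha> in auto)
    then have pos: "(INF \<omega>. \<alpha> \<omega>) - r1 > 0" using n by simp
    show False
      by (rule attractor_reaches_r1[OF pos]) (use A x cINF_lower[OF ba(2) UNIV_I] in force)
  qed
qed

text \<open>If the two sets were equal, compactness would turn the strict inequality at one end into
  a margin, and the attractor has been shown to leave none.\<close>

lemma M_proper:
  assumes "\<M> \<subseteq> UNIV \<times> {r1..<r2} \<or> \<M> \<subseteq> UNIV \<times> {r1<..r2}"
  shows "\<M> \<noteq> \<A>"
proof
  assume MA: "\<M> = \<A>"
  have sc: "compact (snd ` \<A>)" "snd ` \<A> \<noteq> {}"
    using A_nonempty by (auto intro!: compact_continuous_image continuous_intros A_compact)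
  from assms show False
  proof
    assume s: "\<M> \<subseteq> UNIV \<times> {r1..<r2}"
    obtain m where m: "m \<in> snd ` \<A>" "\<forall>x\<in>snd ` \<A>. x \<le> m" using compact_attains_sup[OF sc] by blast
    have "r2 - m > 0" using m(1) s MA by auto
    then show False
    proof (rule attractor_reaches_r2)
      fix \<omega> x assume "(\<omega>, x) \<in> \<A>"
      then show "r1 \<le> x \<and> x \<le> r2 - (r2 - m)" using m(2) s MA by force
    qed
  next
    assume s: "\<M> \<subseteq> UNIV \<times> {r1<..r2}"
    obtain m where m: "m \<in> snd ` \<A>" "\<forall>x\<in>snd ` \<A>. m \<le> x" using compact_attains_inf[OF sc] by blast
    have "m - r1 > 0" using m(1) s MA by auto
    then show False
    proof (rule attractor_reaches_r1)
      fix \<omega> x assume "(\<omega>, x) \<in> \<A>"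
      then show "r1 + (m - r1) \<le> x \<and> x \<le> r2" using m(2) s MA by force
    qed
  qed
qed

section \<open>Lyapunov exponent and complete measure\<close>

text \<open>In the strip \<open>gx\<close> vanishes, so each exponent is the mean of
  \<open>a\<close> for the projected measure on the base and hence nonpositive. The value 0 is
  attained by a limit of time averages whose own mean of \<open>a\<close> is nonnegative.\<close>

lemma upper_lyapunov_zero:
  assumes sub: "\<M> \<subseteq> UNIV \<times> {r1..r2}"
  shows "upper_lyapunov_exponent \<sigma> f (\<lambda>\<omega> x. a \<omega> + gx \<omega> x) \<M> = 0"
proof -
  have af: "continuous_on \<M> (\<lambda>p. a (fst p))"
    by (rule continuous_on_compose2[OF a_cont]) (auto intro!: continuous_intros)
  have red: "(\<integral>p. a (fst p) + gx (fst p) (snd p) \<partial>\<nu>) = (\<integral>p. a (fst p) \<partial>\<nu>)"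
    and nonpos: "(\<integral>p. a (fst p) \<partial>\<nu>) \<le> 0" if \<nu>: "\<nu> \<in> invariant_probs \<M> \<tau>" for \<nu>
  proof -
    have sets: "sets \<nu> = sets (restrict_space borel \<M>)" and "prob_space \<nu>"
      and meas: "\<tau> t \<in> \<nu> \<rightarrow>\<^sub>M \<nu>" and inv: "distr \<nu> \<nu> (\<tau> t) = \<nu>" for t
      using \<nu> by (auto simp: invariant_probs_def)
    interpret nu: prob_space \<nu> by fact
    have space: "space \<nu> = \<M>" using sets_eq_imp_space_eq[OF sets] by (simp add: space_restrict_space)
    show "(\<integral>p. a (fst p) + gx (fst p) (snd p) \<partial>\<nu>) = (\<integral>p. a (fst p) \<partial>\<nu>)"
    proof (rule Bochner_Integration.integral_cong[OF refl])
      fix p assume "p \<in> space \<nu>"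
      then have "snd p \<in> {r1..r2}" using sub space by auto
      then show "a (fst p) + gx (fst p) (snd p) = a (fst p)" using gx_eq_zero by simp
    qed
    have fstm: "fst \<in> \<nu> \<rightarrow>\<^sub>M borel"
    proof -
      have "continuous_on \<M> fst" by (intro continuous_intros)
      from borel_measurable_continuous_on_restrict[OF this] show ?thesis
        by (simp add: measurable_cong_sets[OF sets refl])
    qed
    define m where "m = distr \<nu> borel fst"
    have ms: "sets m = sets borel" by (simp add: m_def)
    have \<sigma>m: "\<sigma> t \<in> borel \<rightarrow>\<^sub>M borel" for t by (rule borel_measurable_continuous_onI) (intro continuous_intros)
    have "m \<in> invariant_probs UNIV \<sigma>"
      unfolding invariant_probs_def mem_Collect_eq
    proof (intro conjI allI)
      show "prob_space m" unfolding m_def by (rule nu.prob_space_distr[OF fstm])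
      show "sets m = sets (restrict_space borel UNIV)" by (simp add: ms)
      fix t
      show mm: "\<sigma> t \<in> m \<rightarrow>\<^sub>M m" using \<sigma>m by (simp add: measurable_cong_sets[OF ms ms])
      have "distr m m (\<sigma> t) = distr m borel (\<sigma> t)" by (rule distr_cong) (simp_all add: ms)
      also have "\<dots> = distr \<nu> borel (\<sigma> t \<circ> fst)" unfolding m_def by (rule distr_distr[OF \<sigma>m fstm])
      also have "\<sigma> t \<circ> fst = fst \<circ> \<tau> t" by (simp add: fun_eq_iff fst_\<tau>)
      also have "distr \<nu> borel (fst \<circ> \<tau> t) = distr (distr \<nu> \<nu> (\<tau> t)) borel fst"
        by (rule distr_distr[OF fstm meas, symmetric])
      also have "\<dots> = m" by (simp add: inv m_def)
      finally show "distr m m (\<sigma> t) = m" .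
    qed
    then have "(\<integral>\<omega>. a \<omega> \<partial>m) \<le> 0" by (rule mean_a_nonpos)
    moreover have "(\<integral>\<omega>. a \<omega> \<partial>m) = (\<integral>p. a (fst p) \<partial>\<nu>)"
      unfolding m_def by (rule integral_distr[OF fstm borel_measurable_continuous_onI[OF a_cont]])
    ultimately show "(\<integral>p. a (fst p) \<partial>\<nu>) \<le> 0" by simp
  qed
  \<comment> \<open>The time \<open>n + 1\<close> is the length of the \<open>n\<close>-th average,
    so that this average of \<open>a\<close> is \<open>C / (n + 1) \<ge> 0\<close>.\<close>
  have "\<exists>p. \<forall>n. p n \<in> \<M> \<and> C (fst (p n)) (real n + 1) \<ge> 0"
  proof (rule choice, rule allI)
    fix n
    obtain \<omega> where "C \<omega> (real n + 1) \<ge> 0" using C_nonneg_somewhere[of "real n + 1"] by auto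
    then show "\<exists>p. p \<in> \<M> \<and> C (fst p) (real n + 1) \<ge> 0" using M_fibre[of \<omega>] by (metis fst_conv)
  qed
  then obtain p where p: "\<And>n. p n \<in> \<M>" "\<And>n. C (fst (p n)) (real n + 1) \<ge> 0" by blast
  have \<tau>M: "\<tau> t x \<in> \<M>" if "x \<in> \<M>" for t x using skew_invariant_image[OF M_invariant] that by blast
  have \<tau>orbit: "continuous_on UNIV (\<lambda>s. \<tau> s x)" if "x \<in> \<M>" for x
  proof -
    have "(fst x, snd x) \<in> \<A>" using that M_subset_A by auto
    then have "continuous_on UNIV (\<lambda>s. sol \<sigma> f s (fst x) (snd x))"
      by (intro continuous_at_imp_continuous_on ballI solves_isCont[OF A_solves])
    then show ?thesis unfolding skew_flow_def case_prod_beta by (intro continuous_intros)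
  qed
  obtain \<nu> r where \<nu>: "\<nu> \<in> invariant_probs \<M> \<tau>" and
    conv: "\<And>h :: 'w \<times> real \<Rightarrow> real. continuous_on \<M> h \<Longrightarrow>
      (\<lambda>n. \<integral>s. h (\<tau> s (p (r n))) \<partial>time_uniform (real (r n) + 1)) \<longlonglongrightarrow> (\<integral>x. h x \<partial>\<nu>)"
    by (rule krylov_bogoliubov[where p=p, OF M_compact \<tau>M continuous_on_subset[OF \<tau>_continuous M_subset_A] \<tau>orbit
          \<tau>_add[OF subsetD[OF M_subset_A]] p(1)], assumption, assumption, assumption) (rule that)
  have "(\<integral>s. a (fst (\<tau> s (p k))) \<partial>time_uniform (real k + 1)) \<ge> 0" for k
  proof -
    have "(\<integral>s. a (\<sigma> s (fst (p k))) \<partial>time_uniform (real k + 1)) = (C (fst (p k)) (real k + 1) - C (fst (p k)) 0) / (real k + 1)"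
      by (rule integral_time_uniform[OF _ continuous_a_orbit C_deriv]) simp
    then show ?thesis using p(2)[of k] by (simp add: fst_\<tau>)
  qed
  then have "(\<integral>p. a (fst p) \<partial>\<nu>) \<ge> 0" by (intro LIMSEQ_le_const[OF conv[OF af]]) simp
  then have zero: "(\<integral>p. a (fst p) + gx (fst p) (snd p) \<partial>\<nu>) = 0" using nonpos[OF \<nu>] red[OF \<nu>] by simp
  show ?thesis
    unfolding upper_lyapunov_exponent_def
  proof (rule cSup_eq_maximum)
    show "0 \<in> (\<lambda>\<nu>. \<integral>p. a (fst p) + gx (fst p) (snd p) \<partial>\<nu>) ` invariant_probs \<M> \<tau>" using \<nu> zero by force
    show "x \<le> 0" if "x \<in> (\<lambda>\<nu>. \<integral>p. a (fst p) + gx (fst p) (snd p) \<partial>\<nu>) ` invariant_probs \<M> \<tau>" for x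
      using that red nonpos by auto
  qed
qed

text \<open>Sublevel sets are projections of compact pieces of the attractor, hence closed.\<close>

lemma \<alpha>_measurable: "\<alpha> \<in> borel_measurable borel"
proof (rule borel_measurableI_le)
  fix y
  have "closed {p :: 'w \<times> real. snd p \<le> y}" by (intro closed_Collect_le continuous_intros)
  then have "compact (fst ` (\<A> \<inter> {p. snd p \<le> y}))"
    by (intro compact_continuous_image continuous_intros compact_Int_closed A_compact)
  moreover have "{\<omega> \<in> space borel. \<alpha> \<omega> \<le> y} = fst ` (\<A> \<inter> {p. snd p \<le> y})"
  proof (intro set_eqI iffI)
    fix \<omega> assume "\<omega> \<in> {\<omega> \<in> space borel. \<alpha> \<omega> \<le> y}"
    then show "\<omega> \<in> fst ` (\<A> \<inter> {p. snd p \<le> y})" using \<alpha>_in[of \<omega>] by (intro image_eqI[of _ _ "(\<omega>, \<alpha> \<omega>)"]) auto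
  qed (auto simp: mem_A)
  ultimately show "{\<omega> \<in> space borel. \<alpha> \<omega> \<le> y} \<in> sets borel" by (simp add: compact_imp_closed borel_closed)
qed

lemma \<beta>_measurable: "\<beta> \<in> borel_measurable borel"
proof (rule borel_measurableI_ge)
  fix y
  have "closed {p :: 'w \<times> real. y \<le> snd p}" by (intro closed_Collect_le continuous_intros)
  then have "compact (fst ` (\<A> \<inter> {p. y \<le> snd p}))"
    by (intro compact_continuous_image continuous_intros compact_Int_closed A_compact)
  moreover have "{\<omega> \<in> space borel. y \<le> \<beta> \<omega>} = fst ` (\<A> \<inter> {p. y \<le> snd p})"
  proof (intro set_eqI iffI)
    fix \<omega> assume "\<omega> \<in> {\<omega> \<in> space borel. y \<le> \<beta> \<omega>}"
    then show "\<omega> \<in> fst ` (\<A> \<inter> {p. y \<le> snd p})" using \<beta>_in[of \<omega>] by (intro image_eqI[of _ _ "(\<omega>, \<beta> \<omega>)"]) auto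
  qed (auto simp: mem_A)
  ultimately show "{\<omega> \<in> space borel. y \<le> \<beta> \<omega>} \<in> sets borel" by (simp add: compact_imp_closed borel_closed)
qed

text \<open>If \<open>\<alpha> < \<beta>\<close> on a set of positive measure, then \<open>ln (\<beta> - \<alpha>)\<close> grows along the flow strictly less
  than \<open>C\<close> there. Its increments have mean \<open>0\<close> (truncation makes up for its possible lack of integrability),
  whereas those of \<open>C\<close> have nonpositive mean.\<close>

lemma pinched_complete_measure:
  assumes "r1 = r2"
  shows "has_complete_measure \<sigma> \<Omega>p"
  unfolding has_complete_measure_def
proof (intro conjI ballI)
  have "\<Omega>p = {\<omega> \<in> space borel. \<alpha> \<omega> = \<beta> \<omega>}" by (simp add: \<Omega>p_def)
  then show \<Omega>b: "\<Omega>p \<in> sets borel" using borel_measurable_eq[OF \<alpha>_measurable \<beta>_measurable] by simp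
  fix m assume m: "m \<in> invariant_probs UNIV \<sigma>"
  interpret m: prob_space m by (rule invariant_prob_base(1)[OF m])
  have mb: "F \<in> borel_measurable m" if "F \<in> borel_measurable borel" for F :: "'w \<Rightarrow> real"
    using that by (simp add: measurable_cong_sets[OF invariant_prob_base(2)[OF m] refl])
  define v where "v \<omega> = \<beta> \<omega> - \<alpha> \<omega>" for \<omega>
  define E where "E = - \<Omega>p"
  have E: "E \<in> sets borel" using \<Omega>b by (simp add: E_def borel_comp)
  have Einv: "\<sigma> t \<omega> \<in> E \<longleftrightarrow> \<omega> \<in> E" for \<omega> t
    using \<Omega>p_invariant[of \<omega> t] \<Omega>p_invariant[of "\<sigma> t \<omega>" "- t"] by (auto simp: E_def)
  have Ev: "\<omega> \<in> E \<longleftrightarrow> v \<omega> > 0" for \<omega> using \<alpha>_le_\<beta>[of \<omega>] by (auto simp: E_def \<Omega>p_def v_def)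
  have vR: "v \<omega> \<le> 2 * R" for \<omega>
  proof -
    have "\<bar>\<alpha> \<omega>\<bar> \<le> R" "\<bar>\<beta> \<omega>\<bar> \<le> R" using R_bound \<alpha>_in \<beta>_in by blast+
    then show ?thesis by (simp add: v_def)
  qed
  \<comment> \<open>With the value 0 where the gap vanishes, the increment \<open>\<psi>\<close> is
    0 off the invariant set \<open>E\<close>.\<close>
  define \<phi> where "\<phi> \<omega> = (if v \<omega> > 0 then ln (v \<omega>) else 0)" for \<omega>
  define \<psi> where "\<psi> \<omega> = \<phi> (\<sigma> 1 \<omega>) - \<phi> \<omega>" for \<omega>
  obtain L where L: "L > 0" "\<And>\<omega> x y. \<bar>x\<bar> \<le> R \<Longrightarrow> \<bar>y\<bar> \<le> R \<Longrightarrow> \<bar>f \<omega> x - f \<omega> y\<bar> \<le> L * \<bar>x - y\<bar>"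
    using f_lipschitz by metis
  \<comment> \<open>In unit time the gap changes at most by the factor \<open>exp L\<close> either
    way, so \<open>\<psi>\<close> is bounded even where \<open>\<phi>\<close> is not bounded
    below.\<close>
  have growth: "v (\<sigma> q \<omega>) \<le> exp (L * \<bar>q - p\<bar>) * v (\<sigma> p \<omega>)" for p q \<omega>
  proof -
    have "(\<lambda>s. v (\<sigma> s \<omega>)) q + 0 \<le> exp (L * \<bar>q - p\<bar>) * ((\<lambda>s. v (\<sigma> s \<omega>)) p + 0)"
    proof (rule gronwall_segment)
      fix s
      show "((\<lambda>s. v (\<sigma> s \<omega>)) has_real_derivative f (\<sigma> s \<omega>) (\<beta> (\<sigma> s \<omega>)) - f (\<sigma> s \<omega>) (\<alpha> (\<sigma> s \<omega>))) (at s)"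
        unfolding v_def using \<alpha>_solves[of \<omega> s] \<beta>_solves[of \<omega> s] unfolding solves_def by (rule DERIV_diff[rotated])
      show "\<bar>f (\<sigma> s \<omega>) (\<beta> (\<sigma> s \<omega>)) - f (\<sigma> s \<omega>) (\<alpha> (\<sigma> s \<omega>))\<bar> \<le> L * (v (\<sigma> s \<omega>) + 0)"
        using L(2)[OF R_bound[OF \<beta>_in] R_bound[OF \<alpha>_in], of "\<sigma> s \<omega>" "\<sigma> s \<omega>" "\<sigma> s \<omega>"] \<alpha>_le_\<beta>[of "\<sigma> s \<omega>"] by (simp add: v_def)
    qed
    then show ?thesis by simp
  qed
  have \<psi>L: "\<bar>\<psi> \<omega>\<bar> \<le> L" for \<omega>
  proof (cases "\<omega> \<in> E")
    case True
    then have p: "v \<omega> > 0" "v (\<sigma> 1 \<omega>) > 0" using Einv Ev by blast+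
    have "ln (v (\<sigma> 1 \<omega>)) \<le> ln (exp L * v \<omega>)" using growth[of 1 \<omega> 0] p by simp
    moreover have "ln (v \<omega>) \<le> ln (exp L * v (\<sigma> 1 \<omega>))" using growth[of 0 \<omega> 1] p by simp
    ultimately show ?thesis using p by (simp add: \<psi>_def \<phi>_def ln_mult abs_le_iff)
  next
    case False
    then have "\<not> v \<omega> > 0" "\<not> v (\<sigma> 1 \<omega>) > 0" using Einv Ev by blast+
    then show ?thesis using L(1) by (simp add: \<psi>_def \<phi>_def)
  qed
  have strict: "\<psi> \<omega> < C \<omega> 1" if "\<omega> \<in> E" for \<omega>
  proof -
    have p: "v (\<sigma> s \<omega>) > 0" for s using that Einv Ev by blast
    then have ab: "\<alpha> (\<sigma> s \<omega>) < \<beta> (\<sigma> s \<omega>)" for s by (simp add: v_def)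
    have "(\<lambda>s. ln (\<beta> (\<sigma> s \<omega>) - \<alpha> (\<sigma> s \<omega>)) - C \<omega> s) 1 < (\<lambda>s. ln (\<beta> (\<sigma> s \<omega>) - \<alpha> (\<sigma> s \<omega>)) - C \<omega> s) 0"
    proof (rule DERIV_neg_imp_decreasing[of 0 1])
      fix s :: real
      let ?q = "(g (\<sigma> s \<omega>) (\<beta> (\<sigma> s \<omega>)) - g (\<sigma> s \<omega>) (\<alpha> (\<sigma> s \<omega>))) / (\<beta> (\<sigma> s \<omega>) - \<alpha> (\<sigma> s \<omega>))"
      \<comment> \<open>As the strip is a single point, two distinct values cannot both lie in it;
        the decrease is therefore strict at every time.\<close>
      have "\<alpha> (\<sigma> s \<omega>) < r1 \<or> \<beta> (\<sigma> s \<omega>) > r2" using ab[of s] assms by linarith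
      then have "g (\<sigma> s \<omega>) (\<beta> (\<sigma> s \<omega>)) < g (\<sigma> s \<omega>) (\<alpha> (\<sigma> s \<omega>))" by (rule g_strict[OF ab])
      then have "?q < 0" using ab[of s] by (intro divide_neg_pos) auto
      moreover have "((\<lambda>s. ln (\<beta> (\<sigma> s \<omega>) - \<alpha> (\<sigma> s \<omega>)) - C \<omega> s) has_real_derivative ?q) (at s)"
        by (rule log_gap_deriv[OF \<alpha>_solves \<beta>_solves ab])
      ultimately show "\<exists>y. ((\<lambda>s. ln (\<beta> (\<sigma> s \<omega>) - \<alpha> (\<sigma> s \<omega>)) - C \<omega> s) has_real_derivative y) (at s) \<and> y < 0"
        by blast
    qed simp
    then show ?thesis using p[of 0] p[of 1] by (simp add: \<psi>_def \<phi>_def v_def)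
  qed
  have vm: "v \<in> borel_measurable borel" unfolding v_def using \<alpha>_measurable \<beta>_measurable by measurable
  have \<phi>m: "\<phi> \<in> borel_measurable borel" unfolding \<phi>_def using vm by measurable
  have \<sigma>m: "\<sigma> 1 \<in> borel \<rightarrow>\<^sub>M borel" by (rule borel_measurable_continuous_onI) (intro continuous_intros)
  have \<psi>m: "\<psi> \<in> borel_measurable borel" unfolding \<psi>_def using \<phi>m \<sigma>m by measurable
  \<comment> \<open>Only a cut from below is needed, \<open>\<phi>\<close> being bounded above
    through \<open>R\<close>. Taking a maximum with a constant does not enlarge differences, so
    \<open>L\<close> dominates all the truncated increments.\<close>
  define T where "T k \<omega> = max (\<phi> \<omega>) (- real k)" for k :: nat and \<omega>
  have Tm: "T k \<in> borel_measurable borel" for k unfolding T_def using \<phi>m by measurable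
  have Tm': "(\<lambda>\<omega>. T k (\<sigma> 1 \<omega>)) \<in> borel_measurable borel" for k using Tm \<sigma>m by measurable
  have Tb: "\<bar>T k \<omega>\<bar> \<le> real k + 2 * \<bar>R\<bar>" for k \<omega>
  proof -
    have "\<phi> \<omega> \<le> 2 * \<bar>R\<bar>" using vR[of \<omega>] ln_le_minus_one[of "v \<omega>"] by (auto simp: \<phi>_def)
    then show ?thesis by (auto simp: T_def)
  qed
  have Ti: "integrable m (T k)" for k
    by (rule m.integrable_const_bound[of _ "real k + 2 * \<bar>R\<bar>"]) (use Tb mb[OF Tm] in auto)
  have Ti': "integrable m (\<lambda>\<omega>. T k (\<sigma> 1 \<omega>))" for k
    by (rule m.integrable_const_bound[of _ "real k + 2 * \<bar>R\<bar>"]) (use Tb mb[OF Tm'] in auto)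
  have "(\<lambda>k. \<integral>\<omega>. T k (\<sigma> 1 \<omega>) - T k \<omega> \<partial>m) \<longlonglongrightarrow> (\<integral>\<omega>. \<psi> \<omega> \<partial>m)"
  proof (rule integral_dominated_convergence[where w="\<lambda>_. L"])
    show "\<psi> \<in> borel_measurable m" by (rule mb[OF \<psi>m])
    show "(\<lambda>\<omega>. T k (\<sigma> 1 \<omega>) - T k \<omega>) \<in> borel_measurable m" for k
      by (intro borel_measurable_diff mb Tm Tm')
    show "AE \<omega> in m. norm (T k (\<sigma> 1 \<omega>) - T k \<omega>) \<le> L" for k
    proof (rule AE_I2)
      fix \<omega>
      have "\<bar>T k (\<sigma> 1 \<omega>) - T k \<omega>\<bar> \<le> \<bar>\<psi> \<omega>\<bar>" by (auto simp: T_def \<psi>_def)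
      then show "norm (T k (\<sigma> 1 \<omega>) - T k \<omega>) \<le> L" using \<psi>L[of \<omega>] by simp
    qed
    show "AE \<omega> in m. (\<lambda>k. T k (\<sigma> 1 \<omega>) - T k \<omega>) \<longlonglongrightarrow> \<psi> \<omega>"
    proof (rule AE_I2)
      fix \<omega>
      have Tlim: "(\<lambda>k. T k w) \<longlonglongrightarrow> \<phi> w" for w
      proof -
        obtain k0 where "real k0 \<ge> - \<phi> w" using real_arch_simple by blast
        then have "T k w = \<phi> w" if "k \<ge> k0" for k using that by (auto simp: T_def max_def)
        then have "\<forall>\<^sub>F k in sequentially. T k w = \<phi> w" using eventually_sequentially by blast
        then show ?thesis by (rule tendsto_eventually)
      qed
      show "(\<lambda>k. T k (\<sigma> 1 \<omega>) - T k \<omega>) \<longlonglongrightarrow> \<psi> \<omega>" unfolding \<psi>_def by (intro tendsto_diff Tlim)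
    qed
  qed simp
  moreover have "(\<integral>\<omega>. T k (\<sigma> 1 \<omega>) - T k \<omega> \<partial>m) = 0" for k
    using integral_invariant[OF m mb[OF Tm[of k]], of 1] by (simp add: Bochner_Integration.integral_diff[OF Ti' Ti])
  ultimately have \<psi>0: "(\<integral>\<omega>. \<psi> \<omega> \<partial>m) = 0" by (simp add: LIMSEQ_const_iff)
  have \<psi>i: "integrable m \<psi>" by (rule m.integrable_const_bound[of _ L]) (use \<psi>L mb[OF \<psi>m] in auto)
  have Cm: "(\<lambda>\<omega>. indicator E \<omega> * C \<omega> 1) \<in> borel_measurable borel"
    by (intro borel_measurable_times borel_measurable_indicator E borel_measurable_continuous_onI C_cont)
  have Ci: "integrable m (\<lambda>\<omega>. indicator E \<omega> * C \<omega> 1)"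
    by (rule m.integrable_const_bound[of _ "a_max"])
       (use mb[OF Cm] C_bound[of _ 1] a_max[of undefined] in \<open>auto simp: indicator_def\<close>)
  \<comment> \<open>Nonnegative everywhere and positive exactly on \<open>E\<close>; mean 0 then
    makes \<open>E\<close> a null set.\<close>
  define D where "D \<omega> = indicator E \<omega> * C \<omega> 1 - \<psi> \<omega>" for \<omega>
  have Di: "integrable m D" unfolding D_def by (rule Bochner_Integration.integrable_diff[OF Ci \<psi>i])
  have \<psi>E: "\<psi> \<omega> = 0" if "\<omega> \<notin> E" for \<omega>
  proof -
    have "\<not> v \<omega> > 0" "\<not> v (\<sigma> 1 \<omega>) > 0" using that Einv Ev by blast+
    then show ?thesis by (simp add: \<psi>_def \<phi>_def)
  qed
  have Dpos: "0 \<le> D \<omega>" "\<omega> \<in> E \<Longrightarrow> 0 < D \<omega>" for \<omega>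
    using strict[of \<omega>] \<psi>E[of \<omega>] by (cases "\<omega> \<in> E"; simp add: D_def)+
  have "(\<integral>\<omega>. D \<omega> \<partial>m) = (\<integral>\<omega>. indicator E \<omega> * C \<omega> 1 \<partial>m) - (\<integral>\<omega>. \<psi> \<omega> \<partial>m)"
    unfolding D_def by (rule Bochner_Integration.integral_diff[OF Ci \<psi>i])
  moreover have "(\<integral>\<omega>. indicator E \<omega> * C \<omega> 1 \<partial>m) \<le> 0" by (rule cocycle_mean_nonpos[OF m E Einv]) simp
  ultimately have "(\<integral>\<omega>. D \<omega> \<partial>m) \<le> 0" using \<psi>0 by simp
  moreover have "(\<integral>\<omega>. D \<omega> \<partial>m) \<ge> 0" by (rule Bochner_Integration.integral_nonneg) (rule Dpos)
  ultimately have "(\<integral>\<omega>. D \<omega> \<partial>m) = 0" by simp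
  then have "AE \<omega> in m. D \<omega> = 0" using integral_nonneg_eq_0_iff_AE[OF Di] Dpos(1) by simp
  then have "AE \<omega> in m. \<omega> \<in> \<Omega>p"
  proof (rule AE_mp, intro AE_I2 impI)
    fix \<omega> assume "D \<omega> = 0"
    then have "\<omega> \<notin> E" using Dpos(2)[of \<omega>] by linarith
    then show "\<omega> \<in> \<Omega>p" by (simp add: E_def)
  qed
  moreover have "\<Omega>p \<in> sets m" using \<Omega>b invariant_prob_base(2)[OF m] by simp
  ultimately show "measure m \<Omega>p = 1" by (simp add: m.prob_eq_1)
qed

end

theorem theorem3p11:
  fixes \<sigma> :: "real \<Rightarrow> 'w::metric_space \<Rightarrow> 'w"
    and a b :: "'w \<Rightarrow> real"
    and g gx f :: "'w \<Rightarrow> real \<Rightarrow> real"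
    and r1 r2 :: real
    and \<A> :: "('w \<times> real) set"
    and \<alpha> \<beta> :: "'w \<Rightarrow> real"
    and \<Omega>c :: "'w set"
  assumes compact_base: "compact (UNIV :: 'w set)"
    and flow: "continuous_flow \<sigma>"
    and minimal: "minimal_set (flow_invariant \<sigma>) UNIV"
    and a_cont: "continuous_on UNIV a"
    and b_cont: "continuous_on UNIV b"
    and g_deriv: "\<And>\<omega> x. ((\<lambda>y. g \<omega> y) has_real_derivative gx \<omega> x) (at x)"
    and g_cont: "continuous_on UNIV (\<lambda>(\<omega>, x). g \<omega> x)"
    and gx_cont: "continuous_on UNIV (\<lambda>(\<omega>, x). gx \<omega> x)"
    and r_le: "r1 \<le> r2"
    and g_zero: "\<And>\<omega> x. r1 \<le> x \<Longrightarrow> x \<le> r2 \<Longrightarrow> g \<omega> x = 0"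
    and g_pos: "\<And>\<omega> x. x < r1 \<Longrightarrow> g \<omega> x > 0"
    and g_neg: "\<And>\<omega> x. x > r2 \<Longrightarrow> g \<omega> x < 0"
    and gx_zero: "r1 = r2 \<Longrightarrow> (\<And>\<omega>. gx \<omega> r1 = 0)"
    and g_lim_top: "\<And>B. \<forall>\<^sub>F x in at_top. \<forall>\<omega>. g \<omega> x / x < B"
    and g_lim_bot: "\<And>B. \<forall>\<^sub>F x in at_bot. \<forall>\<omega>. g \<omega> x / x < B"
    and gx_neg: "\<And>\<omega> x. x \<notin> {r1..r2} \<Longrightarrow> gx \<omega> x < 0"
    and f_eq: "f = (\<lambda>\<omega> x. a \<omega> * x + b \<omega> + g \<omega> x)"
    and attractor: "global_attractor \<sigma> f \<A>"
    and attractor_form: "\<A> = (\<Union>\<omega>. {\<omega>} \<times> {\<alpha> \<omega>..\<beta> \<omega>})"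
    and \<Omega>c_eq: "\<Omega>c = {\<omega>. isCont \<alpha> \<omega> \<and> isCont \<beta> \<omega>}"
    and spectrum: "Sup (sacker_sell_spectrum \<sigma> a) = 0"
    and pinched: "pinched \<A>"
  shows "\<Omega>c = {\<omega>. \<alpha> \<omega> = \<beta> \<omega>} \<and>
    (\<exists>\<M>.
      (\<forall>\<omega>\<^sub>0\<in>\<Omega>c. orbit_closure \<sigma> \<alpha> \<omega>\<^sub>0 = \<M> \<and> orbit_closure \<sigma> \<beta> \<omega>\<^sub>0 = \<M>) \<and>
      (\<forall>K. minimal_set (skew_invariant \<sigma> f) K \<longleftrightarrow> K = \<M>) \<and>
      \<comment> \<open>(i)\<close>
      (\<not> \<M> \<subseteq> UNIV \<times> {r1..r2} \<longleftrightarrow> (\<exists>\<omega>\<in>\<Omega>c. \<alpha> \<omega> < r1 \<or> \<beta> \<omega> > r2)) \<and>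
      (\<not> \<M> \<subseteq> UNIV \<times> {r1..r2} \<longrightarrow>
         \<A> = \<M> \<and> unif_exp_stable \<sigma> f \<M> \<and> copy_of_base \<sigma> f \<M> \<and>
         continuous_on UNIV \<alpha> \<and> \<alpha> = \<beta> \<and> \<M> = graph_of \<alpha>) \<and>
      \<comment> \<open>(ii)\<close>
      (\<M> \<subseteq> UNIV \<times> {r1..r2} \<longrightarrow>
         upper_lyapunov_exponent \<sigma> f (\<lambda>\<omega> x. a \<omega> + gx \<omega> x) \<M> = 0) \<and>
      \<comment> \<open>(iii)\<close>
      (\<M> \<subseteq> UNIV \<times> {r1..r2} \<and> has_continuous_primitive \<sigma> a \<longrightarrow>
         \<A> = \<M> \<and> copy_of_base \<sigma> f \<M> \<and> \<M> = graph_of \<alpha> \<and> \<M> = graph_of \<beta> \<and>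
         (INF \<omega>. \<alpha> \<omega>) = r1 \<and> (SUP \<omega>. \<alpha> \<omega>) = r2) \<and>
      \<comment> \<open>(iv)\<close>
      (r1 = r2 \<and> \<M> = UNIV \<times> {r1} \<longrightarrow> has_complete_measure \<sigma> \<Omega>c) \<and>
      \<comment> \<open>(v)\<close>
      (r1 < r2 \<and> (\<M> \<subseteq> UNIV \<times> {r1..<r2} \<or> \<M> \<subseteq> UNIV \<times> {r1<..r2}) \<longrightarrow>
         \<not> has_continuous_primitive \<sigma> a \<and> \<M> \<subset> \<A> \<and> \<Omega>c \<subset> UNIV)) \<and>
    \<comment> \<open>(vi)\<close>
    chain_recurrent sum_dist \<A> (skew_flow \<sigma> f)"
  proof -
  interpret pinched_attractor \<sigma> a b g gx f r1 r2 \<A> \<alpha> \<beta>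
    by unfold_locales (fact compact_base flow minimal a_cont spectrum b_cont g_deriv g_cont gx_cont r_le g_zero
        gx_zero g_lim_top g_lim_bot gx_neg f_eq attractor attractor_form pinched)+
  have \<Omega>c: "\<Omega>c = \<Omega>p" using \<Omega>c_eq common_continuity_points by simp
  show ?thesis
  proof (intro conjI exI[of _ \<M>])
    show "\<Omega>c = {\<omega>. \<alpha> \<omega> = \<beta> \<omega>}" by (simp add: \<Omega>c \<Omega>p_def)
    show "\<forall>\<omega>\<^sub>0\<in>\<Omega>c. orbit_closure \<sigma> \<alpha> \<omega>\<^sub>0 = \<M> \<and> orbit_closure \<sigma> \<beta> \<omega>\<^sub>0 = \<M>"
      using orbit_closure_eq orbit_closure_\<beta>_eq by (simp add: \<Omega>c)
    show "\<forall>K. minimal_set (skew_invariant \<sigma> f) K \<longleftrightarrow> K = \<M>" using M_minimal by simp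
    show "\<not> \<M> \<subseteq> UNIV \<times> {r1..r2} \<longleftrightarrow> (\<exists>\<omega>\<in>\<Omega>c. \<alpha> \<omega> < r1 \<or> \<beta> \<omega> > r2)"
      unfolding \<Omega>c by (rule M_section_iff)
    show "\<not> \<M> \<subseteq> UNIV \<times> {r1..r2} \<longrightarrow>
         \<A> = \<M> \<and> unif_exp_stable \<sigma> f \<M> \<and> copy_of_base \<sigma> f \<M> \<and>
         continuous_on UNIV \<alpha> \<and> \<alpha> = \<beta> \<and> \<M> = graph_of \<alpha>"
    proof
      assume "\<not> \<M> \<subseteq> UNIV \<times> {r1..r2}"
      then have "\<exists>\<omega>\<in>\<Omega>p. \<alpha> \<omega> < r1 \<or> \<beta> \<omega> > r2" by (simp only: M_section_iff)
      then obtain \<omega> where \<omega>: "\<omega> \<in> \<Omega>p" "\<alpha> \<omega> \<notin> {r1..r2}" by (auto simp: \<Omega>p_def)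
      note full = hyperbolic_case[OF \<omega>]
      have "\<A> = \<M>" by (rule graph_attractor(1)[OF full(1)])
      moreover from this full(2) have "unif_exp_stable \<sigma> f \<M>" by simp
      ultimately show "\<A> = \<M> \<and> unif_exp_stable \<sigma> f \<M> \<and> copy_of_base \<sigma> f \<M> \<and>
         continuous_on UNIV \<alpha> \<and> \<alpha> = \<beta> \<and> \<M> = graph_of \<alpha>"
        using graph_attractor(2,3,5,6)[OF full(1)] by blast
    qed
    show "\<M> \<subseteq> UNIV \<times> {r1..r2} \<longrightarrow>
         upper_lyapunov_exponent \<sigma> f (\<lambda>\<omega> x. a \<omega> + gx \<omega> x) \<M> = 0"
      using upper_lyapunov_zero by blast
    show "\<M> \<subseteq> UNIV \<times> {r1..r2} \<and> has_continuous_primitive \<sigma> a \<longrightarrow>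
         \<A> = \<M> \<and> copy_of_base \<sigma> f \<M> \<and> \<M> = graph_of \<alpha> \<and> \<M> = graph_of \<beta> \<and>
         (INF \<omega>. \<alpha> \<omega>) = r1 \<and> (SUP \<omega>. \<alpha> \<omega>) = r2"
      using graph_attractor(1,3,4,6)[OF primitive_collapses] graph_range[OF primitive_collapses] by blast
    show "r1 = r2 \<and> \<M> = UNIV \<times> {r1} \<longrightarrow> has_complete_measure \<sigma> \<Omega>c"
      using pinched_complete_measure by (simp add: \<Omega>c)
    show "r1 < r2 \<and> (\<M> \<subseteq> UNIV \<times> {r1..<r2} \<or> \<M> \<subseteq> UNIV \<times> {r1<..r2}) \<longrightarrow>
         \<not> has_continuous_primitive \<sigma> a \<and> \<M> \<subset> \<A> \<and> \<Omega>c \<subset> UNIV"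
    proof
      assume "r1 < r2 \<and> (\<M> \<subseteq> UNIV \<times> {r1..<r2} \<or> \<M> \<subseteq> UNIV \<times> {r1<..r2})"
      then have ne: "\<M> \<noteq> \<A>" by (intro M_proper) blast
      \<comment> \<open>If all points were pinched, the attractor would equal \<open>\<M>\<close>; a
        primitive would make all points pinched. So the three claims follow from
        \<open>ne\<close>.\<close>
      then have "\<Omega>p \<noteq> UNIV" using graph_attractor(1) by metis
      then show "\<not> has_continuous_primitive \<sigma> a \<and> \<M> \<subset> \<A> \<and> \<Omega>c \<subset> UNIV"
        using primitive_collapses ne M_subset_A unfolding \<Omega>c by blast
    qed
    show "chain_recurrent sum_dist \<A> (skew_flow \<sigma> f)" by (rule chain_recurrent_attractor)
  qed
qed

end
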